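(* Let $n\ge 1$ and $1\le J\le n$. With the discrete spaces $V_h^{k,l}:=\mathscr{S}^{\vec p}_{\vec{\mathbf r}}\Lambda^{k,l}$, and the discrete BGG complex $$0\to \Upsilon_h^0\xrightarrow{\mathscr D^0}\Upsilon_h^1\xrightarrow{\mathscr D^1}\cdots\xrightarrow{\mathscr D^{n-1}}\Upsilon_h^n\to 0$$ defined in the context, the dimension of the cohomology of the BGG complex is bounded by that of the two input complexes: for every $0\le k\le n$, $$\dim \mathscr H^k(\Upsilon_h^{\bullet},\mathscr D^{\bullet})\le \dim \mathscr H^k(V_h^{\bullet,J-1},d^{\bullet})+\dim\mathscr H^k(V_h^{\bullet,J},d^{\bullet}).$$
   Context: **Algebra.** $\mathrm{Alt}^k=\mathrm{Alt}^k\mathbb R^n$ is the space of alternating $k$-linear forms on $\mathbb R^n$ ($\mathrm{Alt}^k=0$ if $k<0$ or $k>n$), and $\mathrm{Alt}^{k,l}=\mathrm{Alt}^k\otimes\mathrm{Alt}^l$. For $\sigma=\{\sigma_1<\dots<\sigma_k\}\subset\{1,\dots,n\}$ let $dx^\sigma=dx^{\sigma_1}\wedge\cdots\wedge dx^{\sigma_k}$, and let $\chi_m(\sigma)=1$ if $m\in\sigma$ and $0$ otherwise. $\mathrm{Alt}^{k,l}$ carries the inner product in which the forms $dx^\sigma\otimes dx^\tau$ ($|\sigma|=k$, $|\tau|=l$) are orthonormal. The linear map $s^{k,l}:\mathrm{Alt}^{k,l}\to\mathrm{Alt}^{k+1,l-1}$ is $$s^{k,l}\mu(v_0,\dots,v_k)(w_1,\dots,w_{l-1})=\sum_{i=0}^{k}(-1)^i\mu(v_0,\dots,\widehat{v_i},\dots,v_k)(v_i,w_1,\dots,w_{l-1}).$$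 **One-dimensional spaces.** Let $\mathcal I=[0,1]$. For each coordinate direction $m=1,\dots,n$ there are given finite-dimensional subspaces $\mathcal S^{p_m-a}_{\mathbf r_m-a}\subset L^2(\mathcal I)$, $a=0,1,2$ (here the "degree" $p_m$ and the "smoothness" $\mathbf r_m$ are just abstract labels), such that for $a=0,1$ the (weak) derivative is defined on $\mathcal S^{p_m-a}_{\mathbf r_m-a}$ and maps it onto $\mathcal S^{p_m-a-1}_{\mathbf r_m-a-1}$. **Tensor product spaces.** $V_h^{k,l}=\mathscr{S}^{\vec p}_{\vec{\mathbf r}}\Lambda^{k,l}\subset L^2(\mathcal I^n)\otimes \mathrm{Alt}^{k,l}$ is $$V_h^{k,l}=\bigoplus_{|\sigma|=k,\ |\tau|=l}\Bigl(\bigotimes_{m=1}^n\mathcal S^{p_m-\chi_m(\sigma)-\chi_m(\tau)}_{\mathbf r_m-\chi_m(\sigma)-\chi_m(\tau)}\Bigr)\,dx^\sigma\otimes dx^\tau .$$ The exterior derivative $d^k:V_h^{k,l}\to V_h^{k+1,l}$ is $d^k(f\,dx^\sigma\otimes dx^\tau)=\sum_{m=1}^n\partial_m f\,(dx^m\wedge dx^\sigma)\otimes dx^\tau$, with $d^n=0$. The map $S^{k,l}=I\otimes s^{k,l}$ acts only on the form part and maps $V_h^{k,l}$ into $V_h^{k+1,l-1}$; $S^{J-1,J}:V_h^{J-1,J}\to V_h^{J,J-1}$ is bijective. Orthogonality is with respect to the $L^2$ inner product on $L^2(\mathcal I^n)\otimes\mathrm{Alt}^{k,l}$. **Discrete BGG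 complex.** With $\mathcal R(\cdot)$ the range and $\mathcal N(\cdot)$ the kernel (and $S^{-1,J}=0$), $$\Upsilon_h^i=\begin{cases}\mathcal R(S^{i-1,J})^\perp\subset V_h^{i,J-1}, & 0\le i\le J-1,\\ \mathcal N(S^{i,J})\subset V_h^{i,J}, & J\le i\le n,\end{cases}$$ $$\mathscr D^i=\begin{cases}P_{\mathcal R(S^{i,J})^\perp}\,d^i, & 0\le i<J-1,\\ d^{J-1}\circ(S^{J-1,J})^{-1}\circ d^{J-1}, & i=J-1,\\ d^i, & J\le i\le n,\end{cases}$$ where $P_{\mathcal R(S^{i,J})^\perp}$ is the $L^2$-orthogonal projection of $V_h^{i+1,J-1}$ onto $\mathcal R(S^{i,J})^\perp$. For a complex $(A^\bullet,\delta^\bullet)$, $\mathscr H^k(A^\bullet,\delta^\bullet)=\ker\delta^k/\operatorname{ran}\delta^{k-1}$. *)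

theory Defs
  imports "HOL-Analysis.Analysis" "HOL-Library.Function_Algebras"
begin

section \<open>The Hilbert space of square-integrable functions on the unit cube\<close>

text \<open>
  The cube is \<open>cbox 0 One\<close>: the interval \<open>{0..1}\<close> for type \<open>real\<close>, and
  \<open>{0..1}\<close> to the power \<open>CARD('n)\<close> for type \<open>real ^ 'n\<close>.
\<close>

definition cube_measure :: "'a::euclidean_space measure" where
  "cube_measure = restrict_space lborel (cbox 0 One)"

definition square_integrable :: "('a::euclidean_space \<Rightarrow> real) \<Rightarrow> bool" where
  "square_integrable f \<longleftrightarrow>
     f \<in> borel_measurable cube_measure \<and> integrable cube_measure (\<lambda>x. (f x)\<^sup>2)"

definition L2_rel :: "('a::euclidean_space \<Rightarrow> real) \<Rightarrow> ('a \<Rightarrow> real) \<Rightarrow> bool" where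
  "L2_rel f g \<longleftrightarrow> square_integrable f \<and> square_integrable g \<and> (AE x in cube_measure. f x = g x)"

lemma square_integrable_zero [simp]: "square_integrable (\<lambda>x. 0)"
  by (simp add: square_integrable_def)

lemma square_integrable_mult:
  assumes "square_integrable f" "square_integrable g"
  shows "integrable cube_measure (\<lambda>x. f x * g x)"
proof (rule Bochner_Integration.integrable_bound)
  show "integrable cube_measure (\<lambda>x. (f x)\<^sup>2 + (g x)\<^sup>2)"
    using assms by (auto simp: square_integrable_def)
  show "(\<lambda>x. f x * g x) \<in> borel_measurable cube_measure"
    using assms by (auto simp: square_integrable_def)
  have "\<bar>a * b\<bar> \<le> a\<^sup>2 + b\<^sup>2" for a b :: real
  proof -
    have "0 \<le> (\<bar>a\<bar> - \<bar>b\<bar>)\<^sup>2" by simp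
    then have "2 * (\<bar>a\<bar> * \<bar>b\<bar>) \<le> a\<^sup>2 + b\<^sup>2" by (simp add: power2_diff)
    moreover have "0 \<le> \<bar>a\<bar> * \<bar>b\<bar>" by simp
    ultimately show ?thesis unfolding abs_mult by linarith
  qed
  then show "AE x in cube_measure. norm (f x * g x) \<le> norm ((f x)\<^sup>2 + (g x)\<^sup>2)"
    by (intro always_eventually allI) (metis abs_of_nonneg real_norm_def sum_power2_ge_zero)
qed

lemma square_integrable_add:
  assumes "square_integrable f" "square_integrable g"
  shows "square_integrable (\<lambda>x. f x + g x)"
  using assms square_integrable_mult[OF assms]
  by (auto simp: square_integrable_def power2_sum mult.assoc)

lemma square_integrable_scale:
  "square_integrable f \<Longrightarrow> square_integrable (\<lambda>x. c * f x)"
  by (auto simp: square_integrable_def power_mult_distrib)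

quotient_type (overloaded) 'a L2 = "'a::euclidean_space \<Rightarrow> real" / partial: L2_rel
proof (rule part_equivpI)
  show "\<exists>f. L2_rel f f" by (rule exI[of _ "\<lambda>x. 0"]) (simp add: L2_rel_def)
  show "symp L2_rel" by (auto simp: symp_def L2_rel_def elim: eventually_mono)
  show "transp L2_rel" by (auto simp: transp_def L2_rel_def elim: eventually_elim2)
qed

instantiation L2 :: (euclidean_space) real_vector
begin

lift_definition zero_L2 :: "'a L2" is "\<lambda>x. 0"
  by (simp add: L2_rel_def)

lift_definition plus_L2 :: "'a L2 \<Rightarrow> 'a L2 \<Rightarrow> 'a L2" is "\<lambda>f g x. f x + g x"
  by (auto simp: L2_rel_def intro: square_integrable_add elim: eventually_elim2)

lift_definition scaleR_L2 :: "real \<Rightarrow> 'a L2 \<Rightarrow> 'a L2" is "\<lambda>c f x. c * f x"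
  by (auto simp: L2_rel_def intro: square_integrable_scale elim: eventually_mono)

definition uminus_L2 :: "'a L2 \<Rightarrow> 'a L2" where "uminus_L2 f = (-1) *\<^sub>R f"

definition minus_L2 :: "'a L2 \<Rightarrow> 'a L2 \<Rightarrow> 'a L2" where "minus_L2 f g = f + (-1) *\<^sub>R g"

instance
proof
  fix a b :: real and f g h :: "'a L2"
  show "f + g + h = f + (g + h)"
    by transfer (auto simp: L2_rel_def add.assoc intro!: square_integrable_add)
  show "f + g = g + f"
    by transfer (auto simp: L2_rel_def add.commute intro!: square_integrable_add)
  show "0 + f = f" by transfer (auto simp: L2_rel_def)
  show "- f + f = 0"
    unfolding uminus_L2_def
    by transfer (auto simp: L2_rel_def)
  show "f - g = f + - g" by (simp add: minus_L2_def uminus_L2_def)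
  show "a *\<^sub>R (f + g) = a *\<^sub>R f + a *\<^sub>R g"
    by transfer (auto simp: L2_rel_def distrib_left intro!: square_integrable_add square_integrable_scale)
  show "(a + b) *\<^sub>R f = a *\<^sub>R f + b *\<^sub>R f"
    by transfer (auto simp: L2_rel_def distrib_right intro!: square_integrable_add square_integrable_scale)
  show "a *\<^sub>R b *\<^sub>R f = (a * b) *\<^sub>R f"
    by transfer (auto simp: L2_rel_def mult.assoc intro!: square_integrable_scale)
  show "1 *\<^sub>R f = f" by transfer (auto simp: L2_rel_def)
qed

end

instantiation L2 :: (euclidean_space) real_inner
begin

lift_definition inner_L2 :: "'a L2 \<Rightarrow> 'a L2 \<Rightarrow> real" is
  "\<lambda>f g. \<integral>x. f x * g x \<partial>cube_measure"
  by (rule integral_cong_AE)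
    (auto simp: L2_rel_def square_integrable_def elim: eventually_elim2)

definition norm_L2 :: "'a L2 \<Rightarrow> real" where "norm_L2 f = sqrt (f \<bullet> f)"

definition dist_L2 :: "'a L2 \<Rightarrow> 'a L2 \<Rightarrow> real" where "dist_L2 f g = norm (f - g)"

definition sgn_L2 :: "'a L2 \<Rightarrow> 'a L2" where "sgn_L2 f = inverse (norm f) *\<^sub>R f"

definition uniformity_L2 :: "('a L2 \<times> 'a L2) filter" where
  "uniformity_L2 = (INF e\<in>{0<..}. principal {(x, y). dist x y < e})"

definition open_L2 :: "'a L2 set \<Rightarrow> bool" where
  "open_L2 U = (\<forall>x\<in>U. eventually (\<lambda>(x', y). x' = x \<longrightarrow> y \<in> U) uniformity)"

instance
proof
  fix c :: real and f g h :: "'a L2"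
  show "f \<bullet> g = g \<bullet> f" by transfer (simp add: mult.commute)
  show "(f + g) \<bullet> h = f \<bullet> h + g \<bullet> h"
    by transfer
      (simp add: L2_rel_def distrib_right square_integrable_mult Bochner_Integration.integral_add)
  show "(c *\<^sub>R f) \<bullet> g = c * (f \<bullet> g)"
    by transfer (simp add: mult.assoc)
  show "0 \<le> f \<bullet> f" by transfer simp
  show "(f \<bullet> f = 0) = (f = 0)"
    by transfer
      (auto simp: L2_rel_def square_integrable_def power2_eq_square integral_nonneg_eq_0_iff_AE)
qed (simp_all add: norm_L2_def dist_L2_def sgn_L2_def uniformity_L2_def open_L2_def)

end


section \<open>Weak derivatives\<close>

primrec differentiable_times :: "nat \<Rightarrow> ('a::euclidean_space \<Rightarrow> real) \<Rightarrow> bool" where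
  "differentiable_times 0 f \<longleftrightarrow> continuous_on UNIV f"
| "differentiable_times (Suc k) f \<longleftrightarrow>
     (\<forall>x. f differentiable at x) \<and>
     (\<forall>b\<in>Basis. differentiable_times k (\<lambda>x. frechet_derivative f (at x) b))"

definition test_function :: "('a::euclidean_space \<Rightarrow> real) \<Rightarrow> bool" where
  "test_function \<phi> \<longleftrightarrow>
     (\<forall>k. differentiable_times k \<phi>) \<and>
     (\<exists>K. compact K \<and> K \<subseteq> box 0 One \<and> (\<forall>x. x \<notin> K \<longrightarrow> \<phi> x = 0))"

definition has_weak_derivative :: "'a::euclidean_space \<Rightarrow> 'a L2 \<Rightarrow> 'a L2 \<Rightarrow> bool" where
  "has_weak_derivative b f g \<longleftrightarrow>
     (\<forall>\<phi>. test_function \<phi> \<longrightarrow>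
        (\<integral>x. rep_L2 f x * frechet_derivative \<phi> (at x) b \<partial>cube_measure) =
        - (\<integral>x. rep_L2 g x * \<phi> x \<partial>cube_measure))"

definition weak_derivative :: "'a::euclidean_space \<Rightarrow> 'a L2 \<Rightarrow> 'a L2" where
  "weak_derivative b f = (THE g. has_weak_derivative b f g)"


section \<open>Tensor products of univariate functions\<close>

lemma sets_cube [measurable]: "cbox 0 One \<inter> space lborel \<in> sets lborel"
  by simp

lemma One_vec_nth [simp]: "(\<Sum>b\<in>Basis. (b :: real^'n::finite) $ m) = 1"
proof -
  have "(One :: real^'n) $ m = 1"
    unfolding cart_eq_inner_axis inner_sum_left
    by (simp add: inner_Basis axis_in_Basis_iff if_distrib cong: if_cong)
  then show ?thesis by simp
qed

lemma coordinate_measurable_cube: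
  "(\<lambda>x::real^'n::finite. x $ m) \<in> measurable cube_measure cube_measure"
  unfolding cube_measure_def
  by (rule measurable_restrict_space3) (auto simp: mem_box_cart)

lemma nn_integral_cube_prod:
  fixes h :: "'n::finite \<Rightarrow> real \<Rightarrow> ennreal"
  assumes h: "\<And>m. h m \<in> borel_measurable cube_measure"
  shows "(\<integral>\<^sup>+x. (\<Prod>m\<in>UNIV. h m (x $ m)) \<partial>(cube_measure :: (real^'n) measure)) =
         (\<Prod>m\<in>UNIV. \<integral>\<^sup>+t. h m t \<partial>cube_measure)"
proof -
  define e :: "'n \<Rightarrow> real^'n" where "e m = axis m 1" for m
  have inj: "inj e" by (auto simp: inj_on_def e_def axis_eq_axis)
  have Basis: "Basis = e ` UNIV" by (auto simp: Basis_vec_def e_def)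
  define F where "F b t = h (inv e b) t * indicator {0..1} t" for b t
  have F_e: "F (e m) = (\<lambda>t. h m t * indicator {0..1} t)" for m
    by (simp add: F_def[abs_def] inv_f_f[OF inj])
  have inner_e: "x \<bullet> e m = x $ m" for x m
    by (simp add: e_def cart_eq_inner_axis)
  have F: "F b \<in> borel_measurable borel" for b
    using h[of "inv e b"]
    by (simp add: F_def[abs_def] cube_measure_def borel_measurable_restrict_space_iff_ennreal)
  have "(\<integral>\<^sup>+x. (\<Prod>m\<in>UNIV. h m (x $ m)) \<partial>(cube_measure :: (real^'n) measure)) =
        (\<integral>\<^sup>+x. (\<Prod>m\<in>UNIV. h m (x $ m)) * indicator (cbox 0 One) x \<partial>lborel)"
    by (simp add: cube_measure_def nn_integral_restrict_space)
  also have "\<dots> = (\<integral>\<^sup>+x. (\<Prod>b\<in>Basis. F b (x \<bullet> b)) \<partial>lborel)"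
  proof (rule nn_integral_cong)
    fix x :: "real^'n"
    have "(\<Prod>b\<in>Basis. F b (x \<bullet> b)) = (\<Prod>m\<in>UNIV. h m (x $ m) * indicator {0..1} (x $ m))"
      unfolding Basis
      by (subst prod.reindex[OF inj])
        (simp add: F_e inner_e)
    also have "\<dots> = (\<Prod>m\<in>UNIV. h m (x $ m)) * indicator (cbox 0 One) x"
    proof (cases "x \<in> cbox 0 One")
      case True
      then have "x $ m \<in> {0..1}" for m by (simp add: mem_box_cart)
      then show ?thesis using True by simp
    next
      case False
      then obtain m where "x $ m \<notin> {0..1}" by (auto simp: mem_box_cart)
      then have "h m (x $ m) * indicator {0..1} (x $ m) = 0" by simp
      then have "(\<Prod>m\<in>UNIV. h m (x $ m) * indicator {0..1} (x $ m)) = 0"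
        by (intro prod_zero) auto
      then show ?thesis using False by simp
    qed
    finally show "(\<Prod>m\<in>UNIV. h m (x $ m)) * indicator (cbox 0 One) x = (\<Prod>b\<in>Basis. F b (x \<bullet> b))"
      by simp
  qed
  also have "\<dots> = (\<Prod>b\<in>Basis. \<integral>\<^sup>+t. F b t \<partial>lborel)"
    by (rule nn_integral_lborel_prod) (auto simp: F)
  also have "\<dots> = (\<Prod>m\<in>UNIV. \<integral>\<^sup>+t. h m t \<partial>cube_measure)"
    unfolding Basis
    by (subst prod.reindex[OF inj])
      (simp add: F_e cube_measure_def nn_integral_restrict_space)
  finally show ?thesis .
qed

lemma square_integrable_tensor:
  fixes f :: "'n::finite \<Rightarrow> real \<Rightarrow> real"
  assumes "\<And>m. square_integrable (f m)"
  shows "square_integrable (\<lambda>x::real^'n. \<Prod>m\<in>UNIV. f m (x $ m))"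
proof -
  have meas: "f m \<in> borel_measurable cube_measure" for m
    using assms by (simp add: square_integrable_def)
  have coord: "(\<lambda>x::real^'n. f m (x $ m)) \<in> borel_measurable cube_measure" for m
    using measurable_compose[OF coordinate_measurable_cube meas] .
  have "(\<integral>\<^sup>+x. ennreal (norm ((\<Prod>m\<in>UNIV. f m (x $ m))\<^sup>2)) \<partial>(cube_measure :: (real^'n) measure)) =
        (\<integral>\<^sup>+x. (\<Prod>m\<in>UNIV. ennreal ((f m (x $ m))\<^sup>2)) \<partial>cube_measure)"
    by (simp add: prod_ennreal prod_power_distrib prod_nonneg)
  also have "\<dots> = (\<Prod>m\<in>UNIV. \<integral>\<^sup>+t. ennreal ((f m t)\<^sup>2) \<partial>cube_measure)"
    using meas by (intro nn_integral_cube_prod) measurable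
  also have "\<dots> < \<infinity>"
  proof -
    have "(\<integral>\<^sup>+t. ennreal ((f m t)\<^sup>2) \<partial>cube_measure) < \<infinity>" for m
      using assms[of m] by (auto simp: square_integrable_def integrable_iff_bounded)
    then show ?thesis by (auto simp: less_top[symmetric] ennreal_prod_eq_top)
  qed
  finally show ?thesis
    using coord by (simp add: square_integrable_def integrable_iff_bounded)
qed

lemma AE_cube_coordinate:
  assumes "AE t in cube_measure. P t"
  shows "AE x in (cube_measure :: (real^'n::finite) measure). P (x $ m)"
proof -
  obtain N where N: "{t \<in> space cube_measure. \<not> P t} \<subseteq> N"
      "N \<in> sets cube_measure" "emeasure cube_measure N = 0"
    using assms by (auto elim: AE_E)
  define h :: "'n \<Rightarrow> real \<Rightarrow> ennreal" where
    "h j = (if j = m then indicator N else (\<lambda>_. 1))" for j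
  have h: "h j \<in> borel_measurable cube_measure" for j
    using N(2) by (simp add: h_def)
  have prod: "(\<Prod>j\<in>UNIV. h j (x $ j)) = indicator N (x $ m)" for x :: "real^'n"
    by (subst prod.remove[of _ m]) (auto simp: h_def)
  have "(\<integral>\<^sup>+x. (indicator N (x $ m) :: ennreal) \<partial>(cube_measure :: (real^'n) measure)) =
        (\<Prod>j\<in>UNIV. \<integral>\<^sup>+t. h j t \<partial>cube_measure)"
    using nn_integral_cube_prod[of h, OF h] by (simp only: prod)
  also have "\<dots> = 0"
    using N by (intro prod_zero) (auto simp: h_def intro!: bexI[of _ m])
  finally have "AE x in (cube_measure :: (real^'n) measure). (indicator N (x $ m) :: ennreal) = 0"
    using measurable_compose[OF coordinate_measurable_cube borel_measurable_indicator[OF N(2)]]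
    by (subst (asm) nn_integral_0_iff_AE) auto
  moreover have "AE x in (cube_measure :: (real^'n) measure). x $ m \<in> space cube_measure"
    using measurable_space[OF coordinate_measurable_cube] by (intro AE_I2) auto
  ultimately show ?thesis
    by eventually_elim (use N(1) in \<open>auto simp: indicator_def split: if_splits\<close>)
qed

lift_definition tensor :: "('n::finite \<Rightarrow> real L2) \<Rightarrow> (real^'n) L2" is
  "\<lambda>f x. \<Prod>m\<in>UNIV. f m (x $ m)"
proof -
  fix f g :: "'n \<Rightarrow> real \<Rightarrow> real"
  assume "\<And>m. L2_rel (f m) (g m)"
  then have *: "square_integrable (f m)" "square_integrable (g m)"
      "AE t in cube_measure. f m t = g m t" for m
    by (auto simp: L2_rel_def)
  have "AE x in (cube_measure :: (real^'n) measure). \<forall>m\<in>UNIV. f m (x $ m) = g m (x $ m)"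
    by (rule AE_finite_allI) (auto intro: AE_cube_coordinate *)
  then have "AE x in (cube_measure :: (real^'n) measure).
      (\<Prod>m\<in>UNIV. f m (x $ m)) = (\<Prod>m\<in>UNIV. g m (x $ m))"
    by eventually_elim simp
  then show "L2_rel (\<lambda>x::real^'n. \<Prod>m\<in>UNIV. f m (x $ m)) (\<lambda>x. \<Prod>m\<in>UNIV. g m (x $ m))"
    by (simp add: L2_rel_def square_integrable_tensor *)
qed

definition tensor_space :: "('n::finite \<Rightarrow> real L2 set) \<Rightarrow> (real^'n) L2 set" where
  "tensor_space A = span {tensor f | f. \<forall>m. f m \<in> A m}"


section \<open>Alternating forms\<close>

instantiation "fun" :: (type, real_vector) real_vector
begin

definition "c *\<^sub>R f = (\<lambda>x. c *\<^sub>R f x)"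

instance
  by standard (auto simp: scaleR_fun_def fun_eq_iff scaleR_add_right scaleR_add_left)

end

text \<open>
  A \<open>k\<close>-linear form takes the list of its \<open>k\<close> arguments and is \<open>0\<close> on lists of any other
  length. The tensor product of a real vector space \<open>'b\<close> with \<open>Alt\<^sup>k\<^sup>,\<^sup>l\<close> is identified with
  the \<open>'b\<close>-valued forms that are alternating in a list of \<open>k\<close> and in a list of \<open>l\<close> vectors.
\<close>

type_synonym 'n form = "(real^'n) list \<Rightarrow> real"

type_synonym ('n, 'b) biform = "(real^'n) list \<Rightarrow> (real^'n) list \<Rightarrow> 'b"

type_synonym 'n L2_biform = "('n, (real^'n) L2) biform"

definition remove_nth :: "nat \<Rightarrow> 'a list \<Rightarrow> 'a list" where
  "remove_nth i xs = take i xs @ drop (Suc i) xs"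

text \<open>The wedge product of a \<open>1\<close>-form with a form.\<close>

definition wedge1 :: "(real^'n \<Rightarrow> real) \<Rightarrow> 'n form \<Rightarrow> 'n form" where
  "wedge1 \<alpha> \<omega> vs = (\<Sum>i<length vs. (-1) ^ i * \<alpha> (vs ! i) * \<omega> (remove_nth i vs))"

definition dx :: "'n \<Rightarrow> real^'n \<Rightarrow> real" where
  "dx m v = v $ m"

definition dx_set :: "'n::{finite,linorder} set \<Rightarrow> 'n form" where
  "dx_set \<sigma> =
     foldr (\<lambda>m. wedge1 (dx m)) (sorted_list_of_set \<sigma>) (\<lambda>vs. if vs = [] then 1 else 0)"

definition form_tensor :: "'n form \<Rightarrow> 'n form \<Rightarrow> ('n, real) biform" where
  "form_tensor \<alpha> \<beta> vs ws = \<alpha> vs * \<beta> ws"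

definition biform_scale :: "'b::real_vector \<Rightarrow> ('n, real) biform \<Rightarrow> ('n, 'b) biform" where
  "biform_scale f \<mu> vs ws = \<mu> vs ws *\<^sub>R f"

text \<open>
  The map \<open>s\<^sup>k\<^sup>,\<^sup>l\<close> for \<open>'b = real\<close>, and \<open>S\<^sup>k\<^sup>,\<^sup>l\<close>, its tensor product with the identity, for
  \<open>'b = (real^'n) L2\<close>. On a biform of degree \<open>(k, 0)\<close> it is \<open>0\<close>.
\<close>

definition s_map :: "('n, 'b::real_vector) biform \<Rightarrow> ('n, 'b) biform" where
  "s_map \<mu> vs ws = (\<Sum>i<length vs. (-1) ^ i *\<^sub>R \<mu> (remove_nth i vs) (vs ! i # ws))"

lemma s_map_biform_scale: "s_map (biform_scale f \<mu>) = biform_scale f (s_map \<mu>)"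
  by (simp add: fun_eq_iff s_map_def biform_scale_def scaleR_sum_left)

definition basis_list :: "'n::{finite,linorder} set \<Rightarrow> (real, 'n) vec list" where
  "basis_list \<sigma> = map (\<lambda>m. axis m 1) (sorted_list_of_set \<sigma>)"

text \<open>
  \<open>coeff \<mu> \<sigma> \<tau>\<close> is the coefficient of \<open>dx_set \<sigma> \<otimes> dx_set \<tau>\<close> in a biform \<open>\<mu>\<close>.
\<close>

definition coeff :: "('n::{finite,linorder}, 'b) biform \<Rightarrow> 'n set \<Rightarrow> 'n set \<Rightarrow> 'b" where
  "coeff \<mu> \<sigma> \<tau> = \<mu> (basis_list \<sigma>) (basis_list \<tau>)"

lemma dx_axis: "dx m (axis j 1) = (if j = m then 1 else 0)"
  by (simp add: dx_def axis_def)

lemma foldr_wedge1_axis: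
  fixes ms ns :: "'n::{finite,linorder} list"
  assumes "sorted_wrt (<) ms" "sorted_wrt (<) ns"
  shows "foldr (\<lambda>m. wedge1 (dx m)) ms (\<lambda>vs. if vs = [] then 1 else 0) (map (\<lambda>m. axis m 1) ns) =
         (if ms = ns then 1 else 0)"
  using assms
proof (induction ms arbitrary: ns)
  case Nil
  then show ?case by (cases ns) auto
next
  case (Cons m ms)
  let ?F = "foldr (\<lambda>m. wedge1 (dx m)) ms (\<lambda>vs. if vs = [] then (1::real) else 0)"
  let ?term = "\<lambda>i. (-1) ^ i * dx m (map (\<lambda>m. axis m 1) ns ! i) *
                  ?F (remove_nth i (map (\<lambda>m. axis m 1) ns))"
  have IH: "?F (remove_nth i (map (\<lambda>m. axis m 1) ns)) =
            (if ms = remove_nth i ns then 1 else 0)" for i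
  proof -
    have "sorted_wrt (<) (take i ns @ drop i ns)"
      using Cons.prems(2) by simp
    moreover have "set (drop (Suc i) ns) \<subseteq> set (drop i ns)"
      by (simp add: set_drop_subset_set_drop)
    moreover have "sorted_wrt (<) (drop (Suc i) ns)"
      using Cons.prems(2) by (rule sorted_wrt_drop)
    ultimately have "sorted_wrt (<) (remove_nth i ns)"
      unfolding remove_nth_def sorted_wrt_append by blast
    from Cons.IH[OF _ this] Cons.prems(1) show ?thesis
      by (simp add: remove_nth_def take_map drop_map)
  qed
  have zero: "?term i = 0" if i: "0 < i" "i < length ns" for i
  proof (rule ccontr)
    assume "?term i \<noteq> 0"
    then have eq: "ns ! i = m" "ms = remove_nth i ns"
      using i by (auto simp: IH dx_axis split: if_splits)
    have "ns ! 0 \<in> set ms"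
      unfolding eq(2) remove_nth_def using i by (auto simp: in_set_conv_nth intro!: exI[of _ 0])
    then have "m < ns ! 0" using Cons.prems(1) by simp
    moreover have "ns ! 0 < ns ! i"
      using Cons.prems(2) i by (simp add: sorted_wrt_iff_nth_less)
    ultimately show False using eq(1) by simp
  qed
  have "wedge1 (dx m) ?F (map (\<lambda>m. axis m 1) ns) = (\<Sum>i<length ns. ?term i)"
    by (simp add: wedge1_def)
  also have "\<dots> = (if m # ms = ns then 1 else 0)"
  proof (cases ns)
    case Nil
    then show ?thesis by simp
  next
    case (Cons n ns')
    have "(\<Sum>i<length ns. ?term i) = (\<Sum>i\<in>{0}. ?term i)"
    proof (rule sum.mono_neutral_right)
      show "\<forall>i\<in>{..<length ns} - {0}. ?term i = 0"
        by (intro ballI zero) auto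
    qed (use Cons in auto)
    also have "\<dots> = (if m # ms = ns then 1 else 0)"
      using IH[of 0] by (auto simp: Cons remove_nth_def dx_axis)
    finally show ?thesis .
  qed
  finally show ?case by simp
qed

lemma dx_set_basis_list: "dx_set \<sigma> (basis_list \<tau>) = (if \<sigma> = \<tau> then 1 else 0)"
proof -
  have "sorted_list_of_set \<sigma> = sorted_list_of_set \<tau> \<longleftrightarrow> \<sigma> = \<tau>"
    by (metis finite set_sorted_list_of_set)
  then show ?thesis
    by (simp add: dx_set_def basis_list_def foldr_wedge1_axis)
qed

lemma coeff_dx_set:
  "coeff (biform_scale f (form_tensor (dx_set \<sigma>) (dx_set \<tau>))) \<sigma>' \<tau>' =
     (if \<sigma> = \<sigma>' \<and> \<tau> = \<tau>' then f else 0)"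
  by (simp add: coeff_def biform_scale_def form_tensor_def dx_set_basis_list)

text \<open>
  The \<open>L\<^sup>2\<close> inner product of biforms of degree \<open>(k, l)\<close>, with the \<open>dx_set \<sigma> \<otimes> dx_set \<tau>\<close>
  orthonormal.
\<close>

definition biform_inner ::
  "nat \<Rightarrow> nat \<Rightarrow> ('n::{finite,linorder}, 'b::real_inner) biform \<Rightarrow> ('n, 'b) biform \<Rightarrow> real" where
  "biform_inner k l \<mu> \<nu> =
     (\<Sum>\<sigma> | card \<sigma> = k. \<Sum>\<tau> | card \<tau> = l. coeff \<mu> \<sigma> \<tau> \<bullet> coeff \<nu> \<sigma> \<tau>)"


section \<open>The discrete spaces and the BGG complex\<close>

text \<open>
  \<open>\<S> m a\<close> is the univariate space in direction \<open>m\<close> with degree and smoothness lowered by \<open>a\<close>.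
\<close>

definition form_space ::
  "('n::{finite,linorder} \<Rightarrow> nat \<Rightarrow> real L2 set) \<Rightarrow> nat \<Rightarrow> nat \<Rightarrow> 'n L2_biform set" where
  "form_space \<S> k l =
     {(\<Sum>\<sigma> | card \<sigma> = k. \<Sum>\<tau> | card \<tau> = l.
         biform_scale (f \<sigma> \<tau>) (form_tensor (dx_set \<sigma>) (dx_set \<tau>))) | f.
      \<forall>\<sigma> \<tau>. card \<sigma> = k \<longrightarrow> card \<tau> = l \<longrightarrow>
        f \<sigma> \<tau> \<in> tensor_space (\<lambda>m. \<S> m (of_bool (m \<in> \<sigma>) + of_bool (m \<in> \<tau>)))}"

text \<open>
  \<open>d\<^sup>k\<close> on biforms of degree \<open>(k, l)\<close>. The terms with \<open>m \<in> \<sigma>\<close> vanish, whether or not the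
  coefficient is differentiable in direction \<open>m\<close>, because \<open>dx m \<and> dx_set \<sigma> = 0\<close>; for
  \<open>k = CARD('n)\<close> there are no others.
\<close>

definition ext_deriv ::
  "nat \<Rightarrow> nat \<Rightarrow> ('n::{finite,linorder}) L2_biform \<Rightarrow> 'n L2_biform" where
  "ext_deriv k l \<mu> =
     (\<Sum>\<sigma> | card \<sigma> = k. \<Sum>\<tau> | card \<tau> = l. \<Sum>m\<in>UNIV.
        biform_scale (weak_derivative (axis m 1) (coeff \<mu> \<sigma> \<tau>))
          (form_tensor (wedge1 (dx m) (dx_set \<sigma>)) (dx_set \<tau>)))"

text \<open>The orthogonal complement of the range of \<open>S\<^sup>i\<^sup>-\<^sup>1\<^sup>,\<^sup>J\<close> in the forms of degree \<open>(i, J - 1)\<close>.\<close>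

definition range_perp ::
  "('n::{finite,linorder} \<Rightarrow> nat \<Rightarrow> real L2 set) \<Rightarrow> nat \<Rightarrow> nat \<Rightarrow> 'n L2_biform set" where
  "range_perp \<S> J i =
     {\<mu> \<in> form_space \<S> i (J - 1).
        \<forall>\<nu> \<in> (if i = 0 then {0} else s_map ` form_space \<S> (i - 1) J). biform_inner i (J - 1) \<mu> \<nu> = 0}"

definition orthogonal_projection ::
  "nat \<Rightarrow> nat \<Rightarrow> ('n::{finite,linorder}, 'b::real_inner) biform set \<Rightarrow> ('n, 'b) biform \<Rightarrow> ('n, 'b) biform"
  where
  "orthogonal_projection k l W \<mu> =
     (THE \<omega>. \<omega> \<in> W \<and> (\<forall>\<nu>\<in>W. biform_inner k l (\<mu> - \<omega>) \<nu> = 0))"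

definition bgg_space ::
  "('n::{finite,linorder} \<Rightarrow> nat \<Rightarrow> real L2 set) \<Rightarrow> nat \<Rightarrow> nat \<Rightarrow> 'n L2_biform set" where
  "bgg_space \<S> J i =
     (if i < J then range_perp \<S> J i else {\<mu> \<in> form_space \<S> i J. s_map \<mu> = 0})"

definition bgg_op ::
  "('n::{finite,linorder} \<Rightarrow> nat \<Rightarrow> real L2 set) \<Rightarrow> nat \<Rightarrow> nat \<Rightarrow>
     'n L2_biform \<Rightarrow> 'n L2_biform" where
  "bgg_op \<S> J i \<mu> =
     (if i + 1 < J then
        orthogonal_projection (i + 1) (J - 1) (range_perp \<S> J (i + 1)) (ext_deriv i (J - 1) \<mu>)
      else if i + 1 = J then
        ext_deriv i J (inv_into (form_space \<S> i J) s_map (ext_deriv i (J - 1) \<mu>))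
      else ext_deriv i J \<mu>)"


section \<open>Dimension of cohomology\<close>

text \<open>The classes modulo \<open>B\<close> of the elements of \<open>X\<close> form a basis of the quotient space \<open>Z / B\<close>.\<close>

definition quotient_basis :: "'a::real_vector set \<Rightarrow> 'a set \<Rightarrow> 'a set \<Rightarrow> bool" where
  "quotient_basis Z B X \<longleftrightarrow>
     finite X \<and> X \<subseteq> Z \<and>
     (\<forall>c. (\<Sum>x\<in>X. c x *\<^sub>R x) \<in> B \<longrightarrow> (\<forall>x\<in>X. c x = 0)) \<and>
     (\<forall>z\<in>Z. \<exists>c. z - (\<Sum>x\<in>X. c x *\<^sub>R x) \<in> B)"

definition quotient_dim :: "'a::real_vector set \<Rightarrow> 'a set \<Rightarrow> nat" where
  "quotient_dim Z B = (THE d. \<exists>X. quotient_basis Z B X \<and> card X = d)"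

lemma quotient_basis_card:
  assumes B: "subspace B" "B \<subseteq> Z" and Z: "subspace Z" "Z = span F" "finite F"
    and X: "quotient_basis Z B X"
  shows "card X + dim B = dim Z"
proof -
  have X': "finite X" "X \<subseteq> Z"
    and indep: "\<And>c. (\<Sum>x\<in>X. c x *\<^sub>R x) \<in> B \<Longrightarrow> \<forall>x\<in>X. c x = 0"
    and gen: "\<And>z. z \<in> Z \<Longrightarrow> \<exists>c. z - (\<Sum>x\<in>X. c x *\<^sub>R x) \<in> B"
    using X by (auto simp: quotient_basis_def)
  obtain Y where Y: "Y \<subseteq> B" "independent Y" "B \<subseteq> span Y" "card Y = dim B"
    by (rule basis_exists[of B])
  have spanY: "span Y = B"
    using Y B by (simp add: span_minimal subset_antisym)
  have finY: "finite Y"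
    using independent_span_bound[OF Z(3) Y(2)] Y(1) B(2) Z(2) by auto
  have disj: "X \<inter> Y = {}"
  proof (rule ccontr)
    assume "X \<inter> Y \<noteq> {}"
    then obtain y where y: "y \<in> X" "y \<in> Y" by blast
    have "(\<Sum>x\<in>X. (if x = y then 1 else 0) *\<^sub>R x) = y"
      using X'(1) y(1) by (simp add: if_distrib[of "\<lambda>c. c *\<^sub>R _"] cong: if_cong)
    then have "\<forall>x\<in>X. (if x = y then 1 else 0 :: real) = 0"
      using y(2) Y(1) by (intro indep) auto
    with y(1) show False by force
  qed
  have "independent (X \<union> Y)"
  proof (rule independent_if_scalars_zero)
    show "finite (X \<union> Y)" using X'(1) finY by simp
    fix c x
    assume "(\<Sum>x\<in>X \<union> Y. c x *\<^sub>R x) = 0" and x: "x \<in> X \<union> Y"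
    then have sum: "(\<Sum>x\<in>X. c x *\<^sub>R x) + (\<Sum>y\<in>Y. c y *\<^sub>R y) = 0"
      using X'(1) finY disj by (simp add: sum.union_disjoint)
    then have "(\<Sum>x\<in>X. c x *\<^sub>R x) = - (\<Sum>y\<in>Y. c y *\<^sub>R y)"
      by (simp add: eq_neg_iff_add_eq_0)
    also have "\<dots> \<in> B"
      using Y(1) B(1) by (intro subspace_neg subspace_sum subspace_scale) auto
    finally have c: "\<forall>x\<in>X. c x = 0" by (rule indep)
    with sum have "(\<Sum>y\<in>Y. c y *\<^sub>R y) = 0" by simp
    then have "\<forall>y\<in>Y. c y = 0"
      using Y(2) finY by (auto simp: dependent_finite)
    with c x show "c x = 0" by auto
  qed
  moreover have "span (X \<union> Y) = Z"
  proof
    show "span (X \<union> Y) \<subseteq> Z"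
      using X'(2) Y(1) B(2) Z(1) by (intro span_minimal) auto
    show "Z \<subseteq> span (X \<union> Y)"
    proof
      fix z assume "z \<in> Z"
      then obtain c where "z - (\<Sum>x\<in>X. c x *\<^sub>R x) \<in> span Y"
        using gen spanY by blast
      then have "z - (\<Sum>x\<in>X. c x *\<^sub>R x) \<in> span (X \<union> Y)"
        using span_mono[of Y "X \<union> Y"] by blast
      moreover have "(\<Sum>x\<in>X. c x *\<^sub>R x) \<in> span (X \<union> Y)"
        by (intro span_sum span_scale span_base) auto
      ultimately show "z \<in> span (X \<union> Y)"
        by (metis diff_add_cancel span_add)
    qed
  qed
  ultimately have "dim Z = card (X \<union> Y)"
    by (metis dim_span_eq_card_independent)
  then show ?thesis
    using card_Un_disjoint[OF X'(1) finY disj] Y(4) by simp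
qed

lemma quotient_basis_exists:
  assumes B: "subspace B" "B \<subseteq> Z" and Z: "subspace Z" "Z = span F" "finite F"
  shows "\<exists>X. quotient_basis Z B X"
proof -
  obtain Y where Y: "Y \<subseteq> B" "independent Y" "B \<subseteq> span Y"
    by (rule basis_exists[of B])
  have spanY: "span Y = B"
    using Y B by (simp add: span_minimal subset_antisym)
  obtain W where W: "Y \<subseteq> W" "W \<subseteq> Z" "independent W" "Z \<subseteq> span W"
    using maximal_independent_subset_extend[of Y Z] Y B(2) by blast
  have finW: "finite W"
    using independent_span_bound[OF Z(3) W(3)] W(2) Z(2) by auto
  have finY: "finite Y" using finW W(1) by (rule rev_finite_subset)
  have split: "(\<Sum>w\<in>W. g w) = (\<Sum>w\<in>W - Y. g w) + (\<Sum>w\<in>Y. g w)" for g :: "'a \<Rightarrow> 'a"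
    using sum.subset_diff[OF W(1) finW] .
  have "\<forall>x\<in>W - Y. c x = 0" if c: "(\<Sum>x\<in>W - Y. c x *\<^sub>R x) \<in> B" for c
  proof -
    obtain u where u: "(\<Sum>x\<in>W - Y. c x *\<^sub>R x) = (\<Sum>y\<in>Y. u y *\<^sub>R y)"
      using c unfolding spanY[symmetric] span_finite[OF finY] by blast
    define e where "e x = (if x \<in> Y then - u x else c x)" for x
    have "(\<Sum>x\<in>W. e x *\<^sub>R x) = (\<Sum>x\<in>W - Y. c x *\<^sub>R x) + (\<Sum>y\<in>Y. - (u y *\<^sub>R y))"
      unfolding split by (simp add: e_def)
    also have "\<dots> = 0" by (simp add: u sum_negf)
    finally have "\<forall>x\<in>W. e x = 0"
      using W(3) finW by (auto simp: dependent_finite)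
    then show ?thesis by (auto simp: e_def)
  qed
  moreover have "\<exists>c. z - (\<Sum>x\<in>W - Y. c x *\<^sub>R x) \<in> B" if z: "z \<in> Z" for z
  proof -
    obtain u where "z = (\<Sum>w\<in>W. u w *\<^sub>R w)"
      using z W(4) span_finite[OF finW] by auto
    then have "z - (\<Sum>x\<in>W - Y. u x *\<^sub>R x) = (\<Sum>y\<in>Y. u y *\<^sub>R y)"
      by (simp add: split)
    also have "\<dots> \<in> B"
      using Y(1) B(1) by (intro subspace_sum subspace_scale) auto
    finally show ?thesis by blast
  qed
  ultimately have "quotient_basis Z B (W - Y)"
    using finW W(2) by (auto simp: quotient_basis_def)
  then show ?thesis by blast
qed

lemma quotient_dim_eq:
  assumes "subspace B" "B \<subseteq> Z" "subspace Z" "Z = span F" "finite F"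
  shows "quotient_dim Z B + dim B = dim Z"
proof -
  obtain X where X: "quotient_basis Z B X"
    using quotient_basis_exists[OF assms] by blast
  have "quotient_dim Z B = card X"
    unfolding quotient_dim_def
  proof (rule the_equality)
    show "\<exists>X'. quotient_basis Z B X' \<and> card X' = card X"
      using X by blast
    show "d = card X" if "\<exists>X'. quotient_basis Z B X' \<and> card X' = d" for d
      using that quotient_basis_card[OF assms] X by (metis add_right_cancel)
  qed
  then show ?thesis using quotient_basis_card[OF assms X] by simp
qed

definition cohomology_dim :: "(nat \<Rightarrow> 'a::real_vector set) \<Rightarrow> (nat \<Rightarrow> 'a \<Rightarrow> 'a) \<Rightarrow> nat \<Rightarrow> nat" where
  "cohomology_dim A \<delta> k =
     quotient_dim {x \<in> A k. \<delta> k x = 0} (if k = 0 then {0} else \<delta> (k - 1) ` A (k - 1))"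

end

theory Submission
  imports Defs
begin

text \<open>
  Write \<open>A\<^sup>i\<close> and \<open>B\<^sup>i\<close> for the discrete forms of degree \<open>(i, J - 1)\<close> and \<open>(i, J)\<close>. The map
  \<open>S : B\<^sup>i \<rightarrow> A\<^sup>i\<^sup>+\<^sup>1\<close> anticommutes with the exterior derivative \<open>d\<close>, is injective for \<open>i < J\<close> and
  onto for \<open>i \<ge> J - 1\<close>. The bound then follows by a diagram chase. For \<open>k < J\<close> a BGG cocycle
  \<open>a \<in> A\<^sup>k\<close> is one with \<open>d a = S b\<close> for a closed \<open>b \<in> B\<^sup>k\<close>, and \<open>a \<mapsto> [b]\<close> maps the
  BGG cohomology to \<open>H\<^sup>k(B)\<close>. If \<open>b = d b'\<close>, then \<open>a + S b'\<close> is closed and projects to \<open>a\<close>, so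
  the kernel of this map is a quotient of \<open>H\<^sup>k(A)\<close>. For \<open>k \<ge> J\<close> a BGG cocycle is itself a
  cocycle \<open>b \<in> B\<^sup>k\<close> with \<open>S b = 0\<close>; if it is exact, \<open>b = d b'\<close>, then \<open>S b'\<close> is closed in
  \<open>A\<^sup>k\<close>, and its class in \<open>H\<^sup>k(A)\<close> determines the BGG class of \<open>b\<close>. In both cases two short
  exact sequences bound the dimension by the sum; the common linear algebra is
  \<open>quotient_dim_zigzag\<close>, and the two cases are \<open>cohomology_bound_below\<close> and
  \<open>cohomology_bound_above\<close> in the locale \<open>bgg_diagram\<close>.

  Injectivity and surjectivity of \<open>S\<close> come from the representation theory of \<open>sl\<^sub>2\<close>. In the
  coefficients with respect to \<open>dx_set \<sigma> \<otimes> dx_set \<tau>\<close>, \<open>S\<close> moves an index from \<open>\<tau>\<close> to \<open>\<sigma>\<close>, its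
  adjoint \<open>S\<^sup>*\<close> moves one back, and \<open>S S\<^sup>* - S\<^sup>* S = k - l\<close> in degree \<open>(k, l)\<close>
  (\<open>raise_lower_commutator\<close>). Hence \<open>|S c|\<^sup>2 = |S\<^sup>* c|\<^sup>2 + (l - k) |c|\<^sup>2\<close>, so \<open>S\<close> is injective
  if \<open>k < l\<close> and \<open>S\<^sup>*\<close> is injective if \<open>k > l\<close>. Since the number of times that an index occurs
  in \<open>\<sigma>\<close> and \<open>\<tau>\<close> together stays the same, \<open>S\<close> and \<open>S\<^sup>*\<close> preserve the tensor product
  spaces of the coefficients, and the argument applies to the discrete spaces.

  The weak derivatives remain. They are unique because a square integrable function that is
  orthogonal to all test functions vanishes (\<open>AE_zero_if_test_integrals_zero\<close>), and the weak
  partial derivative of a tensor product differentiates one factor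
  (\<open>has_weak_derivative_tensor\<close>), by Fubini's theorem along coordinate lines. So \<open>d\<close> is
  linear on the discrete spaces and stays inside them, and \<open>d d = 0\<close>.
\<close>

section \<open>Smooth bump functions\<close>

text \<open>
  The powers of \<open>inverse x\<close> make this family of flat functions closed under differentiation up
  to linear combinations, so that smoothness at \<open>0\<close> needs the limit only.
\<close>

definition flat :: "nat \<Rightarrow> real \<Rightarrow> real" where
  "flat k x = (if 0 < x then inverse x ^ k * exp (- inverse x) else 0)"

lemma flat_tendsto_0: "(flat k \<longlongrightarrow> 0) (at 0)"
proof -
  have "((\<lambda>x::real. inverse x ^ k / exp (inverse x)) \<longlongrightarrow> 0) (at_right 0)"
    by (rule filterlim_compose[OF tendsto_power_div_exp_0 filterlim_inverse_at_top_right])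
  then have "(flat k \<longlongrightarrow> 0) (at_right 0)"
    by (rule Lim_transform_eventually)
      (auto simp: flat_def eventually_at_right_less exp_minus divide_inverse
        intro: eventually_mono[OF eventually_at_right_less])
  moreover have "(flat k \<longlongrightarrow> 0) (at_left 0)"
    by (rule tendsto_eventually) (auto simp: flat_def eventually_at_left_field intro!: exI[of _ "-1"])
  ultimately show ?thesis by (simp add: filterlim_at_split)
qed

lemma flat_has_derivative:
  "(flat k has_real_derivative flat (k + 2) x - real k * flat (k + 1) x) (at x)"
proof -
  consider "0 < x" | "x < 0" | "x = 0" by linarith
  then show ?thesis
  proof cases
    case 1
    have "((\<lambda>x. inverse x ^ k * exp (- inverse x)) has_real_derivative
        flat (k + 2) x - real k * flat (k + 1) x) (at x)"
      using 1 by (auto intro!: derivative_eq_intros simp: flat_def)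
        (cases k; simp add: field_simps power2_eq_square)
    then show ?thesis
      by (rule has_field_derivative_transform_within_open[of _ _ _ "{0<..}"]) (use 1 in \<open>auto simp: flat_def\<close>)
  next
    case 2
    have "((\<lambda>x. 0) has_real_derivative flat (k + 2) x - real k * flat (k + 1) x) (at x)"
      using 2 by (auto simp: flat_def)
    then show ?thesis
      by (rule has_field_derivative_transform_within_open[of _ _ _ "{..<0}"]) (use 2 in \<open>auto simp: flat_def\<close>)
  next
    case 3
    have "(\<lambda>h. (flat k (0 + h) - flat k 0) / h) = flat (k + 1)"
      by (auto simp: flat_def field_simps)
    then show ?thesis using flat_tendsto_0[of "k + 1"] 3 by (simp add: DERIV_def flat_def)
  qed
qed

text \<open>
  A class of functions that is closed under differentiation by construction: membership replaces
  the bookkeeping of higher derivatives.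
\<close>

inductive smooth :: "(real \<Rightarrow> real) \<Rightarrow> bool" where
  flat: "smooth (\<lambda>x. flat k (a * x + b))"
| const: "smooth (\<lambda>x. c)"
| add: "smooth f \<Longrightarrow> smooth g \<Longrightarrow> smooth (\<lambda>x. f x + g x)"
| mult: "smooth f \<Longrightarrow> smooth g \<Longrightarrow> smooth (\<lambda>x. f x * g x)"

lemma smooth_derivative:
  assumes "smooth f"
  shows "\<exists>f'. smooth f' \<and> (\<forall>x. (f has_real_derivative f' x) (at x))"
  using assms
proof (induction rule: smooth.induct)
  case (flat k a b)
  let ?g = "\<lambda>x. a * flat (k + 2) (a * x + b) + (- a * real k) * flat (k + 1) (a * x + b)"
  have "((\<lambda>x. flat k (a * x + b)) has_real_derivative ?g x) (at x)" for x
    by (rule DERIV_cong[OF DERIV_chain2[OF flat_has_derivative, where g = "\<lambda>x. a * x + b"]])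
      (auto intro!: derivative_eq_intros simp: algebra_simps)
  moreover have "smooth ?g" by (intro smooth.intros)
  ultimately show ?case by blast
next
  case (const c)
  show ?case by (auto intro!: exI[of _ "\<lambda>x. 0"] smooth.const)
next
  case (add f g)
  then obtain f' g' where "smooth f'" "smooth g'"
      "\<And>x. (f has_real_derivative f' x) (at x)" "\<And>x. (g has_real_derivative g' x) (at x)"
    by blast
  then show ?case by (intro exI[of _ "\<lambda>x. f' x + g' x"]) (auto intro: smooth.add DERIV_add)
next
  case (mult f g)
  then obtain f' g' where "smooth f'" "smooth g'"
      "\<And>x. (f has_real_derivative f' x) (at x)" "\<And>x. (g has_real_derivative g' x) (at x)"
    by blast
  with mult.hyps show ?case
    by (intro exI[of _ "\<lambda>x. f' x * g x + g' x * f x"]) (auto intro: smooth.add smooth.mult DERIV_mult)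
qed

lemma smooth_continuous_on: "smooth f \<Longrightarrow> continuous_on UNIV f"
  using smooth_derivative[of f]
  by (auto simp: continuous_on_eq_continuous_at intro: DERIV_isCont)

text \<open>
  A partial derivative of a product of univariate functions is again such a product, with one
  factor differentiated; hence the induction over the order.
\<close>

lemma smooth_prod_differentiable_times:
  fixes g :: "'a::euclidean_space \<Rightarrow> real \<Rightarrow> real"
  assumes "\<And>b. b \<in> Basis \<Longrightarrow> smooth (g b)"
  shows "differentiable_times k (\<lambda>x. \<Prod>b\<in>Basis. g b (x \<bullet> b))"
  using assms
proof (induction k arbitrary: g)
  case 0
  have "continuous_on UNIV (\<lambda>x. g b (x \<bullet> b))" if "b \<in> Basis" for b
    by (rule continuous_on_compose2[OF smooth_continuous_on[OF 0[OF that]]])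
      (auto intro: continuous_intros)
  then show ?case by (auto intro!: continuous_on_prod)
next
  case (Suc k)
  have "\<exists>g'. \<forall>b\<in>Basis. smooth (g' b) \<and> (\<forall>x. (g b has_real_derivative g' b x) (at x))"
    by (rule bchoice) (use smooth_derivative Suc.prems in blast)
  then obtain g' where g': "\<And>b. b \<in> Basis \<Longrightarrow> smooth (g' b)"
      "\<And>b x. b \<in> Basis \<Longrightarrow> (g b has_real_derivative g' b x) (at x)"
    by blast
  have "((\<lambda>x. g b (x \<bullet> b)) has_derivative (\<lambda>h. (h \<bullet> b) * g' b (x \<bullet> b))) (at x)"
    if "b \<in> Basis" for b x
    by (rule has_derivative_eq_rhs[OF has_derivative_compose[OF _ g'(2)[OF that, unfolded has_field_derivative_def]]])
      (auto intro!: derivative_eq_intros simp: mult.commute)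
  then have D: "((\<lambda>x. \<Prod>b\<in>Basis. g b (x \<bullet> b)) has_derivative
      (\<lambda>h. \<Sum>b\<in>Basis. (h \<bullet> b) * g' b (x \<bullet> b) * (\<Prod>c\<in>Basis - {b}. g c (x \<bullet> c)))) (at x)" for x
    by (intro has_derivative_prod) auto
  have F: "frechet_derivative (\<lambda>x. \<Prod>b\<in>Basis. g b (x \<bullet> b)) (at x) c =
      (\<Prod>b\<in>Basis. (g(c := g' c)) b (x \<bullet> b))" if c: "c \<in> Basis" for x c
  proof -
    have "frechet_derivative (\<lambda>x. \<Prod>b\<in>Basis. g b (x \<bullet> b)) (at x) c =
        (\<Sum>b\<in>Basis. (c \<bullet> b) * g' b (x \<bullet> b) * (\<Prod>c\<in>Basis - {b}. g c (x \<bullet> c)))"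
      using fun_cong[OF frechet_derivative_at[OF D[of x]], of c] by simp
    also have "\<dots> = (\<Sum>b\<in>Basis. if b = c then g' c (x \<bullet> c) * (\<Prod>b\<in>Basis - {c}. g b (x \<bullet> b)) else 0)"
      using c by (intro sum.cong) (auto simp: inner_Basis)
    also have "\<dots> = (\<Prod>b\<in>Basis. (g(c := g' c)) b (x \<bullet> b))"
      using c by (subst prod.remove[of _ c]) auto
    finally show ?thesis .
  qed
  show ?case
    using D Suc.IH[of "g(b := g' b)" for b] g'(1) Suc.prems by (auto simp: F differentiable_def)
qed

section \<open>Uniqueness of weak derivatives\<close>

text \<open>
  The positive and the negative part of \<open>G\<close> are densities of two measures that agree on boxes.
  Boxes are an intersection-stable generator of the Borel sets, so the measures agree.
\<close>

lemma AE_zero_if_box_integrals_zero: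
  fixes G :: "'a::euclidean_space \<Rightarrow> real"
  assumes G: "integrable lborel G"
    and zero: "\<And>a b. (\<integral>x. indicator (box a b) x * G x \<partial>lborel) = 0"
  shows "AE x in lborel. G x = 0"
proof -
  define p where "p x = max 0 (G x)" for x
  define q where "q x = max 0 (- G x)" for x
  have int: "integrable lborel p" "integrable lborel q"
    using G by (auto simp: p_def[abs_def] q_def[abs_def])
  have meas [measurable]: "p \<in> borel_measurable borel" "q \<in> borel_measurable borel"
    using borel_measurable_integrable[OF int(1)] borel_measurable_integrable[OF int(2)] by auto
  have em: "emeasure (density lborel (\<lambda>x. ennreal (f x))) (box a b) =
      ennreal (\<integral>x. indicator (box a b) x * f x \<partial>lborel)"
    if f: "integrable lborel f" "\<And>x. 0 \<le> f x" for f :: "'a \<Rightarrow> real" and a b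
  proof -
    have [measurable]: "f \<in> borel_measurable borel" using borel_measurable_integrable[OF f(1)] by auto
    have i: "integrable lborel (\<lambda>x. indicator (box a b) x * f x)"
      using integrable_mult_indicator[OF _ f(1), of "box a b"] by simp
    have "emeasure (density lborel (\<lambda>x. ennreal (f x))) (box a b) =
        (\<integral>\<^sup>+x. ennreal (f x) * indicator (box a b) x \<partial>lborel)"
      by (subst emeasure_density) auto
    also have "\<dots> = (\<integral>\<^sup>+x. ennreal (indicator (box a b) x * f x) \<partial>lborel)"
      by (intro nn_integral_cong) (auto simp: indicator_def)
    also have "\<dots> = ennreal (\<integral>x. indicator (box a b) x * f x \<partial>lborel)"
      using f by (intro nn_integral_eq_integral i) auto
    finally show ?thesis .
  qed
  have eq: "emeasure (density lborel (\<lambda>x. ennreal (p x))) (box a b) =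
      emeasure (density lborel (\<lambda>x. ennreal (q x))) (box a b)" for a b
  proof -
    have i: "integrable lborel (\<lambda>x. indicator (box a b) x * p x)"
        "integrable lborel (\<lambda>x. indicator (box a b) x * q x)"
      using integrable_mult_indicator[OF _ int(1), of "box a b"]
        integrable_mult_indicator[OF _ int(2), of "box a b"] by auto
    have "indicator (box a b) x * G x = indicator (box a b) x * p x - indicator (box a b) x * q x" for x
      by (auto simp: p_def q_def indicator_def max_def)
    then have "(\<integral>x. indicator (box a b) x * p x \<partial>lborel) = (\<integral>x. indicator (box a b) x * q x \<partial>lborel)"
      using zero[of a b] Bochner_Integration.integral_diff[OF i] by simp
    then have "ennreal (\<integral>x. indicator (box a b) x * p x \<partial>lborel) =
        ennreal (\<integral>x. indicator (box a b) x * q x \<partial>lborel)" by simp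
    then show ?thesis by (subst (1 2) em) (auto simp: int p_def q_def)
  qed
  have "density lborel (\<lambda>x. ennreal (p x)) = density lborel (\<lambda>x. ennreal (q x))"
  proof (rule measure_eqI_generator_eq)
    let ?E = "range (\<lambda>(a, b). box a b :: 'a set)"
    show "Int_stable ?E" by (auto simp: Int_stable_def box_Int_box)
    show "?E \<subseteq> Pow UNIV" "sets (density lborel (\<lambda>x. ennreal (p x))) = sigma_sets UNIV ?E"
      "sets (density lborel (\<lambda>x. ennreal (q x))) = sigma_sets UNIV ?E"
      by (simp_all add: borel_eq_box)
    let ?A = "\<lambda>n::nat. box (- (real n *\<^sub>R One)) (real n *\<^sub>R One) :: 'a set"
    show "range ?A \<subseteq> ?E" "(\<Union>i. ?A i) = UNIV"
      unfolding UN_box_eq_UNIV by auto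
    show "emeasure (density lborel (\<lambda>x. ennreal (p x))) (?A i) \<noteq> \<infinity>" for i
      by (subst em) (auto simp: int p_def)
    show "emeasure (density lborel (\<lambda>x. ennreal (p x))) X = emeasure (density lborel (\<lambda>x. ennreal (q x))) X"
      if "X \<in> ?E" for X
      using that eq by auto
  qed
  then have "AE x in lborel. ennreal (p x) = ennreal (q x)"
    by (intro sigma_finite_measure.density_unique[OF lborel.sigma_finite_measure_axioms]) auto
  then show ?thesis
    by eventually_elim (auto simp: p_def q_def max_def split: if_splits)
qed

lemma finite_measure_cube: "finite_measure (cube_measure :: 'a::euclidean_space measure)"
  by (rule finite_measureI)
    (simp add: cube_measure_def emeasure_restrict_space space_restrict_space emeasure_lborel_cbox_eq)

lemma square_integrable_continuous:
  assumes "continuous_on UNIV f"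
  shows "square_integrable f"
proof -
  have "integrable lborel (\<lambda>x. indicator (cbox 0 One) x *\<^sub>R (f x)\<^sup>2)"
    using assms by (intro borel_integrable_compact continuous_intros) (auto intro: continuous_on_subset)
  then show ?thesis
    using borel_measurable_continuous_onI[OF assms]
    by (auto simp: square_integrable_def cube_measure_def integrable_restrict_space
        intro: measurable_restrict_space1)
qed

lemma test_function_square_integrable:
  assumes "test_function \<phi>"
  shows "square_integrable \<phi>"
    "b \<in> Basis \<Longrightarrow> square_integrable (\<lambda>x. frechet_derivative \<phi> (at x) b)"
proof -
  have "differentiable_times 0 \<phi>" "differentiable_times (Suc 0) \<phi>"
    using assms unfolding test_function_def by blast+
  then show "square_integrable \<phi>"
    "b \<in> Basis \<Longrightarrow> square_integrable (\<lambda>x. frechet_derivative \<phi> (at x) b)"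
    by (auto intro: square_integrable_continuous)
qed

text \<open>
  For \<open>n > 0\<close> the shift by \<open>-1\<close> confines the support to the box shrunk by \<open>1 / n\<close> on every side, a compact
  subset of the open box \<open>box a b\<close>. Nevertheless the bumps converge to its indicator function.
\<close>

definition bump :: "'a::euclidean_space \<Rightarrow> 'a \<Rightarrow> nat \<Rightarrow> 'a \<Rightarrow> real" where
  "bump a b n x = (\<Prod>i\<in>Basis. flat 0 (real n * (x \<bullet> i - a \<bullet> i) - 1) * flat 0 (real n * (b \<bullet> i - x \<bullet> i) - 1))"

lemma flat_0_bounds: "0 \<le> flat 0 x" "flat 0 x \<le> 1"
  by (auto simp: flat_def)

lemma bump_bounds: "0 \<le> bump a b n x" "bump a b n x \<le> 1"
  unfolding bump_def by (auto intro!: prod_nonneg prod_le_1 mult_nonneg_nonneg mult_le_one simp: flat_0_bounds)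

lemma test_function_bump:
  fixes a b :: "'a::euclidean_space"
  assumes ab: "box a b \<subseteq> box 0 One"
  shows "test_function (bump a b n)"
proof -
  have smooth: "smooth (\<lambda>t. flat 0 (real n * (t - a \<bullet> i) - 1) * flat 0 (real n * (b \<bullet> i - t) - 1))" for i
    using smooth.mult[OF smooth.flat[of 0 "real n" "- real n * (a \<bullet> i) - 1"]
        smooth.flat[of 0 "- real n" "real n * (b \<bullet> i) - 1"]]
    by (simp add: algebra_simps)
  have "differentiable_times k (bump a b n)" for k
    using smooth_prod_differentiable_times[of "\<lambda>i t. flat 0 (real n * (t - a \<bullet> i) - 1) * flat 0 (real n * (b \<bullet> i - t) - 1)" k] smooth
    by (simp add: bump_def[abs_def])
  moreover have "\<exists>K. compact K \<and> K \<subseteq> box 0 One \<and> (\<forall>x. x \<notin> K \<longrightarrow> bump a b n x = 0)"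
  proof (cases "n = 0")
    case True
    \<comment> \<open>Every factor is \<open>flat 0 (-1) = 0\<close>.\<close>
    have "bump a b n x = 0" for x
      unfolding bump_def using True SOME_Basis by (intro prod_zero bexI[of _ "SOME i. i \<in> Basis"]) (auto simp: flat_def)
    then show ?thesis by (intro exI[of _ "{}"]) auto
  next
    case False
    let ?e = "(1 / real n) *\<^sub>R One :: 'a"
    have "cbox (a + ?e) (b - ?e) \<subseteq> box a b"
    proof
      fix x assume x: "x \<in> cbox (a + ?e) (b - ?e)"
      have "a \<bullet> i < x \<bullet> i \<and> x \<bullet> i < b \<bullet> i" if i: "i \<in> Basis" for i
      proof -
        have "a \<bullet> i + 1 / real n \<le> x \<bullet> i" "x \<bullet> i \<le> b \<bullet> i - 1 / real n"
          using x i by (auto simp: mem_box inner_add_left inner_diff_left)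
        moreover have "0 < 1 / real n" using False by simp
        ultimately show ?thesis by linarith
      qed
      then show "x \<in> box a b" by (simp add: mem_box)
    qed
    moreover have "bump a b n x = 0" if x: "x \<notin> cbox (a + ?e) (b - ?e)" for x
    proof -
      obtain i where i: "i \<in> Basis" "x \<bullet> i < a \<bullet> i + 1 / real n \<or> b \<bullet> i - 1 / real n < x \<bullet> i"
        using x by (auto simp: mem_box inner_add_left inner_diff_left not_le)
      then have "real n * (x \<bullet> i - a \<bullet> i) - 1 < 0 \<or> real n * (b \<bullet> i - x \<bullet> i) - 1 < 0"
        using False by (auto simp: field_simps)
      then have "flat 0 (real n * (x \<bullet> i - a \<bullet> i) - 1) * flat 0 (real n * (b \<bullet> i - x \<bullet> i) - 1) = 0"
        by (auto simp: flat_def)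
      then show ?thesis unfolding bump_def using i(1) by (intro prod_zero) auto
    qed
    ultimately show ?thesis using ab by (intro exI[of _ "cbox (a + ?e) (b - ?e)"]) auto
  qed
  ultimately show ?thesis by (simp add: test_function_def)
qed

lemma flat_0_linear_tendsto:
  assumes "0 < c"
  shows "(\<lambda>n. flat 0 (real n * c - 1)) \<longlonglongrightarrow> 1"
proof -
  have lim: "filterlim (\<lambda>n. real n * c - 1) at_top sequentially"
    using filterlim_tendsto_add_at_top[OF tendsto_const[of "-1"]
        filterlim_tendsto_pos_mult_at_top[OF tendsto_const assms filterlim_real_sequentially]]
    by (simp add: mult.commute)
  have "(\<lambda>n. exp (- inverse (real n * c - 1))) \<longlonglongrightarrow> exp (- 0)"
    by (intro tendsto_intros filterlim_compose[OF tendsto_inverse_0_at_top lim] tendsto_inverse_0_at_top lim)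
  moreover have "\<forall>\<^sub>F n in sequentially. exp (- inverse (real n * c - 1)) = flat 0 (real n * c - 1)"
    using filterlim_at_top_dense[THEN iffD1, OF lim, rule_format, of 0]
    by eventually_elim (simp add: flat_def)
  ultimately show ?thesis by (simp add: Lim_transform_eventually)
qed

lemma bump_tendsto: "(\<lambda>n. bump a b n x) \<longlonglongrightarrow> indicator (box a b) x"
proof (cases "x \<in> box a b")
  case True
  then have "(\<lambda>n. bump a b n x) \<longlonglongrightarrow> (\<Prod>i\<in>(Basis::'a set). 1 * 1)"
    unfolding bump_def by (intro tendsto_prod tendsto_mult flat_0_linear_tendsto) (auto simp: mem_box)
  then show ?thesis using True by simp
next
  case False
  have "bump a b n x = 0" for n
  proof -
    obtain i where i: "i \<in> Basis" "x \<bullet> i \<le> a \<bullet> i \<or> b \<bullet> i \<le> x \<bullet> i"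
      using False by (auto simp: mem_box not_less)
    then have "real n * (x \<bullet> i - a \<bullet> i) \<le> 0 \<or> real n * (b \<bullet> i - x \<bullet> i) \<le> 0"
      by (auto simp: mult_nonneg_nonpos)
    then have "flat 0 (real n * (x \<bullet> i - a \<bullet> i) - 1) * flat 0 (real n * (b \<bullet> i - x \<bullet> i) - 1) = 0"
      by (auto simp: flat_def)
    then show ?thesis unfolding bump_def using i(1) by (intro prod_zero) auto
  qed
  then show ?thesis using False by simp
qed

text \<open>
  Bumps approximate the indicator functions of boxes inside the open cube boundedly, so dominated
  convergence gives vanishing integrals over all these boxes. The boundary of the cube is a null
  set.
\<close>

lemma AE_zero_if_test_integrals_zero:
  fixes g :: "'a::euclidean_space \<Rightarrow> real"
  assumes g: "square_integrable g"
    and zero: "\<And>\<phi>. test_function \<phi> \<Longrightarrow> (\<integral>x. g x * \<phi> x \<partial>cube_measure) = 0"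
  shows "AE x in cube_measure. g x = 0"
proof -
  have int: "integrable cube_measure g"
    using square_integrable_mult[OF g square_integrable_continuous[OF continuous_on_const[of UNIV 1]]] by simp
  have box: "(\<integral>x. indicator (box a b) x * g x \<partial>cube_measure) = 0" if ab: "box a b \<subseteq> box 0 One" for a b
  proof -
    have [measurable]: "g \<in> borel_measurable cube_measure" using g by (simp add: square_integrable_def)
    have bm [measurable]: "bump a b n \<in> borel_measurable cube_measure" for n
      using test_function_square_integrable(1)[OF test_function_bump[OF ab]] by (simp add: square_integrable_def)
    have ind: "(\<lambda>x. indicator (box a b) x * g x) \<in> borel_measurable cube_measure"
      by (intro borel_measurable_times borel_measurable_LIMSEQ_real[OF bump_tendsto bm]) simp
    have "(\<lambda>n. \<integral>x. bump a b n x * g x \<partial>cube_measure) \<longlonglongrightarrow> (\<integral>x. indicator (box a b) x * g x \<partial>cube_measure)"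
    proof (rule integral_dominated_convergence[where w = "\<lambda>x. \<bar>g x\<bar>"])
      show "AE x in cube_measure. (\<lambda>n. bump a b n x * g x) \<longlonglongrightarrow> indicator (box a b) x * g x"
        by (intro AE_I2 tendsto_mult bump_tendsto tendsto_const)
      show "AE x in cube_measure. norm (bump a b n x * g x) \<le> \<bar>g x\<bar>" for n
        using bump_bounds[of a b n] by (auto simp: abs_mult intro!: mult_left_le_one_le)
    qed (use int ind in auto)
    moreover have "(\<integral>x. bump a b n x * g x \<partial>cube_measure) = 0" for n
      using zero[OF test_function_bump[OF ab], of n] by (simp add: mult.commute)
    ultimately show ?thesis by (simp add: LIMSEQ_const_iff)
  qed
  define G where "G x = indicator (cbox 0 One) x * (indicator (box 0 One) x * g x)" for x :: 'a
  have cube: "(\<integral>x. f x \<partial>cube_measure) = (\<integral>x. indicator (cbox 0 One) x * f x \<partial>lborel)" for f :: "'a \<Rightarrow> real"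
    by (simp add: cube_measure_def integral_restrict_space)
  have "integrable lborel (\<lambda>x. indicator (cbox 0 One) x * g x)"
    using int by (simp add: cube_measure_def integrable_restrict_space)
  from integrable_mult_indicator[OF _ this, of "box 0 One"]
  have G_int: "integrable lborel G"
    by (simp add: G_def[abs_def] mult_ac)
  have "(\<integral>x. indicator (box a b) x * G x \<partial>lborel) = 0" for a b
  proof -
    obtain c d where cd: "box a b \<inter> box 0 One = box c (d::'a)" by (simp add: box_Int_box)
    have "indicator (box a b) x * G x = indicator (cbox 0 One) x * (indicator (box c d) x * g x)" for x
      unfolding G_def cd[symmetric] by (auto simp: indicator_def)
    then show ?thesis using box[of c d] cd by (auto simp: cube)
  qed
  then have "AE x in lborel. G x = 0" by (rule AE_zero_if_box_integrals_zero[OF G_int])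
  moreover have "AE x in lborel. x \<notin> cbox 0 One - box (0::'a) One"
    by (rule AE_not_in) (auto simp: null_sets_def emeasure_lborel_cbox_eq emeasure_lborel_box_eq emeasure_Diff box_subset_cbox)
  ultimately have "AE x in lborel. x \<in> cbox 0 One \<longrightarrow> g x = 0"
    by eventually_elim (auto simp: G_def indicator_def split: if_splits)
  then show ?thesis unfolding cube_measure_def
    by (subst AE_restrict_space_iff) auto
qed

lemma square_integrable_rep_L2: "square_integrable (rep_L2 f)"
  using Quotient3_rep_reflp[OF Quotient3_L2, of f] by (simp add: L2_rel_def)

lemma rep_L2_abs_L2: "square_integrable F \<Longrightarrow> AE x in cube_measure. rep_L2 (abs_L2 F) x = F x"
  using rep_abs_rsp_left[OF Quotient3_L2, of F F] by (simp add: L2_rel_def)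

lemma L2_eqI: "AE x in cube_measure. rep_L2 f x = rep_L2 g x \<Longrightarrow> f = g"
  using Quotient3_rel_rep[OF Quotient3_L2, of f g] by (simp add: L2_rel_def square_integrable_rep_L2)

lemma rep_L2_add: "AE x in cube_measure. rep_L2 (f + g) x = rep_L2 f x + rep_L2 g x"
  using rep_L2_abs_L2[of "\<lambda>x. rep_L2 f x + rep_L2 g x"]
  by (simp add: plus_L2_def square_integrable_add square_integrable_rep_L2)

lemma rep_L2_scaleR: "AE x in cube_measure. rep_L2 (c *\<^sub>R f) x = c * rep_L2 f x"
  using rep_L2_abs_L2[of "\<lambda>x. c * rep_L2 f x"]
  by (simp add: scaleR_L2_def square_integrable_scale square_integrable_rep_L2)

lemma rep_L2_zero: "AE x in cube_measure. rep_L2 0 x = 0"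
  using rep_L2_abs_L2[of "\<lambda>x. 0"] by (simp add: zero_L2_def)

lemma rep_L2_tensor:
  "AE x in cube_measure. rep_L2 (tensor f) x = (\<Prod>m\<in>UNIV. rep_L2 (f m) (x $ m))"
  using rep_L2_abs_L2[OF square_integrable_tensor[of "\<lambda>m. rep_L2 (f m)"]]
  by (simp add: tensor_def square_integrable_rep_L2)

lemma integral_cong_cube:
  assumes "AE x in cube_measure. f x = g x" "square_integrable f" "square_integrable g" "square_integrable h"
  shows "(\<integral>x. f x * h x \<partial>cube_measure) = (\<integral>x. g x * h x \<partial>cube_measure)"
  using assms by (intro integral_cong_AE) (auto simp: square_integrable_def elim: eventually_mono)


lemma integral_rep_L2_add:
  assumes "square_integrable h"
  shows "(\<integral>x. rep_L2 (f + g) x * h x \<partial>cube_measure) =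
    (\<integral>x. rep_L2 f x * h x \<partial>cube_measure) + (\<integral>x. rep_L2 g x * h x \<partial>cube_measure)"
proof -
  have "(\<integral>x. rep_L2 (f + g) x * h x \<partial>cube_measure) =
      (\<integral>x. (rep_L2 f x + rep_L2 g x) * h x \<partial>cube_measure)"
    by (intro integral_cong_cube rep_L2_add square_integrable_rep_L2 square_integrable_add assms)
  also have "\<dots> = (\<integral>x. rep_L2 f x * h x + rep_L2 g x * h x \<partial>cube_measure)"
    by (simp add: distrib_right)
  also have "\<dots> = (\<integral>x. rep_L2 f x * h x \<partial>cube_measure) + (\<integral>x. rep_L2 g x * h x \<partial>cube_measure)"
    by (intro Bochner_Integration.integral_add square_integrable_mult square_integrable_rep_L2 assms)
  finally show ?thesis .
qed

lemma integral_rep_L2_scaleR: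
  assumes "square_integrable h"
  shows "(\<integral>x. rep_L2 (c *\<^sub>R f) x * h x \<partial>cube_measure) = c * (\<integral>x. rep_L2 f x * h x \<partial>cube_measure)"
proof -
  have "(\<integral>x. rep_L2 (c *\<^sub>R f) x * h x \<partial>cube_measure) = (\<integral>x. (c * rep_L2 f x) * h x \<partial>cube_measure)"
    by (intro integral_cong_cube rep_L2_scaleR square_integrable_rep_L2 square_integrable_scale assms)
  then show ?thesis by (simp add: mult.assoc)
qed

lemma integral_rep_L2_zero: "square_integrable h \<Longrightarrow> (\<integral>x. rep_L2 0 x * h x \<partial>cube_measure) = 0"
  using integral_rep_L2_scaleR[of h 0 0] by simp

lemma has_weak_derivative_add:
  assumes "b \<in> Basis" "has_weak_derivative b f f'" "has_weak_derivative b g g'"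
  shows "has_weak_derivative b (f + g) (f' + g')"
  using assms
  by (auto simp: has_weak_derivative_def integral_rep_L2_add test_function_square_integrable)

lemma has_weak_derivative_scaleR:
  assumes "b \<in> Basis" "has_weak_derivative b f f'"
  shows "has_weak_derivative b (c *\<^sub>R f) (c *\<^sub>R f')"
  using assms
  by (auto simp: has_weak_derivative_def integral_rep_L2_scaleR test_function_square_integrable)

lemma has_weak_derivative_zero: "b \<in> Basis \<Longrightarrow> has_weak_derivative b 0 0"
  by (auto simp: has_weak_derivative_def integral_rep_L2_zero test_function_square_integrable)

text \<open>
  This makes the definite description in \<open>weak_derivative\<close> meaningful.
\<close>

lemma has_weak_derivative_unique:
  assumes "has_weak_derivative b f g" "has_weak_derivative b f g'"
  shows "g = g'"
proof -
  have "AE x in cube_measure. rep_L2 (g - g') x = 0"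
  proof (rule AE_zero_if_test_integrals_zero[OF square_integrable_rep_L2])
    fix \<phi> :: "'a \<Rightarrow> real" assume \<phi>: "test_function \<phi>"
    have "(\<integral>x. rep_L2 g x * \<phi> x \<partial>cube_measure) = (\<integral>x. rep_L2 g' x * \<phi> x \<partial>cube_measure)"
      using assms \<phi> unfolding has_weak_derivative_def by (metis neg_equal_iff_equal)
    then show "(\<integral>x. rep_L2 (g - g') x * \<phi> x \<partial>cube_measure) = 0"
      using integral_rep_L2_add[OF test_function_square_integrable(1)[OF \<phi>], of g "(-1) *\<^sub>R g'"]
        integral_rep_L2_scaleR[OF test_function_square_integrable(1)[OF \<phi>], of "-1" g']
      by simp
  qed
  then have "AE x in cube_measure. rep_L2 (g - g') x = rep_L2 0 x"
    using rep_L2_zero by eventually_elim simp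
  then show ?thesis using L2_eqI by force
qed

lemma weak_derivative_eqI: "has_weak_derivative b f g \<Longrightarrow> weak_derivative b f = g"
  unfolding weak_derivative_def by (rule the_equality) (auto intro: has_weak_derivative_unique)

section \<open>Integration along coordinate lines\<close>

definition replace_coord :: "'n \<Rightarrow> real^'n \<Rightarrow> real \<Rightarrow> real^'n" where
  "replace_coord m x t = (\<chi> i. if i = m then t else x $ i)"

lemma replace_coord_nth [simp]: "replace_coord m x t $ i = (if i = m then t else x $ i)"
  by (simp add: replace_coord_def)

lemma space_cube: "space cube_measure = cbox 0 One"
  by (simp add: cube_measure_def space_restrict_space)

lemma sets_cube_iff: "A \<in> sets cube_measure \<longleftrightarrow> A \<subseteq> cbox 0 One \<and> A \<in> sets borel"
  by (auto simp: cube_measure_def sets_restrict_space_iff)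

lemma borel_cube_measurable: "f \<in> borel_measurable borel \<Longrightarrow> f \<in> borel_measurable cube_measure"
  by (simp add: cube_measure_def measurable_restrict_space1)

lemma replace_coord_measurable:
  fixes m :: "'n::finite"
  shows "(\<lambda>p. replace_coord m (fst p) (snd p)) \<in> (cube_measure :: (real^'n) measure) \<Otimes>\<^sub>M cube_measure \<rightarrow>\<^sub>M cube_measure"
proof -
  let ?M = "(cube_measure :: (real^'n) measure) \<Otimes>\<^sub>M (cube_measure :: real measure)"
  have nth: "(\<lambda>x::real^'n. x $ i) \<in> borel_measurable cube_measure" for i
    by (rule borel_cube_measurable) simp
  have id: "(\<lambda>t::real. t) \<in> borel_measurable cube_measure"
    by (rule borel_cube_measurable) simp
  have "(\<lambda>p. replace_coord m (fst p) (snd p) $ i) \<in> borel_measurable ?M" for i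
    using measurable_compose[OF measurable_snd id] measurable_compose[OF measurable_fst nth[of i]]
    by (cases "i = m") simp_all
  then have "(\<lambda>p. replace_coord m (fst p) (snd p)) \<in> borel_measurable ?M"
    by (subst borel_measurable_euclidean_space) (auto simp: Basis_vec_def inner_axis)
  moreover have "(\<lambda>p. replace_coord m (fst p) (snd p)) \<in> space ?M \<rightarrow> cbox 0 One"
    by (auto simp: space_pair_measure space_cube mem_box_cart)
  ultimately show ?thesis
    unfolding cube_measure_def by (intro measurable_restrict_space2) auto
qed

lemma emeasure_cube_prod:
  fixes A :: "'n::finite \<Rightarrow> real set"
  assumes "\<And>i. A i \<in> sets borel"
  shows "emeasure cube_measure {x \<in> space (cube_measure :: (real^'n) measure). \<forall>i. x $ i \<in> A i} =
    (\<Prod>i\<in>UNIV. emeasure cube_measure (A i \<inter> {0..1}))"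
    and "{x \<in> space (cube_measure :: (real^'n) measure). \<forall>i. x $ i \<in> A i} \<in> sets cube_measure"
proof -
  have s: "A i \<inter> {0..1} \<in> sets cube_measure" for i
    using assms by (auto simp: sets_cube_iff)
  let ?X = "{x \<in> space (cube_measure :: (real^'n) measure). \<forall>i. x $ i \<in> A i}"
  have X: "?X = space cube_measure \<inter> (\<Inter>i. (\<lambda>x. x $ i) -` (A i \<inter> {0..1}) \<inter> space cube_measure)"
    by (auto simp: space_cube mem_box_cart)
  show *: "?X \<in> sets cube_measure"
    unfolding X
    by (intro sets.Int sets.top sets.finite_INT measurable_sets[OF coordinate_measurable_cube s]) auto
  have "emeasure cube_measure ?X = (\<integral>\<^sup>+x. indicator ?X x \<partial>cube_measure)"
    using * by simp
  also have "\<dots> = (\<integral>\<^sup>+x. (\<Prod>i\<in>UNIV. indicator (A i \<inter> {0..1}) (x $ i)) \<partial>(cube_measure :: (real^'n) measure))"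
  proof (rule nn_integral_cong)
    fix x :: "real^'n" assume x: "x \<in> space cube_measure"
    show "indicator ?X x = (\<Prod>i\<in>UNIV. indicator (A i \<inter> {0..1}) (x $ i) :: ennreal)"
    proof (cases "\<forall>i. x $ i \<in> A i")
      case True
      then show ?thesis using x by (auto simp: space_cube mem_box_cart)
    next
      case False
      then show ?thesis by (auto simp: indicator_def intro!: prod_zero[symmetric])
    qed
  qed
  also have "\<dots> = (\<Prod>i\<in>UNIV. \<integral>\<^sup>+t. indicator (A i \<inter> {0..1}) t \<partial>cube_measure)"
    using s by (intro nn_integral_cube_prod) auto
  finally show "emeasure cube_measure ?X = (\<Prod>i\<in>UNIV. emeasure cube_measure (A i \<inter> {0..1}))"
    using s by simp
qed

lemma emeasure_unit_interval: "emeasure cube_measure {0..1::real} = 1"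
  by (simp add: cube_measure_def emeasure_restrict_space)

text \<open>
  Replacing one coordinate of a random point of the cube by an independent random number does not
  change the distribution: both measures of a box are the product of its side lengths inside the
  cube, because the replaced coordinate ranges over a set of measure \<open>1\<close>.
\<close>

lemma distr_replace_coord:
  fixes m :: "'n::finite"
  shows "distr ((cube_measure :: (real^'n) measure) \<Otimes>\<^sub>M cube_measure) cube_measure
    (\<lambda>p. replace_coord m (fst p) (snd p)) = cube_measure" (is "distr ?M _ ?r = _")
proof -
  interpret finite_measure "cube_measure :: real measure" by (rule finite_measure_cube)
  interpret n: finite_measure "cube_measure :: (real^'n) measure" by (rule finite_measure_cube)
  note r = replace_coord_measurable[of m]
  have id: "(\<lambda>x. x) \<in> (cube_measure :: (real^'n) measure) \<rightarrow>\<^sub>M borel"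
    by (rule borel_cube_measurable) simp
  have r_borel: "?r \<in> ?M \<rightarrow>\<^sub>M borel" by (rule measurable_compose[OF r id])
  have box: "emeasure (distr ?M borel ?r) (box a b) = emeasure (distr cube_measure borel (\<lambda>x. x)) (box a b)" for a b
  proof -
    define A where "A i = {a $ i<..<b $ i}" for i
    let ?A' = "A(m := UNIV)"
    let ?X = "\<lambda>A. {x \<in> space (cube_measure :: (real^'n) measure). \<forall>i. x $ i \<in> A i}"
    have A: "A i \<in> sets borel" "?A' i \<in> sets borel" for i by (auto simp: A_def)
    have "?r -` box a b \<inter> space ?M = ?X ?A' \<times> (A m \<inter> {0..1})"
      by (auto simp: space_pair_measure space_cube A_def mem_box_cart split: if_splits)
    then have "emeasure (distr ?M borel ?r) (box a b) = emeasure ?M (?X ?A' \<times> (A m \<inter> {0..1}))"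
      by (simp add: emeasure_distr[OF r_borel])
    also have "\<dots> = emeasure cube_measure (?X ?A') * emeasure cube_measure (A m \<inter> {0..1})"
      using emeasure_cube_prod(2)[of ?A'] A by (intro emeasure_pair_measure_Times) (auto simp: sets_cube_iff)
    also have "emeasure cube_measure (?X ?A') = (\<Prod>i\<in>UNIV. emeasure cube_measure (?A' i \<inter> {0..1}))"
      by (rule emeasure_cube_prod(1)) (rule A)
    also have "\<dots> = (\<Prod>i\<in>UNIV - {m}. emeasure cube_measure (A i \<inter> {0..1}))"
      by (subst prod.remove[of _ m]) (auto simp: emeasure_unit_interval)
    also have "\<dots> * emeasure cube_measure (A m \<inter> {0..1}) = (\<Prod>i\<in>UNIV. emeasure cube_measure (A i \<inter> {0..1}))"
      by (subst prod.remove[of UNIV m]) (auto simp: mult.commute)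
    also have "\<dots> = emeasure cube_measure (?X A)"
      by (rule emeasure_cube_prod(1)[symmetric]) (rule A)
    also have "?X A = box a b \<inter> space cube_measure"
      by (auto simp: A_def mem_box_cart)
    finally show ?thesis by (simp add: emeasure_distr[OF id] vimage_def)
  qed
  have borel_eq: "distr ?M borel ?r = distr cube_measure borel (\<lambda>x. x)"
  proof (rule measure_eqI_generator_eq)
    let ?E = "range (\<lambda>(a, b). box a b :: (real^'n) set)"
    show "Int_stable ?E" by (auto simp: Int_stable_def box_Int_box)
    show "?E \<subseteq> Pow UNIV" "sets (distr ?M borel ?r) = sigma_sets UNIV ?E"
      "sets (distr cube_measure borel (\<lambda>x. x)) = sigma_sets UNIV ?E"
      by (simp_all add: borel_eq_box)
    let ?A = "\<lambda>n::nat. box (- (real n *\<^sub>R One)) (real n *\<^sub>R One) :: (real^'n) set"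
    show "range ?A \<subseteq> ?E" "(\<Union>i. ?A i) = UNIV"
      unfolding UN_box_eq_UNIV by auto
    show "emeasure (distr ?M borel ?r) (?A i) \<noteq> \<infinity>" for i
      by (simp add: box emeasure_distr[OF id] n.emeasure_eq_measure)
    show "emeasure (distr ?M borel ?r) X = emeasure (distr cube_measure borel (\<lambda>x. x)) X"
      if "X \<in> ?E" for X
      using that box by auto
  qed
  show ?thesis
  proof (rule measure_eqI)
    fix X assume "X \<in> sets (distr ?M cube_measure ?r)"
    then have X: "X \<in> sets cube_measure" "X \<in> sets borel" "X \<subseteq> space cube_measure"
      by (auto simp: sets_cube_iff space_cube)
    have "emeasure (distr ?M cube_measure ?r) X = emeasure (distr ?M borel ?r) X"
      using X by (simp add: emeasure_distr[OF r] emeasure_distr[OF r_borel])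
    also have "\<dots> = emeasure cube_measure X"
      using X by (simp add: borel_eq emeasure_distr[OF id] vimage_def Int_absorb2)
    finally show "emeasure (distr ?M cube_measure ?r) X = emeasure cube_measure X" .
  qed simp
qed

text \<open>
  Fubini's theorem for one distinguished coordinate. The outer integral runs over the whole cube
  although the integrand ignores the coordinate \<open>m\<close> of \<open>x\<close>; this avoids splitting the index type.
\<close>

lemma integral_replace_coord:
  fixes F :: "real^'n::finite \<Rightarrow> real"
  assumes F: "integrable cube_measure F"
  shows "(\<integral>x. F x \<partial>cube_measure) = (\<integral>x. \<integral>t. F (replace_coord m x t) \<partial>cube_measure \<partial>cube_measure)"
proof -
  let ?M = "(cube_measure :: (real^'n) measure) \<Otimes>\<^sub>M (cube_measure :: real measure)"
  interpret a: finite_measure "cube_measure :: (real^'n) measure" by (rule finite_measure_cube)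
  interpret b: finite_measure "cube_measure :: real measure" by (rule finite_measure_cube)
  interpret pair_sigma_finite "cube_measure :: (real^'n) measure" "cube_measure :: real measure" ..
  have meas: "F \<in> borel_measurable cube_measure" using F by simp
  have "integrable ?M (\<lambda>p. F (replace_coord m (fst p) (snd p)))"
    using F integrable_distr_eq[OF replace_coord_measurable meas, of m]
    by (simp add: distr_replace_coord)
  from integral_fst'[OF this] show ?thesis
    using integral_distr[OF replace_coord_measurable meas, of m] by (simp add: distr_replace_coord)
qed

lemma replace_coord_line: "replace_coord m x = (\<lambda>t. replace_coord m x 0 + t *\<^sub>R axis m 1)"
  by (auto simp: vec_eq_iff axis_def)

lemma differentiable_times_replace_coord:
  fixes \<phi> :: "real^'n::finite \<Rightarrow> real"
  shows "differentiable_times k \<phi> \<Longrightarrow> differentiable_times k (\<lambda>t. \<phi> (replace_coord m x t))"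
    and "\<phi> differentiable at (replace_coord m x t) \<Longrightarrow>
      frechet_derivative (\<lambda>t. \<phi> (replace_coord m x t)) (at t) 1 =
      frechet_derivative \<phi> (at (replace_coord m x t)) (axis m 1)"
proof -
  have D: "((\<lambda>t. \<phi> (replace_coord m x t)) has_derivative
      (\<lambda>h. frechet_derivative \<phi> (at (replace_coord m x t)) (h *\<^sub>R axis m 1))) (at t)"
    if "\<phi> differentiable at (replace_coord m x t)" for \<phi> :: "real^'n \<Rightarrow> real" and t
  proof (rule has_derivative_compose[of "replace_coord m x", OF _ that[unfolded frechet_derivative_works]])
    show "(replace_coord m x has_derivative (\<lambda>h. h *\<^sub>R axis m 1)) (at t)"
      by (subst replace_coord_line) (auto intro!: derivative_eq_intros)
  qed
  have F: "frechet_derivative (\<lambda>t. \<phi> (replace_coord m x t)) (at t) 1 =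
      frechet_derivative \<phi> (at (replace_coord m x t)) (axis m 1)"
    if "\<phi> differentiable at (replace_coord m x t)" for \<phi> :: "real^'n \<Rightarrow> real" and t
    using fun_cong[OF frechet_derivative_at[OF D[OF that]], of 1] by simp
  then show "\<phi> differentiable at (replace_coord m x t) \<Longrightarrow>
      frechet_derivative (\<lambda>t. \<phi> (replace_coord m x t)) (at t) 1 =
      frechet_derivative \<phi> (at (replace_coord m x t)) (axis m 1)" .
  show "differentiable_times k (\<lambda>t. \<phi> (replace_coord m x t))" if "differentiable_times k \<phi>"
    using that
  proof (induction k arbitrary: \<phi>)
    case 0
    have "continuous_on UNIV (replace_coord m x)"
      by (subst replace_coord_line) (auto intro!: continuous_intros)
    with 0 show ?case by (auto intro: continuous_on_compose2)
  next
    case (Suc k)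
    then have "differentiable_times k (\<lambda>y. frechet_derivative \<phi> (at y) (axis m 1))"
      by simp
    from Suc.IH[OF this] have "differentiable_times k (\<lambda>t. frechet_derivative (\<lambda>t. \<phi> (replace_coord m x t)) (at t) 1)"
      using Suc.prems by (simp add: F)
    moreover have "(\<lambda>t. \<phi> (replace_coord m x t)) differentiable at t" for t
      using D[of \<phi> t] Suc.prems by (auto simp: differentiable_def)
    ultimately show ?case by simp
  qed
qed

text \<open>
  A test function restricted to a coordinate line is a test function of one variable, with which
  a univariate weak derivative can be tested.
\<close>

lemma test_function_replace_coord:
  fixes \<phi> :: "real^'n::finite \<Rightarrow> real"
  assumes "test_function \<phi>"
  shows "test_function (\<lambda>t. \<phi> (replace_coord m x t))"
proof -
  obtain K where K: "compact K" "K \<subseteq> box 0 One" "\<And>x. x \<notin> K \<Longrightarrow> \<phi> x = 0"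
    using assms by (auto simp: test_function_def)
  let ?K = "replace_coord m x -` K"
  have sub: "?K \<subseteq> box 0 One"
  proof
    fix t assume "t \<in> ?K"
    then have "replace_coord m x t \<in> box 0 One" using K(2) by auto
    then have "0 < replace_coord m x t $ m \<and> replace_coord m x t $ m < 1" by (simp add: mem_box_cart del: replace_coord_nth)
    then show "t \<in> box 0 One" by simp
  qed
  have "closed ?K"
  proof (rule continuous_closed_vimage[OF compact_imp_closed[OF K(1)]])
    show "isCont (replace_coord m x) t" for t
      by (subst replace_coord_line) (intro continuous_intros)
  qed
  moreover have "bounded ?K" using sub bounded_subset[OF bounded_box] by blast
  ultimately have "compact ?K" by (simp add: compact_eq_bounded_closed)
  then show ?thesis
    using assms sub K(3) unfolding test_function_def
    by (intro conjI allI differentiable_times_replace_coord exI[of _ ?K]) auto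
qed

section \<open>Weak derivatives of tensor products\<close>

text \<open>
  Fubini's theorem moves the integration over the coordinate \<open>m\<close> inside, where the other factors
  are constants and the weak derivative of \<open>f m\<close> can be used.
\<close>

lemma has_weak_derivative_tensor:
  fixes f :: "'n::finite \<Rightarrow> real L2"
  assumes g: "has_weak_derivative 1 (f m) g"
  shows "has_weak_derivative (axis m 1) (tensor f) (tensor (f(m := g)))"
  unfolding has_weak_derivative_def
proof (intro allI impI)
  fix \<phi> :: "real^'n \<Rightarrow> real" assume \<phi>: "test_function \<phi>"
  let ?r = "replace_coord m"
  define c where "c x = (\<Prod>i\<in>UNIV - {m}. rep_L2 (f i) (x $ i))" for x :: "real^'n"
  have fubini: "(\<integral>x. rep_L2 (tensor (f(m := h))) x * \<psi> x \<partial>cube_measure) =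
      (\<integral>x. c x * (\<integral>t. rep_L2 h t * \<psi> (?r x t) \<partial>cube_measure) \<partial>cube_measure)"
    if \<psi>: "square_integrable \<psi>" for h \<psi>
  proof -
    let ?F = "\<lambda>x. (\<Prod>i\<in>UNIV. rep_L2 ((f(m := h)) i) (x $ i)) * \<psi> x"
    have sq: "square_integrable (\<lambda>x::real^'n. \<Prod>i\<in>UNIV. rep_L2 ((f(m := h)) i) (x $ i))"
      by (rule square_integrable_tensor) (rule square_integrable_rep_L2)
    have "(\<integral>x. rep_L2 (tensor (f(m := h))) x * \<psi> x \<partial>cube_measure) = (\<integral>x. ?F x \<partial>cube_measure)"
      by (intro integral_cong_cube rep_L2_tensor square_integrable_rep_L2 sq \<psi>)
    also have "\<dots> = (\<integral>x. \<integral>t. ?F (?r x t) \<partial>cube_measure \<partial>cube_measure)"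
      by (intro integral_replace_coord square_integrable_mult sq \<psi>)
    also have "\<dots> = (\<integral>x. \<integral>t. c x * (rep_L2 h t * \<psi> (?r x t)) \<partial>cube_measure \<partial>cube_measure)"
    proof -
      have "?F (?r x t) = c x * (rep_L2 h t * \<psi> (?r x t))" for x t
        unfolding c_def by (subst prod.remove[of _ m]) (auto simp: mult_ac)
      then show ?thesis by (simp only:)
    qed
    finally show ?thesis by simp
  qed
  have diff: "\<phi> differentiable at x" for x
    using \<phi> unfolding test_function_def by (metis differentiable_times.simps(2))
  have axis: "axis m 1 \<in> (Basis :: (real^'n) set)" by (auto simp: Basis_vec_def)
  have inner: "(\<integral>t. rep_L2 (f m) t * frechet_derivative \<phi> (at (?r x t)) (axis m 1) \<partial>cube_measure) =
      - (\<integral>t. rep_L2 g t * \<phi> (?r x t) \<partial>cube_measure)" for x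
    using g[unfolded has_weak_derivative_def, rule_format, OF test_function_replace_coord[OF \<phi>, of m x]]
    by (simp only: differentiable_times_replace_coord(2)[OF diff])
  have "(\<integral>x. rep_L2 (tensor f) x * frechet_derivative \<phi> (at x) (axis m 1) \<partial>cube_measure) =
      (\<integral>x. c x * (\<integral>t. rep_L2 (f m) t * frechet_derivative \<phi> (at (?r x t)) (axis m 1) \<partial>cube_measure) \<partial>cube_measure)"
    using fubini[OF test_function_square_integrable(2)[OF \<phi> axis], of "f m"] by simp
  also have "\<dots> = - (\<integral>x. c x * (\<integral>t. rep_L2 g t * \<phi> (?r x t) \<partial>cube_measure) \<partial>cube_measure)"
    by (simp add: inner)
  also have "\<dots> = - (\<integral>x. rep_L2 (tensor (f(m := g))) x * \<phi> x \<partial>cube_measure)"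
    by (simp only: fubini[OF test_function_square_integrable(1)[OF \<phi>]])
  finally show "(\<integral>x. rep_L2 (tensor f) x * frechet_derivative \<phi> (at x) (axis m 1) \<partial>cube_measure) =
      - (\<integral>x. rep_L2 (tensor (f(m := g))) x * \<phi> x \<partial>cube_measure)" .
qed

lemma axis_in_Basis: "axis m 1 \<in> (Basis :: (real^'n) set)"
  by (auto simp: Basis_vec_def)

lemma tensor_in_space: "(\<And>m. f m \<in> A m) \<Longrightarrow> tensor f \<in> tensor_space A"
  unfolding tensor_space_def by (rule span_base) auto

lemma tensor_space_weak_derivative:
  fixes A :: "'n::finite \<Rightarrow> real L2 set"
  assumes "\<And>f. f \<in> A m \<Longrightarrow> \<exists>g\<in>A'. has_weak_derivative 1 f g" and "u \<in> tensor_space A"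
  shows "\<exists>v\<in>tensor_space (A(m := A')). has_weak_derivative (axis m 1) u v"
  using assms(2) unfolding tensor_space_def[of A]
proof (induction rule: span_induct_alt)
  case base
  show ?case
    using has_weak_derivative_zero[OF axis_in_Basis]
    by (auto simp: tensor_space_def span_zero intro!: bexI[of _ 0])
next
  case (step c x y)
  then obtain f where f: "x = tensor f" "\<And>m. f m \<in> A m" by auto
  obtain g where g: "g \<in> A'" "has_weak_derivative 1 (f m) g" using assms(1) f(2) by blast
  obtain v where v: "v \<in> tensor_space (A(m := A'))" "has_weak_derivative (axis m 1) y v"
    using step(2) by blast
  have "tensor (f(m := g)) \<in> tensor_space (A(m := A'))"
    using f(2) g(1) by (intro tensor_in_space) auto
  then have "c *\<^sub>R tensor (f(m := g)) + v \<in> tensor_space (A(m := A'))"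
    using v(1) unfolding tensor_space_def by (intro span_add span_scale)
  moreover have "has_weak_derivative (axis m 1) (c *\<^sub>R x + y) (c *\<^sub>R tensor (f(m := g)) + v)"
    unfolding f(1)
    by (intro has_weak_derivative_add has_weak_derivative_scaleR has_weak_derivative_tensor axis_in_Basis g(2) v(2))
  ultimately show ?case by blast
qed

text \<open>
  On a tensor product two partial derivatives in different directions act on different factors.
\<close>

lemma weak_derivatives_commute:
  fixes A :: "'n::finite \<Rightarrow> real L2 set"
  assumes mp: "m \<noteq> p"
    and "\<And>f. f \<in> A m \<Longrightarrow> \<exists>g. has_weak_derivative 1 f g" "\<And>f. f \<in> A p \<Longrightarrow> \<exists>g. has_weak_derivative 1 f g"
    and "u \<in> tensor_space A"
  shows "weak_derivative (axis m 1) (weak_derivative (axis p 1) u) =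
    weak_derivative (axis p 1) (weak_derivative (axis m 1) u)"
proof -
  have "\<exists>v w z. has_weak_derivative (axis m 1) u v \<and> has_weak_derivative (axis p 1) u w \<and>
      has_weak_derivative (axis p 1) v z \<and> has_weak_derivative (axis m 1) w z"
    using assms(4) unfolding tensor_space_def
  proof (induction rule: span_induct_alt)
    case base
    show ?case
      using has_weak_derivative_zero[OF axis_in_Basis] by blast
  next
    case (step c x y)
    then obtain f where f: "x = tensor f" "\<And>m. f m \<in> A m" by auto
    obtain g h where g: "has_weak_derivative 1 (f m) g" and h: "has_weak_derivative 1 (f p) h"
      using assms(2,3) f(2) by blast
    let ?v = "tensor (f(m := g))" and ?w = "tensor (f(p := h))" and ?z = "tensor (f(m := g, p := h))"
    have x: "has_weak_derivative (axis m 1) x ?v" "has_weak_derivative (axis p 1) x ?w"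
      unfolding f(1) by (intro has_weak_derivative_tensor g h)+
    have "has_weak_derivative (axis p 1) ?v ?z"
      using mp h by (intro has_weak_derivative_tensor) auto
    moreover have "has_weak_derivative (axis m 1) ?w ?z"
      unfolding fun_upd_twist[OF mp] using mp g by (intro has_weak_derivative_tensor) auto
    moreover obtain v w z where "has_weak_derivative (axis m 1) y v" "has_weak_derivative (axis p 1) y w"
      "has_weak_derivative (axis p 1) v z" "has_weak_derivative (axis m 1) w z"
      using step by auto
    ultimately show ?case
      using x
      by (intro exI[of _ "c *\<^sub>R ?v + v"] exI[of _ "c *\<^sub>R ?w + w"] exI[of _ "c *\<^sub>R ?z + z"] conjI
        has_weak_derivative_add has_weak_derivative_scaleR axis_in_Basis)
  qed
  then show ?thesis by (metis weak_derivative_eqI)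
qed

lemma tensor_fun_upd_add: "tensor (f(m := a + b)) = tensor (f(m := a)) + tensor (f(m := b))"
proof (rule L2_eqI)
  have "AE x in cube_measure. rep_L2 (a + b) (x $ m) = rep_L2 a (x $ m) + rep_L2 b (x $ m)"
    by (rule AE_cube_coordinate[OF rep_L2_add])
  with rep_L2_tensor[of "f(m := a + b)"] rep_L2_tensor[of "f(m := a)"] rep_L2_tensor[of "f(m := b)"]
    rep_L2_add[of "tensor (f(m := a))" "tensor (f(m := b))"]
  show "AE x in cube_measure. rep_L2 (tensor (f(m := a + b))) x =
      rep_L2 (tensor (f(m := a)) + tensor (f(m := b))) x"
    by eventually_elim (simp add: prod.remove[of UNIV m] distrib_right)
qed

lemma tensor_fun_upd_scaleR: "tensor (f(m := c *\<^sub>R a)) = c *\<^sub>R tensor (f(m := a))"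
proof (rule L2_eqI)
  have "AE x in cube_measure. rep_L2 (c *\<^sub>R a) (x $ m) = c * rep_L2 a (x $ m)"
    by (rule AE_cube_coordinate[OF rep_L2_scaleR])
  with rep_L2_tensor[of "f(m := c *\<^sub>R a)"] rep_L2_tensor[of "f(m := a)"]
    rep_L2_scaleR[of c "tensor (f(m := a))"]
  show "AE x in cube_measure. rep_L2 (tensor (f(m := c *\<^sub>R a))) x = rep_L2 (c *\<^sub>R tensor (f(m := a))) x"
    by eventually_elim (simp add: prod.remove[of UNIV m] mult.assoc)
qed

lemma linear_tensor_fun_upd: "linear (\<lambda>a. tensor (f(m := a)))"
  by (rule linearI) (rule tensor_fun_upd_add tensor_fun_upd_scaleR)+

text \<open>
  By multilinearity the tensor products of the generators of the factors suffice; the induction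
  replaces one factor after the other by a generator.
\<close>

lemma tensor_space_finite_dim:
  fixes A :: "'n::finite \<Rightarrow> real L2 set"
  assumes "\<And>m. \<exists>F. finite F \<and> A m = span F"
  shows "\<exists>F. finite F \<and> tensor_space A = span F"
proof -
  obtain F where F: "\<And>m. finite (F m)" "\<And>m. A m = span (F m)" using assms by metis
  let ?T = "tensor ` {f. \<forall>m. f m \<in> F m}"
  have fin: "finite {f. \<forall>m. f m \<in> F m}"
    using finite_PiE[of UNIV F] F(1) by (simp add: PiE_def Pi_def)
  have "tensor f \<in> span ?T" if "\<And>m. m \<in> M \<Longrightarrow> f m \<in> span (F m)" "\<And>m. m \<notin> M \<Longrightarrow> f m \<in> F m" for M f
    using finite[of M] that
  proof (induction M arbitrary: f rule: finite_induct)
    case empty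
    then show ?case by (intro span_base) auto
  next
    case (insert m M)
    have "tensor (f(m := a)) \<in> span ?T" if "a \<in> span (F m)" for a
      using that
    proof (induction rule: span_induct_alt)
      case base
      show ?case unfolding linear_0[OF linear_tensor_fun_upd[of f m]] by (rule span_zero)
    next
      case (step c x y)
      have "tensor (f(m := x)) \<in> span ?T"
        using insert.prems insert.hyps step(1) by (intro insert.IH) auto
      then show ?case
        unfolding tensor_fun_upd_add tensor_fun_upd_scaleR using step(2) by (intro span_add span_scale)
    qed
    from this[of "f m"] insert.prems show ?case by simp
  qed
  from this[of UNIV] have "tensor_space A \<subseteq> span ?T"
    unfolding tensor_space_def F(2) by (intro span_minimal) auto
  moreover have "span ?T \<subseteq> tensor_space A"
    unfolding tensor_space_def F(2) by (intro span_mono) (auto intro: span_base)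
  ultimately show ?thesis using fin by (intro exI[of _ ?T]) auto
qed

section \<open>Exterior algebra\<close>

lemma length_remove_nth: "i < length xs \<Longrightarrow> length (remove_nth i xs) = length xs - 1"
  by (simp add: remove_nth_def)

lemma nth_remove_nth:
  "i < length xs \<Longrightarrow> j < length xs - 1 \<Longrightarrow>
     remove_nth i xs ! j = (if j < i then xs ! j else xs ! Suc j)"
  by (auto simp: remove_nth_def nth_append)

lemma remove_nth_Cons_0 [simp]: "remove_nth 0 (x # xs) = xs"
  by (simp add: remove_nth_def)

lemma remove_nth_Cons_Suc [simp]: "remove_nth (Suc i) (x # xs) = x # remove_nth i xs"
  by (simp add: remove_nth_def)

lemma remove_nth_commute:
  fixes xs :: "'a list"
  assumes "j < i" "i < length xs"
  shows "remove_nth j (remove_nth i xs) = remove_nth (i - 1) (remove_nth j xs)"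
proof (rule nth_equalityI)
  show "length (remove_nth j (remove_nth i xs)) = length (remove_nth (i - 1) (remove_nth j xs))"
    using assms by (simp add: length_remove_nth)
  fix p assume "p < length (remove_nth j (remove_nth i xs))"
  with assms show "remove_nth j (remove_nth i xs) ! p = remove_nth (i - 1) (remove_nth j xs) ! p"
    by (auto simp: length_remove_nth nth_remove_nth)
qed

text \<open>
  Removing position \<open>i\<close> and then position \<open>j\<close> of the shortened list removes two entries, in one
  of two orders. The right side pairs the two orders of every such removal.
\<close>

lemma sum_lessThan_split_pairs:
  fixes F :: "nat \<Rightarrow> nat \<Rightarrow> real"
  shows "(\<Sum>i<N. \<Sum>j<N - 1. F i j) =
     (\<Sum>(i, j)\<in>{(i, j). j < i \<and> i < N}. F i j + F j (i - 1))"
proof -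
  have fin: "finite {(i, j). j < i \<and> i < N}"
    by (rule finite_subset[of _ "{..<N} \<times> {..<N}"]) auto
  have fin2: "finite {(i, j). i \<le> j \<and> j < N - 1}"
    by (rule finite_subset[of _ "{..<N} \<times> {..<N}"]) auto
  have *: "{..<N} \<times> {..<N - 1} = {(i, j). j < i \<and> i < N} \<union> {(i, j). i \<le> j \<and> j < N - 1}"
    by auto
  have "(\<Sum>i<N. \<Sum>j<N - 1. F i j) = (\<Sum>(i, j)\<in>{..<N} \<times> {..<N - 1}. F i j)"
    by (simp add: sum.cartesian_product)
  also have "\<dots> = (\<Sum>(i, j)\<in>{(i, j). j < i \<and> i < N}. F i j) + (\<Sum>(i, j)\<in>{(i, j). i \<le> j \<and> j < N - 1}. F i j)"
    unfolding * by (rule sum.union_disjoint) (use fin fin2 in auto)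
  also have "(\<Sum>(i, j)\<in>{(i, j). i \<le> j \<and> j < N - 1}. F i j) =
      (\<Sum>(i, j)\<in>{(i, j). j < i \<and> i < N}. F j (i - 1))"
    by (rule sum.reindex_bij_witness[of _ "\<lambda>(i, j). (j, i - 1)" "\<lambda>(i, j). (Suc j, i)"]) auto
  finally show ?thesis by (simp add: sum.distrib case_prod_unfold)
qed

text \<open>
  Exchanging the order in which two entries are removed shifts one of the positions by \<open>1\<close>, which
  flips the sign.
\<close>

lemma wedge1_anticommute:
  fixes \<omega> :: "'n::finite form"
  shows "wedge1 \<alpha> (wedge1 \<beta> \<omega>) = - wedge1 \<beta> (wedge1 \<alpha> \<omega>)"
proof (rule ext)
  fix vs :: "(real^'n) list"
  let ?N = "length vs"
  define F where "F \<alpha> \<beta> i j = (-1) ^ (i + j) * \<alpha> (vs ! i) * \<beta> (remove_nth i vs ! j) *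
      \<omega> (remove_nth j (remove_nth i vs))" for \<alpha> \<beta> :: "real^'n \<Rightarrow> real" and i j
  have W: "wedge1 \<alpha> (wedge1 \<beta> \<omega>) vs =
      (\<Sum>(i, j)\<in>{(i, j). j < i \<and> i < ?N}. F \<alpha> \<beta> i j + F \<alpha> \<beta> j (i - 1))" for \<alpha> \<beta>
  proof -
    have "wedge1 \<alpha> (wedge1 \<beta> \<omega>) vs = (\<Sum>i<?N. \<Sum>j<?N - 1. F \<alpha> \<beta> i j)"
      by (auto simp: wedge1_def F_def length_remove_nth sum_distrib_left power_add mult_ac
          intro!: sum.cong)
    then show ?thesis by (simp only: sum_lessThan_split_pairs)
  qed
  have "F \<alpha> \<beta> i j + F \<alpha> \<beta> j (i - 1) = - (F \<beta> \<alpha> i j + F \<beta> \<alpha> j (i - 1))" if "j < i" "i < ?N" for i j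
  proof -
    have "remove_nth i vs ! j = vs ! j" "remove_nth j vs ! (i - 1) = vs ! i"
      using that by (auto simp: nth_remove_nth)
    moreover have "(-1::real) ^ (i + j) = - ((-1) ^ (j + (i - 1)))"
      using that by (cases i) (auto simp: add.commute)
    ultimately show ?thesis
      using remove_nth_commute[OF that] by (simp add: F_def mult_ac)
  qed
  then show "wedge1 \<alpha> (wedge1 \<beta> \<omega>) vs = (- wedge1 \<beta> (wedge1 \<alpha> \<omega>)) vs"
    unfolding fun_Compl_def W sum_negf[symmetric] by (intro sum.cong) auto
qed

lemma wedge1_self: "wedge1 \<alpha> (wedge1 \<alpha> \<omega>) = 0"
proof (rule ext)
  fix vs show "wedge1 \<alpha> (wedge1 \<alpha> \<omega>) vs = 0 vs"
    using fun_cong[OF wedge1_anticommute[of \<alpha> \<alpha> \<omega>], of vs] by (simp add: zero_fun_def)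
qed

lemma sum_fun_apply: "(\<Sum>i\<in>I. f i) x = (\<Sum>i\<in>I. f i x)"
  by (induction I rule: infinite_finite_induct) auto

lemma wedge1_zero [simp]: "wedge1 \<alpha> 0 = 0"
  by (auto simp: wedge1_def)

lemma wedge1_scaleR: "wedge1 \<alpha> (c *\<^sub>R \<omega>) = c *\<^sub>R wedge1 \<alpha> \<omega>"
  by (auto simp: wedge1_def scaleR_fun_def sum_distrib_left mult_ac)

definition contract :: "real^'n \<Rightarrow> 'n form \<Rightarrow> 'n form" where
  "contract v \<omega> ws = \<omega> (v # ws)"

lemma contract_wedge1: "contract v (wedge1 \<alpha> \<omega>) = \<alpha> v *\<^sub>R \<omega> - wedge1 \<alpha> (contract v \<omega>)"
  by (rule ext)
    (simp add: contract_def wedge1_def scaleR_fun_def sum.lessThan_Suc_shift sum_negf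
      del: sum.lessThan_Suc)

text \<open>
  The sign of sorting \<open>m\<close> into the increasing sequence of the elements of \<open>\<sigma>\<close>.
\<close>

definition pos_sign :: "'n::{finite,linorder} \<Rightarrow> 'n set \<Rightarrow> real" where
  "pos_sign m \<sigma> = (-1) ^ card {j \<in> \<sigma>. j < m}"

lemma pos_sign_insert:
  "p \<notin> \<sigma> \<Longrightarrow> pos_sign m (insert p \<sigma>) = (if p < m then - pos_sign m \<sigma> else pos_sign m \<sigma>)"
proof -
  assume "p \<notin> \<sigma>"
  moreover have "{j \<in> insert p \<sigma>. j < m} = (if p < m then insert p {j \<in> \<sigma>. j < m} else {j \<in> \<sigma>. j < m})"
    by auto
  ultimately show ?thesis by (auto simp: pos_sign_def)
qed

lemma pos_sign_remove:
  "p \<in> \<sigma> \<Longrightarrow> pos_sign m (\<sigma> - {p}) = (if p < m then - pos_sign m \<sigma> else pos_sign m \<sigma>)"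
  using pos_sign_insert[of p "\<sigma> - {p}" m] by (auto simp: insert_absorb)

lemma pos_sign_square [simp]: "pos_sign m \<sigma> * pos_sign m \<sigma> = 1"
  by (simp add: pos_sign_def flip: power_add mult_2)

lemma pos_sign_min: "\<forall>j\<in>\<sigma>. m < j \<Longrightarrow> pos_sign m \<sigma> = 1"
proof -
  assume "\<forall>j\<in>\<sigma>. m < j"
  then have "{j \<in> \<sigma>. j < m} = {}" by (auto dest: less_asym)
  then show ?thesis by (simp only: pos_sign_def card.empty power_0)
qed

lemma dx_set_empty: "dx_set {} = (\<lambda>vs. if vs = [] then 1 else 0)"
  by (simp add: dx_set_def)

lemma dx_set_insert_min:
  assumes "\<forall>j\<in>\<sigma>. m < j"
  shows "dx_set (insert m \<sigma>) = wedge1 (dx m) (dx_set \<sigma>)"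
proof -
  have "sorted_list_of_set (insert m \<sigma>) = m # sorted_list_of_set \<sigma>"
    using assms by (intro sorted_list_of_set_unique[THEN iffD1]) (auto simp: less_imp_le)
  then show ?thesis by (simp add: dx_set_def)
qed

text \<open>
  Induction from the largest element downwards, which follows the recursion of \<open>dx_set\<close>.
\<close>

lemma min_insert_induct:
  fixes \<sigma> :: "'n::{finite,linorder} set"
  assumes "P {}" "\<And>m \<sigma>. \<forall>j\<in>\<sigma>. m < j \<Longrightarrow> P \<sigma> \<Longrightarrow> P (insert m \<sigma>)"
  shows "P \<sigma>"
  by (rule finite_linorder_min_induct[of \<sigma> P]) (use assms in auto)

text \<open>
  Move \<open>dx m\<close> past the factors with smaller index, at the cost of one sign for each. If \<open>m\<close>
  occurs in \<open>\<sigma>\<close> it meets itself.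
\<close>

lemma wedge1_dx_set:
  "wedge1 (dx m) (dx_set \<sigma>) = (if m \<in> \<sigma> then 0 else pos_sign m \<sigma> *\<^sub>R dx_set (insert m \<sigma>))"
proof (induction \<sigma> rule: min_insert_induct)
  case 1
  then show ?case by (simp add: pos_sign_min flip: dx_set_insert_min)
next
  case (2 p \<sigma>)
  have p: "p \<notin> \<sigma>" using 2(1) by auto
  consider "m < p" | "m = p" | "p < m" by fastforce
  then show ?case
  proof cases
    case 1
    then have "\<forall>j\<in>insert p \<sigma>. m < j" using 2(1) by auto
    then show ?thesis using dx_set_insert_min[of "insert p \<sigma>" m] by (auto simp: pos_sign_min)
  next
    case m: 2
    then show ?thesis using 2(1) by (simp add: dx_set_insert_min wedge1_self)
  next
    case 3
    have "wedge1 (dx m) (dx_set (insert p \<sigma>)) = - wedge1 (dx p) (wedge1 (dx m) (dx_set \<sigma>))"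
      using 2(1) by (simp add: dx_set_insert_min flip: wedge1_anticommute)
    also have "\<dots> = (if m \<in> \<sigma> then 0 else - pos_sign m \<sigma> *\<^sub>R wedge1 (dx p) (dx_set (insert m \<sigma>)))"
      unfolding 2(2) by (cases "m \<in> \<sigma>") (simp_all only: wedge1_scaleR wedge1_zero if_True if_False
          minus_zero scaleR_minus_left not_False_eq_True)
    also have "wedge1 (dx p) (dx_set (insert m \<sigma>)) = dx_set (insert p (insert m \<sigma>))"
      using 2(1) 3 by (intro dx_set_insert_min[symmetric]) auto
    finally show ?thesis
      using 3 p by (auto simp: pos_sign_insert insert_commute)
  qed
qed

text \<open>
  Linearity of \<open>dx_set \<tau>\<close> in its first argument, by the Leibniz rule \<open>contract_wedge1\<close>.
\<close>

lemma contract_dx_set_linear: "contract v (dx_set \<tau>) = (\<Sum>m\<in>UNIV. v $ m *\<^sub>R contract (axis m 1) (dx_set \<tau>))"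
proof (induction \<tau> rule: min_insert_induct)
  case 1
  show ?case by (auto simp: contract_def dx_set_empty scaleR_fun_def sum_fun_apply)
next
  case (2 p \<tau>)
  have *: "contract v (dx_set (insert p \<tau>)) = v $ p *\<^sub>R dx_set \<tau> - wedge1 (dx p) (contract v (dx_set \<tau>))" for v
    using 2(1) by (simp add: dx_set_insert_min contract_wedge1 dx_def)
  have W: "wedge1 \<alpha> (\<Sum>m\<in>UNIV. f m) = (\<Sum>m\<in>UNIV. wedge1 \<alpha> (f m))" for \<alpha> and f :: "'a \<Rightarrow> 'a form"
    by (rule ext) (simp add: wedge1_def sum_fun_apply sum_distrib_left sum.swap[of _ UNIV])
  have "v $ p *\<^sub>R dx_set \<tau> = (\<Sum>m\<in>UNIV. v $ m *\<^sub>R (axis m 1 $ p) *\<^sub>R dx_set \<tau>)"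
    by (subst sum.remove[of _ p]) (auto simp: axis_def)
  then show ?case
    unfolding * by (subst 2(2)) (simp add: W wedge1_scaleR sum_subtractf scaleR_diff_right)
qed

lemma contract_axis_dx_set:
  "contract (axis m 1) (dx_set \<tau>) = (if m \<in> \<tau> then pos_sign m \<tau> *\<^sub>R dx_set (\<tau> - {m}) else 0)"
proof (induction \<tau> rule: min_insert_induct)
  case 1
  show ?case by (auto simp: contract_def dx_set_empty)
next
  case (2 p \<tau>)
  have p: "p \<notin> \<tau>" using 2(1) by auto
  have *: "contract (axis m 1) (dx_set (insert p \<tau>)) =
      (if p = m then 1 else 0) *\<^sub>R dx_set \<tau> - wedge1 (dx p) (contract (axis m 1) (dx_set \<tau>))"
    using 2(1) by (simp add: dx_set_insert_min contract_wedge1 dx_axis eq_commute)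
  show ?case
  proof (cases "p = m")
    case True
    then show ?thesis using p 2(1) unfolding * 2(2) by (simp add: pos_sign_insert pos_sign_min)
  next
    case False
    have "wedge1 (dx p) (dx_set (\<tau> - {m})) = dx_set (insert p (\<tau> - {m}))"
      using 2(1) by (intro dx_set_insert_min[symmetric]) auto
    moreover have "insert p (\<tau> - {m}) = insert p \<tau> - {m}" using False by auto
    ultimately show ?thesis
      using False p 2(1) unfolding * 2(2) by (auto simp: pos_sign_insert wedge1_scaleR)
  qed
qed

text \<open>
  Expanding the first vector argument of the second factor in coordinates shows that \<open>s\<close> is
  \<open>\<Sum>m. (dx m \<and> _) \<otimes> contract (axis m 1)\<close>: it moves an index \<open>m\<close> from \<open>\<tau>\<close> to \<open>\<sigma>\<close>.
\<close>

lemma s_map_form_tensor_dx_set: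
  fixes \<sigma> \<tau> :: "'n::{finite,linorder} set"
  shows "s_map (form_tensor (dx_set \<sigma>) (dx_set \<tau>)) =
     (\<Sum>m\<in>\<tau> - \<sigma>. (pos_sign m \<sigma> * pos_sign m \<tau>) *\<^sub>R
        form_tensor (dx_set (insert m \<sigma>)) (dx_set (\<tau> - {m})))"
proof (intro ext)
  fix vs ws :: "(real, 'n) vec list"
  have "s_map (form_tensor (dx_set \<sigma>) (dx_set \<tau>)) vs ws =
      (\<Sum>i<length vs. \<Sum>m\<in>UNIV. (-1) ^ i * dx m (vs ! i) * dx_set \<sigma> (remove_nth i vs) *
        contract (axis m 1) (dx_set \<tau>) ws)"
    unfolding s_map_def form_tensor_def
  proof (rule sum.cong[OF refl])
    fix i
    have "dx_set \<tau> (vs ! i # ws) = (\<Sum>m\<in>UNIV. vs ! i $ m * contract (axis m 1) (dx_set \<tau>) ws)"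
      using fun_cong[OF contract_dx_set_linear[of "vs ! i" \<tau>], of ws]
      by (simp add: contract_def sum_fun_apply scaleR_fun_def)
    then show "(-1) ^ i *\<^sub>R (dx_set \<sigma> (remove_nth i vs) * dx_set \<tau> (vs ! i # ws)) =
        (\<Sum>m\<in>UNIV. (-1) ^ i * dx m (vs ! i) * dx_set \<sigma> (remove_nth i vs) *
          contract (axis m 1) (dx_set \<tau>) ws)"
      by (simp add: sum_distrib_left dx_def mult_ac)
  qed
  also have "\<dots> = (\<Sum>m\<in>UNIV. wedge1 (dx m) (dx_set \<sigma>) vs * contract (axis m 1) (dx_set \<tau>) ws)"
    by (subst sum.swap) (simp add: wedge1_def sum_distrib_right)
  also have "\<dots> = (\<Sum>m\<in>\<tau> - \<sigma>. wedge1 (dx m) (dx_set \<sigma>) vs * contract (axis m 1) (dx_set \<tau>) ws)"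
    by (rule sum.mono_neutral_right) (auto simp: wedge1_dx_set contract_axis_dx_set)
  also have "\<dots> = (\<Sum>m\<in>\<tau> - \<sigma>. (pos_sign m \<sigma> * pos_sign m \<tau>) *\<^sub>R
        form_tensor (dx_set (insert m \<sigma>)) (dx_set (\<tau> - {m}))) vs ws"
    by (simp add: wedge1_dx_set contract_axis_dx_set sum_fun_apply scaleR_fun_def form_tensor_def mult_ac)
  finally show "s_map (form_tensor (dx_set \<sigma>) (dx_set \<tau>)) vs ws = \<dots>" .
qed

section \<open>Coefficients of biforms and the sl2 relation\<close>

type_synonym ('n, 'b) coeffs = "'n set \<Rightarrow> 'n set \<Rightarrow> 'b"

definition comb :: "('n::{finite,linorder}, 'b::real_vector) coeffs \<Rightarrow> ('n, 'b) biform" where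
  "comb c = (\<Sum>\<sigma>\<in>UNIV. \<Sum>\<tau>\<in>UNIV. biform_scale (c \<sigma> \<tau>) (form_tensor (dx_set \<sigma>) (dx_set \<tau>)))"

lemma scaleR_fun_apply: "(a *\<^sub>R f) x = a *\<^sub>R f x"
  by (simp add: scaleR_fun_def)

lemma coeff_add: "coeff (\<mu> + \<nu>) \<sigma> \<tau> = coeff \<mu> \<sigma> \<tau> + coeff \<nu> \<sigma> \<tau>"
  by (simp add: coeff_def)

lemma coeff_scaleR: "coeff (a *\<^sub>R \<mu>) \<sigma> \<tau> = a *\<^sub>R coeff \<mu> \<sigma> \<tau>"
  by (simp add: coeff_def scaleR_fun_apply)

lemma coeff_sum: "coeff (\<Sum>i\<in>I. f i) \<sigma> \<tau> = (\<Sum>i\<in>I. coeff (f i) \<sigma> \<tau>)"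
  by (simp add: coeff_def sum_fun_apply)

lemma coeff_comb [simp]: "coeff (comb c) = c"
proof (intro ext)
  fix \<sigma> \<tau>
  have "coeff (comb c) \<sigma> \<tau> = (\<Sum>\<sigma>'\<in>UNIV. \<Sum>\<tau>'\<in>UNIV. if \<sigma>' = \<sigma> \<and> \<tau>' = \<tau> then c \<sigma>' \<tau>' else 0)"
    by (simp add: comb_def coeff_sum coeff_dx_set)
  also have "\<dots> = (\<Sum>\<sigma>'\<in>UNIV. if \<sigma>' = \<sigma> then c \<sigma>' \<tau> else 0)"
    by (intro sum.cong) auto
  finally show "coeff (comb c) \<sigma> \<tau> = c \<sigma> \<tau>" by simp
qed

lemma biform_scale_add: "biform_scale (a + b) \<mu> = biform_scale a \<mu> + biform_scale b \<mu>"
  by (intro ext) (simp add: biform_scale_def scaleR_add_right)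

lemma biform_scale_scaleR: "biform_scale (r *\<^sub>R a) \<mu> = r *\<^sub>R biform_scale a \<mu>"
  by (intro ext) (simp add: biform_scale_def scaleR_fun_apply)

lemma linear_biform_scale: "linear (\<lambda>a. biform_scale a \<mu>)"
  by (rule linearI) (rule biform_scale_add biform_scale_scaleR)+

lemma biform_scale_zero [simp]: "biform_scale 0 \<mu> = 0"
  by (rule linear_0[OF linear_biform_scale])

lemma biform_scale_sum: "biform_scale (\<Sum>i\<in>I. f i) \<mu> = (\<Sum>i\<in>I. biform_scale (f i) \<mu>)"
  by (rule linear_sum[OF linear_biform_scale])

lemma biform_scale_sum_right: "biform_scale a (\<Sum>i\<in>I. f i) = (\<Sum>i\<in>I. biform_scale a (f i))"
  by (intro ext) (simp add: biform_scale_def sum_fun_apply scaleR_sum_left)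

lemma biform_scale_scaleR_right: "biform_scale a (r *\<^sub>R \<mu>) = biform_scale (r *\<^sub>R a) \<mu>"
  by (intro ext) (simp add: biform_scale_def scaleR_fun_apply mult.commute)

lemma linear_comb: "linear comb"
  by (rule linearI)
    (simp_all add: comb_def biform_scale_add biform_scale_scaleR sum.distrib scaleR_sum_right scaleR_fun_apply)

lemma comb_zero [simp]: "comb 0 = 0"
  by (rule linear_0[OF linear_comb])

lemma linear_s_map: "linear s_map"
  by (rule linearI)
    (auto simp: fun_eq_iff s_map_def sum.distrib scaleR_add_right scaleR_sum_right scaleR_fun_apply mult.commute)

text \<open>
  The sign of moving the index \<open>m\<close> between the two factors. It depends only on the symmetric
  difference of \<open>\<sigma>\<close> and \<open>\<tau>\<close>, and such moves of other indices do not change this difference;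
  hence \<open>swap_sign_move\<close>.
\<close>

definition swap_sign :: "'n::{finite,linorder} \<Rightarrow> 'n set \<Rightarrow> 'n set \<Rightarrow> real" where
  "swap_sign m \<sigma> \<tau> = pos_sign m \<sigma> * pos_sign m \<tau>"

lemma pos_sign_insert_self [simp]: "pos_sign m (insert m \<sigma>) = pos_sign m \<sigma>"
  by (cases "m \<in> \<sigma>") (auto simp: insert_absorb pos_sign_insert)

lemma pos_sign_remove_self [simp]: "pos_sign m (\<sigma> - {m}) = pos_sign m \<sigma>"
  by (cases "m \<in> \<sigma>") (auto simp: pos_sign_remove)

lemma swap_sign_square [simp]: "swap_sign m \<sigma> \<tau> * swap_sign m \<sigma> \<tau> = 1"
  unfolding swap_sign_def by (metis mult.assoc mult.left_commute mult_1_right pos_sign_square)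

lemma swap_sign_move_self [simp]:
  "swap_sign m (\<sigma> - {m}) (insert m \<tau>) = swap_sign m \<sigma> \<tau>"
  "swap_sign m (insert m \<sigma>) (\<tau> - {m}) = swap_sign m \<sigma> \<tau>"
  by (simp_all add: swap_sign_def)

lemma swap_sign_move:
  "p \<in> \<sigma> \<Longrightarrow> p \<notin> \<tau> \<Longrightarrow> swap_sign m (\<sigma> - {p}) (insert p \<tau>) = swap_sign m \<sigma> \<tau>"
  "p \<notin> \<sigma> \<Longrightarrow> p \<in> \<tau> \<Longrightarrow> swap_sign m (insert p \<sigma>) (\<tau> - {p}) = swap_sign m \<sigma> \<tau>"
  by (auto simp: swap_sign_def pos_sign_insert pos_sign_remove)

text \<open>
  The map \<open>s\<close> in coefficients, see \<open>s_map_comb\<close>; the map \<open>lower\<close> is its adjoint, see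
  \<open>raise_adjoint\<close>.
\<close>

definition raise :: "('n::{finite,linorder}, 'b::real_vector) coeffs \<Rightarrow> ('n, 'b) coeffs" where
  "raise c \<sigma> \<tau> = (\<Sum>m\<in>\<sigma> - \<tau>. swap_sign m \<sigma> \<tau> *\<^sub>R c (\<sigma> - {m}) (insert m \<tau>))"

definition lower :: "('n::{finite,linorder}, 'b::real_vector) coeffs \<Rightarrow> ('n, 'b) coeffs" where
  "lower c \<sigma> \<tau> = (\<Sum>m\<in>\<tau> - \<sigma>. swap_sign m \<sigma> \<tau> *\<^sub>R c (insert m \<sigma>) (\<tau> - {m}))"

text \<open>
  Moving an index from \<open>\<tau>\<close> to \<open>\<sigma>\<close> is a bijection between the triples \<open>(\<sigma>, \<tau>, m)\<close> before and after
  the move.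
\<close>

lemma sum_move_index:
  fixes G :: "'n::{finite,linorder} \<Rightarrow> 'n set \<Rightarrow> 'n set \<Rightarrow> 'c::comm_monoid_add"
  shows "(\<Sum>\<sigma>\<in>UNIV. \<Sum>\<tau>\<in>UNIV. \<Sum>m\<in>\<tau> - \<sigma>. G m \<sigma> \<tau>) =
    (\<Sum>\<sigma>\<in>UNIV. \<Sum>\<tau>\<in>UNIV. \<Sum>m\<in>\<sigma> - \<tau>. G m (\<sigma> - {m}) (insert m \<tau>))"
proof -
  have "(\<Sum>\<sigma>\<in>UNIV. \<Sum>\<tau>\<in>UNIV. \<Sum>m\<in>\<tau> - \<sigma>. G m \<sigma> \<tau>) =
      (\<Sum>(\<sigma>, \<tau>, m)\<in>(SIGMA \<sigma>:UNIV. SIGMA \<tau>:UNIV. \<tau> - \<sigma>). G m \<sigma> \<tau>)"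
    by (simp add: sum.Sigma)
  also have "\<dots> = (\<Sum>(\<sigma>, \<tau>, m)\<in>(SIGMA \<sigma>:UNIV. SIGMA \<tau>:UNIV. \<sigma> - \<tau>). G m (\<sigma> - {m}) (insert m \<tau>))"
    by (rule sum.reindex_bij_witness[of _ "\<lambda>(\<sigma>, \<tau>, m). (\<sigma> - {m}, insert m \<tau>, m)"
          "\<lambda>(\<sigma>, \<tau>, m). (insert m \<sigma>, \<tau> - {m}, m)"]) (auto simp: insert_absorb)
  also have "\<dots> = (\<Sum>\<sigma>\<in>UNIV. \<Sum>\<tau>\<in>UNIV. \<Sum>m\<in>\<sigma> - \<tau>. G m (\<sigma> - {m}) (insert m \<tau>))"
    by (simp add: sum.Sigma)
  finally show ?thesis .
qed

lemma s_map_comb: "s_map (comb c) = comb (raise c)"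
proof -
  have "s_map (comb c) = (\<Sum>\<sigma>\<in>UNIV. \<Sum>\<tau>\<in>UNIV. \<Sum>m\<in>\<tau> - \<sigma>.
      biform_scale (swap_sign m \<sigma> \<tau> *\<^sub>R c \<sigma> \<tau>) (form_tensor (dx_set (insert m \<sigma>)) (dx_set (\<tau> - {m}))))"
    by (simp add: comb_def linear_sum[OF linear_s_map] s_map_biform_scale s_map_form_tensor_dx_set
        biform_scale_sum_right biform_scale_scaleR_right swap_sign_def)
  also have "\<dots> = (\<Sum>\<sigma>\<in>UNIV. \<Sum>\<tau>\<in>UNIV. \<Sum>m\<in>\<sigma> - \<tau>.
      biform_scale (swap_sign m \<sigma> \<tau> *\<^sub>R c (\<sigma> - {m}) (insert m \<tau>)) (form_tensor (dx_set \<sigma>) (dx_set \<tau>)))"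
    unfolding sum_move_index by (intro sum.cong refl) (auto simp: insert_absorb)
  finally show ?thesis by (simp add: comb_def raise_def biform_scale_sum)
qed

definition coeff_inner :: "('n::{finite,linorder}, 'b::real_inner) coeffs \<Rightarrow> ('n, 'b) coeffs \<Rightarrow> real" where
  "coeff_inner c c' = (\<Sum>\<sigma>\<in>UNIV. \<Sum>\<tau>\<in>UNIV. c \<sigma> \<tau> \<bullet> c' \<sigma> \<tau>)"

lemma coeff_inner_commute: "coeff_inner c c' = coeff_inner c' c"
  by (simp add: coeff_inner_def inner_commute)

lemma coeff_inner_nonneg: "0 \<le> coeff_inner c c"
  by (simp add: coeff_inner_def sum_nonneg)

lemma coeff_inner_eq_0: "coeff_inner c c = 0 \<longleftrightarrow> c = 0"
  by (auto simp: coeff_inner_def sum_nonneg_eq_0_iff sum_nonneg fun_eq_iff)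

lemma raise_adjoint: "coeff_inner (raise c) c' = coeff_inner c (lower c')"
proof -
  have "coeff_inner c (lower c') = (\<Sum>\<sigma>\<in>UNIV. \<Sum>\<tau>\<in>UNIV. \<Sum>m\<in>\<tau> - \<sigma>.
      swap_sign m \<sigma> \<tau> * (c \<sigma> \<tau> \<bullet> c' (insert m \<sigma>) (\<tau> - {m})))"
    by (simp add: coeff_inner_def lower_def inner_sum_right)
  also have "\<dots> = (\<Sum>\<sigma>\<in>UNIV. \<Sum>\<tau>\<in>UNIV. \<Sum>m\<in>\<sigma> - \<tau>.
      swap_sign m \<sigma> \<tau> * (c (\<sigma> - {m}) (insert m \<tau>) \<bullet> c' \<sigma> \<tau>))"
    unfolding sum_move_index by (intro sum.cong refl) (auto simp: insert_absorb)
  finally show ?thesis by (simp add: coeff_inner_def raise_def inner_sum_left)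
qed

text \<open>
  Moving \<open>m\<close> one way and a different index \<open>p\<close> the other way commutes, signs included, so these
  terms cancel. What remains is moving an index forth and back, which is possible for every
  index in \<open>\<sigma> - \<tau>\<close> in one order and for every index in \<open>\<tau> - \<sigma>\<close> in the other.
\<close>

lemma raise_lower_commutator:
  "raise (lower c) \<sigma> \<tau> - lower (raise c) \<sigma> \<tau> = (real (card \<sigma>) - real (card \<tau>)) *\<^sub>R c \<sigma> \<tau>"
proof -
  define F where "F m p = (swap_sign m \<sigma> \<tau> * swap_sign p \<sigma> \<tau>) *\<^sub>R c (insert p (\<sigma> - {m})) (insert m \<tau> - {p})" for m p
  have "raise (lower c) \<sigma> \<tau> = (\<Sum>m\<in>\<sigma> - \<tau>. c \<sigma> \<tau> + (\<Sum>p\<in>\<tau> - \<sigma>. F m p))"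
    unfolding raise_def
  proof (rule sum.cong[OF refl])
    fix m assume m: "m \<in> \<sigma> - \<tau>"
    then have set: "insert m \<tau> - (\<sigma> - {m}) = insert m (\<tau> - \<sigma>)" by auto
    have "swap_sign m \<sigma> \<tau> *\<^sub>R lower c (\<sigma> - {m}) (insert m \<tau>) =
        swap_sign m \<sigma> \<tau> *\<^sub>R (swap_sign m \<sigma> \<tau> *\<^sub>R c \<sigma> \<tau> +
          (\<Sum>p\<in>\<tau> - \<sigma>. swap_sign p (\<sigma> - {m}) (insert m \<tau>) *\<^sub>R c (insert p (\<sigma> - {m})) (insert m \<tau> - {p})))"
      unfolding lower_def set using m by (subst sum.insert) (auto simp: insert_absorb)
    also have "\<dots> = c \<sigma> \<tau> + (\<Sum>p\<in>\<tau> - \<sigma>. F m p)"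
      using m by (simp add: scaleR_add_right scaleR_sum_right F_def swap_sign_move)
    finally show "swap_sign m \<sigma> \<tau> *\<^sub>R lower c (\<sigma> - {m}) (insert m \<tau>) = \<dots>" .
  qed
  moreover have "lower (raise c) \<sigma> \<tau> = (\<Sum>p\<in>\<tau> - \<sigma>. c \<sigma> \<tau> + (\<Sum>m\<in>\<sigma> - \<tau>. F m p))"
    unfolding lower_def
  proof (rule sum.cong[OF refl])
    fix p assume p: "p \<in> \<tau> - \<sigma>"
    then have set: "insert p \<sigma> - (\<tau> - {p}) = insert p (\<sigma> - \<tau>)" by auto
    have "swap_sign p \<sigma> \<tau> *\<^sub>R raise c (insert p \<sigma>) (\<tau> - {p}) =
        swap_sign p \<sigma> \<tau> *\<^sub>R (swap_sign p \<sigma> \<tau> *\<^sub>R c \<sigma> \<tau> +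
          (\<Sum>m\<in>\<sigma> - \<tau>. swap_sign m (insert p \<sigma>) (\<tau> - {p}) *\<^sub>R c (insert p \<sigma> - {m}) (insert m (\<tau> - {p}))))"
      unfolding raise_def set using p by (subst sum.insert) (auto simp: insert_absorb)
    also have "\<dots> = c \<sigma> \<tau> + (\<Sum>m\<in>\<sigma> - \<tau>. swap_sign p \<sigma> \<tau> *\<^sub>R swap_sign m (insert p \<sigma>) (\<tau> - {p}) *\<^sub>R
        c (insert p \<sigma> - {m}) (insert m (\<tau> - {p})))"
      by (simp add: scaleR_add_right scaleR_sum_right)
    also have "(\<Sum>m\<in>\<sigma> - \<tau>. swap_sign p \<sigma> \<tau> *\<^sub>R swap_sign m (insert p \<sigma>) (\<tau> - {p}) *\<^sub>R
        c (insert p \<sigma> - {m}) (insert m (\<tau> - {p}))) = (\<Sum>m\<in>\<sigma> - \<tau>. F m p)"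
    proof (rule sum.cong[OF refl])
      fix m assume m: "m \<in> \<sigma> - \<tau>"
      then have "insert p \<sigma> - {m} = insert p (\<sigma> - {m})" "insert m (\<tau> - {p}) = insert m \<tau> - {p}"
        using p by auto
      then show "swap_sign p \<sigma> \<tau> *\<^sub>R swap_sign m (insert p \<sigma>) (\<tau> - {p}) *\<^sub>R
          c (insert p \<sigma> - {m}) (insert m (\<tau> - {p})) = F m p"
        using p by (simp add: F_def swap_sign_move mult.commute)
    qed
    finally show "swap_sign p \<sigma> \<tau> *\<^sub>R raise c (insert p \<sigma>) (\<tau> - {p}) = c \<sigma> \<tau> + (\<Sum>m\<in>\<sigma> - \<tau>. F m p)" .
  qed
  moreover have "(\<Sum>m\<in>\<sigma> - \<tau>. \<Sum>p\<in>\<tau> - \<sigma>. F m p) = (\<Sum>p\<in>\<tau> - \<sigma>. \<Sum>m\<in>\<sigma> - \<tau>. F m p)"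
    by (rule sum.swap)
  ultimately have "raise (lower c) \<sigma> \<tau> - lower (raise c) \<sigma> \<tau> =
      (real (card (\<sigma> - \<tau>)) - real (card (\<tau> - \<sigma>))) *\<^sub>R c \<sigma> \<tau>"
    by (simp add: sum.distrib sum_constant_scaleR scaleR_diff_left)
  also have "real (card (\<sigma> - \<tau>)) - real (card (\<tau> - \<sigma>)) = real (card \<sigma>) - real (card \<tau>)"
    using card_Diff_subset_Int[of \<sigma> \<tau>] card_Diff_subset_Int[of \<tau> \<sigma>]
      card_mono[of \<sigma> "\<sigma> \<inter> \<tau>"] card_mono[of \<tau> "\<sigma> \<inter> \<tau>"]
    by (simp add: Int_commute of_nat_diff)
  finally show ?thesis .
qed

definition bidegree :: "nat \<Rightarrow> nat \<Rightarrow> ('n::{finite,linorder}, 'b::real_vector) coeffs \<Rightarrow> bool" where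
  "bidegree k l c \<longleftrightarrow> (\<forall>\<sigma> \<tau>. c \<sigma> \<tau> \<noteq> 0 \<longrightarrow> card \<sigma> = k \<and> card \<tau> = l)"

text \<open>
  Take the inner product of the commutator relation with \<open>c\<close> and use that \<open>raise\<close> and \<open>lower\<close> are
  adjoint.
\<close>

lemma raise_norm:
  fixes c :: "('n::{finite,linorder}, 'b::real_inner) coeffs"
  assumes "bidegree k l c"
  shows "coeff_inner (raise c) (raise c) =
    coeff_inner (lower c) (lower c) + (real l - real k) * coeff_inner c c"
proof -
  have "coeff_inner (lower c) (lower c) - coeff_inner (raise c) (raise c) =
      coeff_inner c (raise (lower c)) - coeff_inner c (lower (raise c))"
    using raise_adjoint[of "lower c" c] raise_adjoint[of c "raise c"]
    by (simp add: coeff_inner_commute)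
  also have "\<dots> = (\<Sum>\<sigma>\<in>UNIV. \<Sum>\<tau>\<in>UNIV. c \<sigma> \<tau> \<bullet> (raise (lower c) \<sigma> \<tau> - lower (raise c) \<sigma> \<tau>))"
    by (simp add: coeff_inner_def sum_subtractf inner_diff_right)
  also have "\<dots> = (\<Sum>\<sigma>\<in>UNIV. \<Sum>\<tau>\<in>UNIV. (real k - real l) * (c \<sigma> \<tau> \<bullet> c \<sigma> \<tau>))"
  proof (intro sum.cong refl)
    fix \<sigma> \<tau>
    show "c \<sigma> \<tau> \<bullet> (raise (lower c) \<sigma> \<tau> - lower (raise c) \<sigma> \<tau>) = (real k - real l) * (c \<sigma> \<tau> \<bullet> c \<sigma> \<tau>)"
      using assms by (cases "c \<sigma> \<tau> = 0") (auto simp: raise_lower_commutator bidegree_def)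
  qed
  also have "\<dots> = (real k - real l) * coeff_inner c c"
    by (simp add: coeff_inner_def sum_distrib_left)
  finally show ?thesis by (simp add: algebra_simps)
qed

lemma raise_eq_0_imp:
  fixes c :: "('n::{finite,linorder}, 'b::real_inner) coeffs"
  assumes "bidegree k l c" "k < l" "raise c = 0"
  shows "c = 0"
proof -
  have "coeff_inner (raise c) (raise c) = 0" using assms(3) by (simp add: coeff_inner_eq_0)
  then have "(real l - real k) * coeff_inner c c \<le> 0"
    using raise_norm[OF assms(1)] coeff_inner_nonneg[of "lower c"] by linarith
  then have "coeff_inner c c = 0"
    using assms(2) coeff_inner_nonneg[of c] by (simp add: mult_le_0_iff)
  then show ?thesis by (simp add: coeff_inner_eq_0)
qed

lemma lower_eq_0_imp:
  fixes c :: "('n::{finite,linorder}, 'b::real_inner) coeffs"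
  assumes "bidegree k l c" "l < k" "lower c = 0"
  shows "c = 0"
proof -
  have "coeff_inner (lower c) (lower c) = 0" using assms(3) by (simp add: coeff_inner_eq_0)
  then have "(real k - real l) * coeff_inner c c \<le> 0"
    using raise_norm[OF assms(1)] coeff_inner_nonneg[of "raise c"] by (simp add: algebra_simps)
  then have "coeff_inner c c = 0"
    using assms(2) coeff_inner_nonneg[of c] by (simp add: mult_le_0_iff)
  then show ?thesis by (simp add: coeff_inner_eq_0)
qed


section \<open>Dimensions of quotients and orthogonal complements\<close>

text \<open>
  The exterior derivative, the inverse of \<open>S\<close> and the orthogonal projections are linear only on
  the subspaces where they are meaningful, so linearity is relative to a subspace.
\<close>

definition linear_on :: "'a::real_vector set \<Rightarrow> ('a \<Rightarrow> 'b::real_vector) \<Rightarrow> bool" where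
  "linear_on V f \<longleftrightarrow>
     (\<forall>x\<in>V. \<forall>y\<in>V. f (x + y) = f x + f y) \<and> (\<forall>c. \<forall>x\<in>V. f (c *\<^sub>R x) = c *\<^sub>R f x)"

lemma linear_onD:
  assumes "linear_on V f"
  shows "x \<in> V \<Longrightarrow> y \<in> V \<Longrightarrow> f (x + y) = f x + f y" "x \<in> V \<Longrightarrow> f (c *\<^sub>R x) = c *\<^sub>R f x"
  using assms by (auto simp: linear_on_def)

lemma linear_on_zero: "linear_on V f \<Longrightarrow> subspace V \<Longrightarrow> f 0 = 0"
  using linear_onD(2)[of V f 0 0] by (simp add: subspace_0)

lemma linear_on_neg: "linear_on V f \<Longrightarrow> x \<in> V \<Longrightarrow> f (- x) = - f x"
  using linear_onD(2)[of V f x "-1"] by simp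

lemma linear_on_diff:
  "linear_on V f \<Longrightarrow> subspace V \<Longrightarrow> x \<in> V \<Longrightarrow> y \<in> V \<Longrightarrow> f (x - y) = f x - f y"
  using linear_onD(1)[of V f x "- y"] linear_on_neg[of V f y] by (simp add: subspace_neg)

lemma linear_on_sum:
  assumes "linear_on V f" "subspace V" "\<And>x. x \<in> X \<Longrightarrow> g x \<in> V"
  shows "f (\<Sum>x\<in>X. c x *\<^sub>R g x) = (\<Sum>x\<in>X. c x *\<^sub>R f (g x))"
  using assms(3)
proof (induction X rule: infinite_finite_induct)
  case (insert x X)
  then have "(\<Sum>x\<in>X. c x *\<^sub>R g x) \<in> V"
    by (intro subspace_sum subspace_scale assms(2)) auto
  with insert show ?case
    by (simp add: linear_onD[OF assms(1)] subspace_scale[OF assms(2)])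
qed (simp_all add: linear_on_zero[OF assms(1,2)])

lemma linear_on_subset: "linear_on V f \<Longrightarrow> W \<subseteq> V \<Longrightarrow> linear_on W f"
  by (auto simp: linear_on_def subset_iff)

lemma linear_imp_linear_on: "linear f \<Longrightarrow> linear_on V f"
  by (simp add: linear_on_def linear_add linear_scale)

lemma linear_on_compose:
  "linear_on V f \<Longrightarrow> linear_on W g \<Longrightarrow> f ` V \<subseteq> W \<Longrightarrow> linear_on V (\<lambda>x. g (f x))"
  by (auto simp: linear_on_def image_subset_iff)

lemma subspace_image_linear_on:
  assumes "linear_on V f" "subspace V"
  shows "subspace (f ` V)"
  unfolding subspace_def
proof (intro conjI ballI allI)
  show "0 \<in> f ` V"
    using linear_on_zero[OF assms] subspace_0[OF assms(2)] by force
  show "x + y \<in> f ` V" if "x \<in> f ` V" "y \<in> f ` V" for x y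
    using that assms by (auto simp: subspace_add simp flip: linear_onD(1)[OF assms(1)])
  show "c *\<^sub>R x \<in> f ` V" if "x \<in> f ` V" for c x
    using that assms by (auto simp: subspace_scale simp flip: linear_onD(2)[OF assms(1)])
qed

lemma subspace_preimage_linear_on:
  assumes "linear_on V f" "subspace V" "subspace W"
  shows "subspace {x \<in> V. f x \<in> W}"
  using assms linear_on_zero[OF assms(1,2)]
  by (auto simp: subspace_def linear_on_def)

lemma subspace_kernel_linear_on:
  "linear_on V f \<Longrightarrow> subspace V \<Longrightarrow> subspace {x \<in> V. f x = 0}"
  using subspace_preimage_linear_on[of V f "{0}"] by simp

definition fin_subspace :: "'a::real_vector set \<Rightarrow> bool" where
  "fin_subspace V \<longleftrightarrow> subspace V \<and> (\<exists>F. finite F \<and> V = span F)"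

lemma fin_subspace_subspace: "fin_subspace V \<Longrightarrow> subspace V"
  by (simp add: fin_subspace_def)

lemma fin_subspace_subset:
  assumes "fin_subspace V" "subspace W" "W \<subseteq> V"
  shows "fin_subspace W"
proof -
  obtain F where F: "finite F" "V = span F"
    using assms(1) by (auto simp: fin_subspace_def)
  obtain X where X: "X \<subseteq> W" "independent X" "W \<subseteq> span X"
    using basis_exists[of W] by metis
  have "finite X"
    using independent_span_bound[OF F(1) X(2)] X(1) assms(3) F(2) by auto
  moreover have "W = span X"
    using X assms(2) by (simp add: span_minimal subset_antisym)
  ultimately show ?thesis using assms(2) by (auto simp: fin_subspace_def)
qed

lemma fin_quotient_dim:
  assumes "fin_subspace Z" "subspace B" "B \<subseteq> Z"
  shows "quotient_dim Z B + dim B = dim Z"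
  using assms quotient_dim_eq[of B Z] by (auto simp: fin_subspace_def)

lemma quotient_basis_card_eq:
  assumes "fin_subspace Z" "subspace B" "B \<subseteq> Z" "quotient_basis Z B X"
  shows "card X = quotient_dim Z B"
  using fin_quotient_dim[OF assms(1-3)] quotient_basis_card[of B Z] assms
  by (fastforce simp: fin_subspace_def)

lemma fin_quotient_basis:
  assumes "fin_subspace Z" "subspace B" "B \<subseteq> Z"
  obtains X where "quotient_basis Z B X" "card X = quotient_dim Z B"
  using quotient_basis_exists[of B Z] quotient_basis_card_eq[OF assms] assms
  by (metis fin_subspace_def)

lemma fin_subspace_basis:
  assumes "fin_subspace B"
  obtains Y where "Y \<subseteq> B" "independent Y" "span Y = B" "card Y = dim B" "finite Y"
proof -
  obtain F where F: "finite F" "B = span F"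
    using assms by (auto simp: fin_subspace_def)
  obtain Y where Y: "Y \<subseteq> B" "independent Y" "B \<subseteq> span Y" "card Y = dim B"
    by (rule basis_exists[of B])
  show thesis
  proof (rule that)
    show "span Y = B"
      using Y fin_subspace_subspace[OF assms] by (simp add: span_minimal subset_antisym)
    show "finite Y"
      using independent_span_bound[OF F(1) Y(2)] Y(1) F(2) by auto
  qed (use Y in auto)
qed

text \<open>
  A family indexed by \<open>X\<close> that is linearly independent modulo \<open>B\<close>, together with a basis of \<open>B\<close>,
  is independent in \<open>Z\<close>.
\<close>

lemma card_le_quotient_dim:
  assumes Z: "fin_subspace Z" "subspace B" "B \<subseteq> Z" and X: "finite X" "g ` X \<subseteq> Z"
    and indep: "\<And>c. (\<Sum>x\<in>X. c x *\<^sub>R g x) \<in> B \<Longrightarrow> \<forall>x\<in>X. c x = 0"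
  shows "card X \<le> quotient_dim Z B"
proof -
  obtain Y where Y: "Y \<subseteq> B" "independent Y" "span Y = B" "card Y = dim B" "finite Y"
    using fin_subspace_basis[OF fin_subspace_subset[OF Z]] by metis
  obtain W where W: "quotient_basis Z B W" "card W = quotient_dim Z B"
    using fin_quotient_basis[OF Z] by metis
  have inj: "inj_on g X"
  proof (rule inj_onI, rule ccontr)
    fix x y assume xy: "x \<in> X" "y \<in> X" "g x = g y" "x \<noteq> y"
    let ?c = "\<lambda>z. (if z = x then 1 else 0) - (if z = y then 1 else 0 :: real)"
    have "(\<Sum>z\<in>X. ?c z *\<^sub>R g z) = g x - g y"
      using X(1) xy(1,2)
      by (simp add: scaleR_diff_left sum_subtractf if_distrib[of "\<lambda>c. c *\<^sub>R _"] cong: if_cong)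
    then have "\<forall>z\<in>X. ?c z = 0"
      using xy(3) subspace_0[OF Z(2)] by (intro indep) auto
    then show False using xy(1,4) by force
  qed
  have indep': "(\<Sum>x\<in>g ` X. c x *\<^sub>R x) \<in> B \<Longrightarrow> \<forall>x\<in>g ` X. c x = 0" for c
    using indep[of "\<lambda>x. c (g x)"] by (simp add: sum.reindex[OF inj])
  have disj: "g ` X \<inter> Y = {}"
  proof (rule ccontr)
    assume "g ` X \<inter> Y \<noteq> {}"
    then obtain y where y: "y \<in> g ` X" "y \<in> Y" by blast
    have "(\<Sum>x\<in>g ` X. (if x = y then 1 else 0) *\<^sub>R x) = y"
      using X(1) y(1) by (simp add: if_distrib[of "\<lambda>c. c *\<^sub>R _"] cong: if_cong)
    then have "\<forall>x\<in>g ` X. (if x = y then 1 else 0 :: real) = 0"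
      using y(2) Y(1) by (intro indep') auto
    with y(1) show False by force
  qed
  have "independent (g ` X \<union> Y)"
  proof (rule independent_if_scalars_zero)
    show "finite (g ` X \<union> Y)" using X(1) Y(5) by simp
    fix c x
    assume "(\<Sum>x\<in>g ` X \<union> Y. c x *\<^sub>R x) = 0" and x: "x \<in> g ` X \<union> Y"
    then have sum: "(\<Sum>x\<in>g ` X. c x *\<^sub>R x) + (\<Sum>y\<in>Y. c y *\<^sub>R y) = 0"
      using X(1) Y(5) disj by (simp add: sum.union_disjoint)
    then have "(\<Sum>x\<in>g ` X. c x *\<^sub>R x) = - (\<Sum>y\<in>Y. c y *\<^sub>R y)"
      by (simp add: eq_neg_iff_add_eq_0)
    also have "\<dots> \<in> B"
      using Y(1) Z(2) by (intro subspace_neg subspace_sum subspace_scale) auto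
    finally have c: "\<forall>x\<in>g ` X. c x = 0" by (rule indep')
    with sum have "(\<Sum>y\<in>Y. c y *\<^sub>R y) = 0" by simp
    then have "\<forall>y\<in>Y. c y = 0"
      using Y(2,5) by (auto simp: dependent_finite)
    with c x show "c x = 0" by auto
  qed
  moreover have "Z \<subseteq> span (W \<union> Y)"
  proof
    fix z assume "z \<in> Z"
    then obtain c where "z - (\<Sum>x\<in>W. c x *\<^sub>R x) \<in> span Y"
      using W(1) Y(3) by (auto simp: quotient_basis_def)
    then have "z - (\<Sum>x\<in>W. c x *\<^sub>R x) \<in> span (W \<union> Y)"
      using span_mono[of Y "W \<union> Y"] by blast
    moreover have "(\<Sum>x\<in>W. c x *\<^sub>R x) \<in> span (W \<union> Y)"
      by (intro span_sum span_scale span_base) auto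
    ultimately show "z \<in> span (W \<union> Y)"
      by (metis diff_add_cancel span_add)
  qed
  moreover have "finite (W \<union> Y)" using W(1) Y(5) by (simp add: quotient_basis_def)
  ultimately have "card (g ` X \<union> Y) \<le> card (W \<union> Y)"
    using independent_span_bound[of "W \<union> Y" "g ` X \<union> Y"] X(2) Y(1) Z(3) by blast
  also have "\<dots> \<le> card W + card Y" by (rule card_Un_le)
  finally show ?thesis
    using card_Un_disjoint[OF finite_imageI[OF X(1)] Y(5) disj] card_image[OF inj] W(2) by simp
qed

lemma quotient_dim_le_card:
  assumes Z: "fin_subspace Z" "subspace B" "B \<subseteq> Z" and X: "finite X"
    and gen: "\<And>z. z \<in> Z \<Longrightarrow> \<exists>c. z - (\<Sum>x\<in>X. c x *\<^sub>R g x) \<in> B"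
  shows "quotient_dim Z B \<le> card X"
proof -
  obtain Y where Y: "Y \<subseteq> B" "independent Y" "span Y = B" "card Y = dim B" "finite Y"
    using fin_subspace_basis[OF fin_subspace_subset[OF Z]] by metis
  have "Z \<subseteq> span (g ` X \<union> Y)"
  proof
    fix z assume "z \<in> Z"
    then obtain c where "z - (\<Sum>x\<in>X. c x *\<^sub>R g x) \<in> span Y"
      using gen Y(3) by auto
    then have "z - (\<Sum>x\<in>X. c x *\<^sub>R g x) \<in> span (g ` X \<union> Y)"
      using span_mono[of Y "g ` X \<union> Y"] by blast
    moreover have "(\<Sum>x\<in>X. c x *\<^sub>R g x) \<in> span (g ` X \<union> Y)"
      by (intro span_sum span_scale span_base) auto
    ultimately show "z \<in> span (g ` X \<union> Y)"
      by (metis diff_add_cancel span_add)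
  qed
  then have "dim Z \<le> card (g ` X \<union> Y)"
    using X Y(5) by (intro dim_le_card) auto
  also have "\<dots> \<le> card (g ` X) + card Y" by (rule card_Un_le)
  also have "\<dots> \<le> card X + dim B" using card_image_le[OF X, of g] Y(4) by simp
  finally show ?thesis using fin_quotient_dim[OF Z] by simp
qed

text \<open>
  Let \<open>K\<close> be the preimage of \<open>B2\<close> under \<open>f\<close>. Then \<open>f\<close> embeds \<open>Z / K\<close> into \<open>Z2 / B2\<close>, and \<open>p\<close>
  induces a map on \<open>Z1 / B1\<close> whose range contains \<open>K / B\<close>. The dimensions of \<open>Z / K\<close> and
  \<open>K / B\<close> add up to that of \<open>Z / B\<close>.
\<close>

lemma quotient_dim_zigzag:
  assumes Z: "fin_subspace Z" "subspace B" "B \<subseteq> Z"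
    and Z1: "fin_subspace Z1" "subspace B1" "B1 \<subseteq> Z1"
    and Z2: "fin_subspace Z2" "subspace B2" "B2 \<subseteq> Z2"
    and f: "linear_on Z f" "f ` Z \<subseteq> Z2" "f ` B \<subseteq> B2"
    and p: "linear_on Z1 p" "p ` B1 \<subseteq> B"
    and cover: "\<And>z. z \<in> Z \<Longrightarrow> f z \<in> B2 \<Longrightarrow> \<exists>x\<in>Z1. z - p x \<in> B"
  shows "quotient_dim Z B \<le> quotient_dim Z1 B1 + quotient_dim Z2 B2"
proof -
  define K where "K = {z \<in> Z. f z \<in> B2}"
  have sZ: "subspace Z" by (rule fin_subspace_subspace[OF Z(1)])
  have sK: "subspace K" and KZ: "K \<subseteq> Z" and BK: "B \<subseteq> K"
    using subspace_preimage_linear_on[OF f(1) sZ Z2(2)] f(3) Z(3) by (auto simp: K_def)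
  have fK: "fin_subspace K" by (rule fin_subspace_subset[OF Z(1) sK KZ])
  have "quotient_dim Z K \<le> quotient_dim Z2 B2"
  proof -
    obtain X where X: "quotient_basis Z K X" "card X = quotient_dim Z K"
      using fin_quotient_basis[OF Z(1) sK KZ] by metis
    then have X': "finite X" "X \<subseteq> Z"
      and indep: "\<And>c. (\<Sum>x\<in>X. c x *\<^sub>R x) \<in> K \<Longrightarrow> \<forall>x\<in>X. c x = 0"
      by (auto simp: quotient_basis_def)
    have "card X \<le> quotient_dim Z2 B2"
    proof (rule card_le_quotient_dim[OF Z2 X'(1), of f])
      show "f ` X \<subseteq> Z2" using f(2) X'(2) by auto
      fix c assume "(\<Sum>x\<in>X. c x *\<^sub>R f x) \<in> B2"
      then have "f (\<Sum>x\<in>X. c x *\<^sub>R x) \<in> B2"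
        using linear_on_sum[OF f(1) sZ, of X "\<lambda>x. x" c] X'(2) by (simp add: subset_iff)
      moreover have "(\<Sum>x\<in>X. c x *\<^sub>R x) \<in> Z"
        using X'(2) by (intro subspace_sum subspace_scale sZ) auto
      ultimately show "\<forall>x\<in>X. c x = 0" by (intro indep) (simp add: K_def)
    qed
    then show ?thesis using X(2) by simp
  qed
  moreover have "quotient_dim K B \<le> quotient_dim Z1 B1"
  proof -
    have sZ1: "subspace Z1" by (rule fin_subspace_subspace[OF Z1(1)])
    obtain X where X: "quotient_basis Z1 B1 X" "card X = quotient_dim Z1 B1"
      using fin_quotient_basis[OF Z1] by metis
    then have X': "finite X" "X \<subseteq> Z1"
      and gen: "\<And>z. z \<in> Z1 \<Longrightarrow> \<exists>c. z - (\<Sum>x\<in>X. c x *\<^sub>R x) \<in> B1"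
      by (auto simp: quotient_basis_def)
    have "quotient_dim K B \<le> card X"
    proof (rule quotient_dim_le_card[OF fK Z(2) BK X'(1), of p])
      fix z assume "z \<in> K"
      then obtain x where x: "x \<in> Z1" "z - p x \<in> B" using cover by (auto simp: K_def)
      obtain c where c: "x - (\<Sum>x\<in>X. c x *\<^sub>R x) \<in> B1" using gen[OF x(1)] by blast
      have sum: "(\<Sum>x\<in>X. c x *\<^sub>R x) \<in> Z1"
        using X'(2) by (intro subspace_sum subspace_scale sZ1) auto
      have "p (x - (\<Sum>x\<in>X. c x *\<^sub>R x)) = p x - (\<Sum>x\<in>X. c x *\<^sub>R p x)"
        using linear_on_diff[OF p(1) sZ1 x(1) sum] linear_on_sum[OF p(1) sZ1, of X "\<lambda>x. x" c] X'(2)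
        by auto
      then have "p x - (\<Sum>x\<in>X. c x *\<^sub>R p x) \<in> B" using p(2) c by auto
      then have "(z - p x) + (p x - (\<Sum>x\<in>X. c x *\<^sub>R p x)) \<in> B"
        using x(2) by (intro subspace_add Z(2))
      then show "\<exists>c. z - (\<Sum>x\<in>X. c x *\<^sub>R p x) \<in> B" by auto
    qed
    then show ?thesis using X(2) by simp
  qed
  ultimately show ?thesis
    using fin_quotient_dim[OF Z] fin_quotient_dim[OF Z(1) sK KZ] fin_quotient_dim[OF fK Z(2) BK]
    by linarith
qed

text \<open>
  One Gram-Schmidt step for each generator. The form \<open>ip\<close> is definite only on the span; the type
  of biforms is no inner product space.
\<close>

lemma orthogonal_decomposition:
  fixes ip :: "'a::real_vector \<Rightarrow> 'a \<Rightarrow> real"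
  assumes lin: "\<And>y. linear (\<lambda>x. ip x y)" and sym: "\<And>x y. ip x y = ip y x"
    and "finite F" and "\<And>w. w \<in> span F \<Longrightarrow> ip w w = 0 \<Longrightarrow> w = 0"
  shows "\<exists>w\<in>span F. \<forall>v\<in>span F. ip (x - w) v = 0"
  using assms(3,4)
proof (induction F arbitrary: x rule: finite_induct)
  case empty
  have "ip x 0 = 0" using linear_0[OF lin] sym by metis
  then show ?case by simp
next
  case (insert b F)
  have lin2: "linear (ip x)" for x
  proof -
    have "ip x = (\<lambda>y. ip y x)" using sym by blast
    then show ?thesis using lin[of x] by simp
  qed
  have sub: "span F \<subseteq> span (insert b F)" by (intro span_mono) auto
  have IH: "\<exists>w\<in>span F. \<forall>v\<in>span F. ip (x - w) v = 0" for x
    using insert.prems sub by (intro insert.IH) auto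
  obtain w where w: "w \<in> span F" "\<And>v. v \<in> span F \<Longrightarrow> ip (x - w) v = 0" using IH by blast
  obtain e where e: "e \<in> span F" "\<And>v. v \<in> span F \<Longrightarrow> ip (b - e) v = 0" using IH by blast
  define u where "u = b - e"
  define a where "a = ip (x - w) u / ip u u"
  have u: "u \<in> span (insert b F)"
    unfolding u_def using e(1) sub by (intro span_diff) (auto intro: span_base)
  \<comment> \<open>If \<open>ip u u = 0\<close>, then \<open>u = 0\<close> and the value of \<open>a\<close> does not matter.\<close>
  have "ip (x - (w + a *\<^sub>R u)) u = 0"
  proof (cases "ip u u = 0")
    case True
    then have "u = 0" by (rule insert.prems[OF u])
    then show ?thesis using linear_0[OF lin2] by simp
  next
    case False
    have "ip (x - (w + a *\<^sub>R u)) u = ip (x - w) u - a * ip u u"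
      using linear_diff[OF lin, of "x - w" "a *\<^sub>R u" u] linear_scale[OF lin, of a u u]
      by (simp add: algebra_simps)
    then show ?thesis using False by (simp add: a_def)
  qed
  moreover have "ip (x - (w + a *\<^sub>R u)) v = 0" if v: "v \<in> span F" for v
    using linear_diff[OF lin, of "x - w" "a *\<^sub>R u" v] linear_scale[OF lin, of a u v] w(2)[OF v] e(2)[OF v]
    by (simp add: u_def algebra_simps)
  ultimately have "ip (x - (w + a *\<^sub>R u)) v = 0" if v: "v \<in> span (insert b F)" for v
  proof -
    assume 1: "ip (x - (w + a *\<^sub>R u)) u = 0" and 2: "\<And>v. v \<in> span F \<Longrightarrow> ip (x - (w + a *\<^sub>R u)) v = 0"
    obtain r where r: "v - r *\<^sub>R b \<in> span F" using v by (auto simp: span_insert)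
    have "v - r *\<^sub>R b + r *\<^sub>R e \<in> span F" using r e(1) by (intro span_add span_scale)
    from 2[OF this] have "ip (x - (w + a *\<^sub>R u)) (v - r *\<^sub>R u) = 0"
      by (simp add: u_def algebra_simps)
    then show ?thesis
      using 1 by (simp add: linear_diff[OF lin2] linear_scale[OF lin2])
  qed
  moreover have "w + a *\<^sub>R u \<in> span (insert b F)"
    using w(1) sub u by (intro span_add span_scale) auto
  ultimately show ?case by blast
qed

section \<open>The BGG construction for two abstract complexes\<close>

definition cocycles :: "(nat \<Rightarrow> 'a::real_vector set) \<Rightarrow> (nat \<Rightarrow> 'a \<Rightarrow> 'a) \<Rightarrow> nat \<Rightarrow> 'a set" where
  "cocycles V \<delta> k = {x \<in> V k. \<delta> k x = 0}"

definition coboundaries :: "(nat \<Rightarrow> 'a::real_vector set) \<Rightarrow> (nat \<Rightarrow> 'a \<Rightarrow> 'a) \<Rightarrow> nat \<Rightarrow> 'a set" where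
  "coboundaries V \<delta> k = (if k = 0 then {0} else \<delta> (k - 1) ` V (k - 1))"

text \<open>
  Two complexes \<open>A\<close> and \<open>B\<close> with a connecting map \<open>S\<close>. The space \<open>U i\<close> is a complement in \<open>A i\<close>
  of the range of \<open>S\<close>, and \<open>P i\<close> the projection onto \<open>U i\<close> along this range.
\<close>

locale bgg_diagram =
  fixes A B U :: "nat \<Rightarrow> 'e::real_vector set"
    and dA dB P :: "nat \<Rightarrow> 'e \<Rightarrow> 'e" and S :: "'e \<Rightarrow> 'e" and J :: nat
  assumes J: "1 \<le> J"
    and fin_A: "fin_subspace (A i)" and fin_B: "fin_subspace (B i)"
    and linear_dA: "linear_on (A i) (dA i)" and linear_dB: "linear_on (B i) (dB i)"
    and dA_in: "x \<in> A i \<Longrightarrow> dA i x \<in> A (Suc i)" and dB_in: "x \<in> B i \<Longrightarrow> dB i x \<in> B (Suc i)"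
    and dA_dA: "x \<in> A i \<Longrightarrow> dA (Suc i) (dA i x) = 0"
    and dB_dB: "x \<in> B i \<Longrightarrow> dB (Suc i) (dB i x) = 0"
    and linear_S: "linear S"
    and S_in: "x \<in> B i \<Longrightarrow> S x \<in> A (Suc i)"
    and S_dB: "x \<in> B i \<Longrightarrow> S (dB i x) = - dA (Suc i) (S x)"
    and inj_S: "i < J \<Longrightarrow> inj_on S (B i)"
    and surj_S: "J \<le> Suc i \<Longrightarrow> S ` B i = A (Suc i)"
    and subspace_U: "subspace (U i)" and U_A: "U i \<subseteq> A i"
    and P_in: "x \<in> A i \<Longrightarrow> P i x \<in> U i"
    and P_diff: "x \<in> A i \<Longrightarrow> x - P i x \<in> (if i = 0 then {0} else S ` B (i - 1))"
    and U_disjoint: "U i \<inter> (if i = 0 then {0} else S ` B (i - 1)) = {0}"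
begin

definition R :: "nat \<Rightarrow> 'e set" where
  "R i = (if i = 0 then {0} else S ` B (i - 1))"

definition Y :: "nat \<Rightarrow> 'e set" where
  "Y i = (if i < J then U i else {b \<in> B i. S b = 0})"

definition D :: "nat \<Rightarrow> 'e \<Rightarrow> 'e" where
  "D i x = (if i + 1 < J then P (i + 1) (dA i x)
      else if i + 1 = J then dB i (inv_into (B i) S (dA i x))
      else dB i x)"

lemma subspace_A: "subspace (A i)" and subspace_B: "subspace (B i)"
  using fin_A fin_B by (auto simp: fin_subspace_def)

lemma subspace_R: "subspace (R i)"
  unfolding R_def
  by (auto intro: subspace_image_linear_on linear_imp_linear_on linear_S subspace_B)

lemma R_A: "R i \<subseteq> A i"
  using S_in subspace_0[OF subspace_A] by (cases i) (auto simp: R_def)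

lemma P_eqI:
  assumes "u \<in> U i" "x - u \<in> R i" "x \<in> A i"
  shows "P i x = u"
proof -
  have "x - P i x \<in> R i" using P_diff[OF assms(3)] by (simp add: R_def)
  from subspace_diff[OF subspace_R assms(2) this] have "(x - u) - (x - P i x) \<in> R i" .
  moreover have "P i x - u \<in> U i"
    using P_in[OF assms(3)] assms(1) by (intro subspace_diff subspace_U)
  ultimately have "P i x - u \<in> U i \<inter> R i" by simp
  then show ?thesis using U_disjoint[of i] by (simp add: R_def)
qed

lemma P_diff_R: "x \<in> A i \<Longrightarrow> x - P i x \<in> R i"
  using P_diff by (simp add: R_def)

lemma P_id: "x \<in> U i \<Longrightarrow> P i x = x"
  using U_A by (intro P_eqI) (auto simp: subspace_0[OF subspace_R])

lemma P_zero: "x \<in> R i \<Longrightarrow> P i x = 0"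
  using R_A by (intro P_eqI) (auto simp: subspace_0[OF subspace_U])

lemma linear_P: "linear_on (A i) (P i)"
  unfolding linear_on_def
proof (intro conjI ballI allI)
  fix x y c assume x: "x \<in> A i" and y: "y \<in> A i"
  have "(x - P i x) + (y - P i y) \<in> R i"
    using P_diff_R x y by (intro subspace_add subspace_R)
  then show "P i (x + y) = P i x + P i y"
    using P_in x y by (intro P_eqI subspace_add subspace_U subspace_A) (auto simp: algebra_simps)
next
  fix x c assume x: "x \<in> A i"
  have "c *\<^sub>R (x - P i x) \<in> R i"
    using P_diff_R x by (intro subspace_scale subspace_R)
  then show "P i (c *\<^sub>R x) = c *\<^sub>R P i x"
    using P_in x by (intro P_eqI subspace_scale subspace_U subspace_A) (auto simp: algebra_simps)
qed

abbreviation "Sinv i \<equiv> inv_into (B i) S"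

lemma Sinv_S: "i < J \<Longrightarrow> b \<in> B i \<Longrightarrow> Sinv i (S b) = b"
  by (simp add: inj_S)

lemma linear_Sinv:
  assumes "i < J"
  shows "linear_on (S ` B i) (Sinv i)"
  unfolding linear_on_def
proof (intro conjI ballI allI)
  fix x y assume "x \<in> S ` B i" "y \<in> S ` B i"
  then obtain a b where ab: "a \<in> B i" "x = S a" "b \<in> B i" "y = S b" by auto
  have "Sinv i (S (a + b)) = a + b"
    using ab by (intro Sinv_S assms subspace_add subspace_B)
  then show "Sinv i (x + y) = Sinv i x + Sinv i y"
    using ab assms by (simp add: Sinv_S linear_add[OF linear_S])
next
  fix x c assume "x \<in> S ` B i"
  then obtain a where a: "a \<in> B i" "x = S a" by auto
  have "Sinv i (S (c *\<^sub>R a)) = c *\<^sub>R a"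
    using a by (intro Sinv_S assms subspace_scale subspace_B)
  then show "Sinv i (c *\<^sub>R x) = c *\<^sub>R Sinv i x"
    using a assms by (simp add: Sinv_S linear_scale[OF linear_S])
qed

text \<open>
  The element \<open>b\<close> is \<open>- d b'\<close> for an element \<open>r = S b'\<close> of the range of \<open>S\<close>. So \<open>A\<close> modulo the range of \<open>S\<close> is a
  complex, and \<open>b\<close> is exact in \<open>B\<close>.
\<close>

lemma dA_R: "r \<in> R i \<Longrightarrow> \<exists>b. b \<in> B i \<and> dB i b = 0 \<and> dA i r = S b \<and> b \<in> (if i = 0 then {0} else dB (i - 1) ` B (i - 1))"
proof (cases i)
  case 0
  moreover assume "r \<in> R i"
  ultimately have "r = 0" by (simp add: R_def)
  then show ?thesis
    using 0 linear_on_zero[OF linear_dA subspace_A] linear_on_zero[OF linear_dB subspace_B]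
      linear_0[OF linear_S] subspace_0[OF subspace_B]
    by (intro exI[of _ 0]) auto
next
  case (Suc j)
  moreover assume "r \<in> R i"
  ultimately obtain b where b: "b \<in> B j" "r = S b" by (auto simp: R_def)
  have "dA i r = S (- dB j b)"
    using S_dB[OF b(1)] Suc b(2) by (simp add: linear_neg[OF linear_S])
  moreover have "dB j (- b) = - dB j b" by (rule linear_on_neg[OF linear_dB b(1)])
  moreover have "- b \<in> B j" by (rule subspace_neg[OF subspace_B b(1)])
  ultimately show ?thesis
    using Suc dB_in[of "- b" j] dB_dB[of "- b" j]
    by (intro exI[of _ "- dB j b"]) (auto intro: rev_image_eqI[of "- b"])
qed

lemma cocycles_A: "fin_subspace (cocycles A dA k)" "subspace (coboundaries A dA k)" "coboundaries A dA k \<subseteq> cocycles A dA k"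
proof -
  show "fin_subspace (cocycles A dA k)"
    unfolding cocycles_def
    by (rule fin_subspace_subset[OF fin_A subspace_kernel_linear_on[OF linear_dA subspace_A]]) auto
  show "subspace (coboundaries A dA k)"
    unfolding coboundaries_def by (auto intro: subspace_image_linear_on linear_dA subspace_A)
  show "coboundaries A dA k \<subseteq> cocycles A dA k"
    using subspace_0[OF subspace_A] linear_on_zero[OF linear_dA subspace_A] dA_in dA_dA
    by (cases k) (auto simp: coboundaries_def cocycles_def)
qed

lemma cocycles_B: "fin_subspace (cocycles B dB k)" "subspace (coboundaries B dB k)" "coboundaries B dB k \<subseteq> cocycles B dB k"
proof -
  show "fin_subspace (cocycles B dB k)"
    unfolding cocycles_def
    by (rule fin_subspace_subset[OF fin_B subspace_kernel_linear_on[OF linear_dB subspace_B]]) auto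
  show "subspace (coboundaries B dB k)"
    unfolding coboundaries_def by (auto intro: subspace_image_linear_on linear_dB subspace_B)
  show "coboundaries B dB k \<subseteq> cocycles B dB k"
    using subspace_0[OF subspace_B] linear_on_zero[OF linear_dB subspace_B] dB_in dB_dB
    by (cases k) (auto simp: coboundaries_def cocycles_def)
qed

lemma dA_A_eq_S: "Suc i = J \<Longrightarrow> x \<in> A i \<Longrightarrow> dA i x \<in> S ` B i"
  using surj_S[of i] dA_in[of x i] by simp

lemma fin_Y: "fin_subspace (Y i)"
proof (cases "i < J")
  case True
  then show ?thesis unfolding Y_def using fin_subspace_subset[OF fin_A subspace_U U_A] by simp
next
  case False
  have "subspace {b \<in> B i. S b = 0}"
    by (intro subspace_kernel_linear_on linear_imp_linear_on linear_S subspace_B)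
  then show ?thesis unfolding Y_def using False by (auto intro: fin_subspace_subset[OF fin_B])
qed

lemma linear_D: "linear_on (Y i) (D i)"
proof -
  consider "i + 1 < J" | "i + 1 = J" | "J \<le> i" by linarith
  then show ?thesis
  proof cases
    case 1
    have "linear_on (U i) (\<lambda>x. P (i + 1) (dA i x))"
      by (rule linear_on_compose[OF linear_on_subset[OF linear_dA U_A] linear_P])
        (use U_A dA_in in auto)
    then show ?thesis using 1 by (simp add: Y_def D_def[abs_def])
  next
    case 2
    have "linear_on (U i) (\<lambda>x. Sinv i (dA i x))"
      by (rule linear_on_compose[OF linear_on_subset[OF linear_dA U_A] linear_Sinv])
        (use 2 U_A in \<open>auto intro!: dA_A_eq_S\<close>)
    then have "linear_on (U i) (\<lambda>x. dB i (Sinv i (dA i x)))"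
      by (rule linear_on_compose[OF _ linear_dB])
        (use 2 U_A in \<open>auto intro!: inv_into_into dA_A_eq_S\<close>)
    then show ?thesis using 2 by (simp add: Y_def D_def[abs_def])
  next
    case 3
    then show ?thesis by (auto simp: Y_def D_def[abs_def] intro: linear_on_subset[OF linear_dB])
  qed
qed

text \<open>
  A uniform description of the cocycles in degrees below \<open>J\<close>. In degrees below \<open>J - 1\<close> the
  vanishing projection gives \<open>d x = S b\<close>, and \<open>S\<close> maps \<open>d b\<close> to \<open>- d d x = 0\<close>; injectivity of \<open>S\<close>
  one degree higher yields \<open>d b = 0\<close>. In degree \<open>J - 1\<close> there always is a
  \<open>b\<close> with \<open>d x = S b\<close>, and \<open>D x = d b\<close>.
\<close>

lemma D_eq_0_iff:
  assumes "k < J" "x \<in> U k"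
  shows "D k x = 0 \<longleftrightarrow> (\<exists>b\<in>B k. dB k b = 0 \<and> dA k x = S b)"
proof (cases "k + 1 = J")
  case True
  have xA: "x \<in> A k" using assms U_A by auto
  obtain b where b: "b \<in> B k" "dA k x = S b" using dA_A_eq_S[OF _ xA] True by auto
  then have D: "D k x = dB k b" using True by (simp add: D_def Sinv_S)
  show ?thesis
  proof
    assume "D k x = 0" then show "\<exists>b\<in>B k. dB k b = 0 \<and> dA k x = S b" using b D by auto
  next
    assume "\<exists>b\<in>B k. dB k b = 0 \<and> dA k x = S b"
    then obtain b' where b': "b' \<in> B k" "dB k b' = 0" "dA k x = S b'" by auto
    then have "b = b'" using b inj_S[OF assms(1)] by (auto dest: inj_onD)
    then show "D k x = 0" using D b' by simp
  qed
next
  case False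
  then have k: "Suc k < J" using assms by simp
  have xA: "x \<in> A k" using assms U_A by auto
  have D: "D k x = P (Suc k) (dA k x)" using k by (simp add: D_def)
  show ?thesis
  proof
    assume "D k x = 0"
    then have "dA k x \<in> R (Suc k)" using P_diff_R[OF dA_in[OF xA]] D by simp
    then obtain b where b: "b \<in> B k" "dA k x = S b" by (auto simp: R_def)
    have "S (dB k b) = 0" using S_dB[OF b(1)] dA_dA[OF xA] b(2) by simp
    then have "S (dB k b) = S 0" by (simp add: linear_0[OF linear_S])
    then have "dB k b = 0"
      using inj_S[OF k] dB_in[OF b(1)] subspace_0[OF subspace_B] by (auto dest: inj_onD)
    then show "\<exists>b\<in>B k. dB k b = 0 \<and> dA k x = S b" using b by auto
  next
    assume "\<exists>b\<in>B k. dB k b = 0 \<and> dA k x = S b"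
    then show "D k x = 0" unfolding D by (intro P_zero) (auto simp: R_def)
  qed
qed

lemma coboundaries_Y_subset: "coboundaries Y D k \<subseteq> cocycles Y D k"
proof (cases k)
  case 0
  then show ?thesis
    using subspace_0[OF fin_subspace_subspace[OF fin_Y]]
      linear_on_zero[OF linear_D fin_subspace_subspace[OF fin_Y]]
    by (auto simp: coboundaries_def cocycles_def)
next
  case (Suc j)
  have "D k (D j x) = 0 \<and> D j x \<in> Y k" if x: "x \<in> Y j" for x
  proof -
    consider "k < J" | "k = J" | "J < k" by linarith
    then show ?thesis
    proof cases
      case 1
      then have xA: "x \<in> A j" using x U_A Suc by (auto simp: Y_def)
      have Dx: "D j x = P k (dA j x)" using 1 Suc by (simp add: D_def)
      have kA: "dA j x \<in> A k" using dA_in[OF xA] Suc by simp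
      have u: "P k (dA j x) \<in> U k" by (rule P_in[OF kA])
      obtain b where b: "b \<in> B k" "dB k b = 0" "dA k (dA j x - P k (dA j x)) = S b"
        using dA_R[OF P_diff_R[OF kA]] by auto
      have "dA k (dA j x - P k (dA j x)) = - dA k (P k (dA j x))"
        using linear_on_diff[OF linear_dA subspace_A kA] u U_A dA_dA[OF xA] Suc by auto
      then have "dA k (P k (dA j x)) = S (- b)"
        using b(3) by (simp add: linear_neg[OF linear_S] minus_equation_iff)
      moreover have "dB k (- b) = 0" using linear_on_neg[OF linear_dB b(1)] b(2) by simp
      ultimately show ?thesis
        unfolding Dx D_eq_0_iff[OF 1 u] using subspace_neg[OF subspace_B b(1)] u 1 by (auto simp: Y_def)
    next
      case 2
      then have xA: "x \<in> A j" using x U_A Suc by (auto simp: Y_def)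
      obtain b where b: "b \<in> B j" "dA j x = S b" using dA_A_eq_S[OF _ xA] 2 Suc by auto
      then have Dx: "D j x = dB j b" using 2 Suc by (simp add: D_def Sinv_S)
      have "S (dB j b) = 0" using S_dB[OF b(1)] dA_dA[OF xA] b(2) by simp
      then show ?thesis
        unfolding Dx using dB_in[OF b(1)] dB_dB[OF b(1)] 2 Suc by (auto simp: Y_def D_def)
    next
      case 3
      then have b: "x \<in> B j" "S x = 0" and Dx: "D j x = dB j x" using x Suc by (auto simp: Y_def D_def)
      have "S (dB j x) = 0"
        using S_dB[OF b(1)] b(2) linear_on_zero[OF linear_dA subspace_A] by simp
      then show ?thesis
        unfolding Dx using dB_in[OF b(1)] dB_dB[OF b(1)] 3 Suc by (auto simp: Y_def D_def)
    qed
  qed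
  then show ?thesis using Suc by (auto simp: coboundaries_def cocycles_def)
qed

lemma cocycles_Y: "fin_subspace (cocycles Y D k)" "subspace (coboundaries Y D k)"
proof -
  have s: "subspace (Y i)" for i by (rule fin_subspace_subspace[OF fin_Y])
  show "fin_subspace (cocycles Y D k)"
    unfolding cocycles_def
    by (rule fin_subspace_subset[OF fin_Y subspace_kernel_linear_on[OF linear_D s]]) auto
  show "subspace (coboundaries Y D k)"
    unfolding coboundaries_def by (auto intro: subspace_image_linear_on linear_D s)
qed

text \<open>
  Zigzag with \<open>f = S\<^sup>-\<^sup>1 d\<close>, which maps cocycles to cocycles of \<open>B\<close>, and the projection \<open>P\<close>. If
  \<open>f z = d b\<close>, then \<open>z + S b\<close> is a cocycle of \<open>A\<close> that projects to \<open>z\<close>.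
\<close>

lemma cohomology_bound_below:
  assumes k: "k < J"
  shows "quotient_dim (cocycles Y D k) (coboundaries Y D k) \<le>
    quotient_dim (cocycles A dA k) (coboundaries A dA k) + quotient_dim (cocycles B dB k) (coboundaries B dB k)"
proof (rule quotient_dim_zigzag[OF cocycles_Y coboundaries_Y_subset cocycles_A cocycles_B])
  let ?f = "\<lambda>x. Sinv k (dA k x)"
  have Z: "x \<in> A k \<and> ?f x \<in> B k \<and> dB k (?f x) = 0 \<and> dA k x = S (?f x)" if x: "x \<in> cocycles Y D k" for x
  proof -
    have u: "x \<in> U k" using x k by (simp add: cocycles_def Y_def)
    then obtain b where b: "b \<in> B k" "dB k b = 0" "dA k x = S b"
      using D_eq_0_iff[OF k u] x by (auto simp: cocycles_def)
    then show ?thesis using Sinv_S[OF k b(1)] u U_A by auto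
  qed
  have "linear_on (cocycles Y D k) (dA k)" using Z by (intro linear_on_subset[OF linear_dA]) auto
  moreover have "dA k ` cocycles Y D k \<subseteq> S ` B k" using Z by auto
  ultimately show "linear_on (cocycles Y D k) ?f" by (rule linear_on_compose[OF _ linear_Sinv[OF k]])
  show "?f ` cocycles Y D k \<subseteq> cocycles B dB k" using Z by (auto simp: cocycles_def)
  show "?f ` coboundaries Y D k \<subseteq> coboundaries B dB k"
  proof (cases k)
    case 0
    have "?f 0 = 0"
      using Sinv_S[OF k subspace_0[OF subspace_B]] linear_0[OF linear_S] linear_on_zero[OF linear_dA subspace_A]
      by simp
    then show ?thesis using 0 by (auto simp: coboundaries_def)
  next
    case (Suc j)
    have "?f (D j x) \<in> dB j ` B j" if x: "x \<in> Y j" for x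
    proof -
      have xA: "x \<in> A j" using x k U_A Suc by (auto simp: Y_def)
      have Dx: "D j x = P k (dA j x)" using k Suc by (simp add: D_def)
      have kA: "dA j x \<in> A k" using dA_in[OF xA] Suc by simp
      have u: "P k (dA j x) \<in> A k" using P_in[OF kA] U_A by auto
      obtain b where b: "b \<in> B k" "dA k (dA j x - P k (dA j x)) = S b" "b \<in> dB j ` B j"
        using dA_R[OF P_diff_R[OF kA]] Suc by auto
      have "dA k (dA j x - P k (dA j x)) = - dA k (P k (dA j x))"
        using linear_on_diff[OF linear_dA subspace_A kA u] dA_dA[OF xA] Suc by auto
      then have "dA k (P k (dA j x)) = S (- b)"
        using b(2) by (simp add: linear_neg[OF linear_S] minus_equation_iff)
      then have "?f (D j x) = - b"
        unfolding Dx using Sinv_S[OF k subspace_neg[OF subspace_B b(1)]] by simp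
      then show ?thesis
        using subspace_neg[OF subspace_image_linear_on[OF linear_dB subspace_B] b(3)] by simp
    qed
    then show ?thesis using Suc by (auto simp: coboundaries_def)
  qed
  show "linear_on (cocycles A dA k) (P k)" by (rule linear_on_subset[OF linear_P]) (auto simp: cocycles_def)
  show "P k ` coboundaries A dA k \<subseteq> coboundaries Y D k"
  proof (cases k)
    case 0
    then show ?thesis
      using P_id[OF subspace_0[OF subspace_U]] by (auto simp: coboundaries_def)
  next
    case (Suc j)
    have "P k (dA j a) \<in> D j ` Y j" if a: "a \<in> A j" for a
    proof -
      have u: "P j a \<in> U j" by (rule P_in[OF a])
      then have uA: "P j a \<in> A j" using U_A by auto
      have r: "a - P j a \<in> R j" by (rule P_diff_R[OF a])
      then have rA: "a - P j a \<in> A j" using R_A by auto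
      have "dA j (a - P j a) \<in> R k" using dA_R[OF r] Suc by (auto simp: R_def)
      then have 0: "P k (dA j (a - P j a)) = 0" by (rule P_zero)
      have "P k (dA j (P j a + (a - P j a))) = P k (dA j (P j a)) + P k (dA j (a - P j a))"
        using linear_onD(1)[OF linear_dA uA rA] linear_onD(1)[OF linear_P dA_in[OF uA] dA_in[OF rA]] Suc
        by simp
      then have "P k (dA j a) = D j (P j a)" using 0 k Suc by (simp add: D_def)
      then show ?thesis using u k Suc by (auto simp: Y_def)
    qed
    then show ?thesis using Suc by (auto simp: coboundaries_def)
  qed
  fix z assume z: "z \<in> cocycles Y D k" and f: "?f z \<in> coboundaries B dB k"
  have zU: "z \<in> U k" using z k by (simp add: cocycles_def Y_def)
  have "\<exists>x\<in>cocycles A dA k. P k x = z"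
  proof (cases k)
    case 0
    then have "dA k z = 0" using f Z[OF z] linear_0[OF linear_S] by (simp add: coboundaries_def)
    then show ?thesis using Z[OF z] P_id[OF zU] by (auto simp: cocycles_def)
  next
    case (Suc j)
    then obtain b where b: "b \<in> B j" "?f z = dB j b" using f by (auto simp: coboundaries_def)
    have dz: "dA k z = - dA k (S b)" using Z[OF z] S_dB[OF b(1)] b(2) Suc by simp
    have SbR: "S b \<in> R k" using b(1) Suc by (simp add: R_def)
    then have SbA: "S b \<in> A k" using R_A by auto
    have "dA k (z + S b) = 0" using linear_onD(1)[OF linear_dA _ SbA] Z[OF z] dz by simp
    moreover have zA: "z + S b \<in> A k" using Z[OF z] SbA by (intro subspace_add subspace_A) auto
    moreover have "P k (z + S b) = z" using zU SbR zA by (intro P_eqI) auto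
    ultimately show ?thesis by (auto simp: cocycles_def)
  qed
  then obtain x where "x \<in> cocycles A dA k" "P k x = z" by auto
  then show "\<exists>x\<in>cocycles A dA k. z - P k x \<in> coboundaries Y D k"
    using subspace_0[OF cocycles_Y(2)] by (intro bexI[of _ x]) auto
qed

text \<open>
  Zigzag with the identity, which maps cocycles to cocycles of \<open>B\<close>, and \<open>d T\<close> for a linear right
  inverse \<open>T\<close> of \<open>S\<close>. If \<open>z = d b\<close>, then \<open>S b\<close> is a cocycle of \<open>A\<close>, and \<open>z - d (T (S b))\<close> is the
  derivative of an element of the kernel of \<open>S\<close>. That \<open>d T\<close> maps an exact \<open>d a\<close> to a BGG coboundary
  holds for \<open>k = J\<close> by the definition of \<open>D\<close>; for \<open>k > J\<close> one writes \<open>a = S b\<close> and adds \<open>d b\<close> to \<open>T (d a)\<close>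
  to reach the kernel of \<open>S\<close>.
\<close>

lemma cohomology_bound_above:
  assumes "J \<le> k"
  shows "quotient_dim (cocycles Y D k) (coboundaries Y D k) \<le>
    quotient_dim (cocycles A dA k) (coboundaries A dA k) + quotient_dim (cocycles B dB k) (coboundaries B dB k)"
proof -
  obtain j where k: "k = Suc j" using assms J by (cases k) auto
  have surj: "S ` B j = A k" using surj_S[of j] assms k by simp
  obtain T where T: "range T \<subseteq> B j" "linear T" "\<forall>a\<in>S ` B j. S (T a) = a"
    using linear_exists_right_inverse_on[OF linear_S subspace_B] by blast
  have TB: "T a \<in> B j" for a using T(1) by auto
  have ST: "S (T a) = a" if "a \<in> A k" for a using T(3) surj that by simp
  let ?p = "\<lambda>a. dB j (T a)"
  have dB_in_BY: "dB j b \<in> coboundaries Y D k" if b: "b \<in> B j" "S b = 0" for b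
  proof (cases "j < J")
    case True
    have "S b = S 0" using b by (simp add: linear_0[OF linear_S])
    then have "b = 0" by (rule inj_onD[OF inj_S[OF True] _ b(1) subspace_0[OF subspace_B]])
    then show ?thesis using linear_on_zero[OF linear_dB subspace_B] subspace_0[OF cocycles_Y(2)] by simp
  next
    case False
    then show ?thesis
      unfolding coboundaries_def using b k by (auto simp: Y_def D_def intro!: rev_image_eqI[of b])
  qed
  show ?thesis
  proof (rule quotient_dim_zigzag[OF cocycles_Y coboundaries_Y_subset cocycles_A cocycles_B, where f = "\<lambda>x. x" and p = ?p])
    show "linear_on (cocycles Y D k) (\<lambda>x. x)" by (simp add: linear_on_def)
    show "(\<lambda>x. x) ` cocycles Y D k \<subseteq> cocycles B dB k"
      using assms by (auto simp: cocycles_def Y_def D_def)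
    show "(\<lambda>x. x) ` coboundaries Y D k \<subseteq> coboundaries B dB k"
    proof -
      have "D j x \<in> dB j ` B j" if x: "x \<in> Y j" for x
      proof (cases "k = J")
        case True
        then have "x \<in> A j" using x k U_A by (auto simp: Y_def)
        then have "dA j x \<in> S ` B j" using True k by (intro dA_A_eq_S) auto
        then have "Sinv j (dA j x) \<in> B j" by (rule inv_into_into)
        then show ?thesis using True k by (auto simp: D_def)
      next
        case False
        then show ?thesis using x k assms by (auto simp: D_def Y_def)
      qed
      then show ?thesis using k by (auto simp: coboundaries_def)
    qed
    have "linear_on (cocycles A dA k) T" by (rule linear_imp_linear_on[OF T(2)])
    then show "linear_on (cocycles A dA k) ?p" by (rule linear_on_compose[OF _ linear_dB]) (use TB in auto)
    have "?p (dA j a) \<in> coboundaries Y D k" if a: "a \<in> A j" for a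
    proof (cases "k = J")
      case True
      have u: "P j a \<in> U j" by (rule P_in[OF a])
      then have uA: "P j a \<in> A j" using U_A by auto
      have r: "a - P j a \<in> R j" by (rule P_diff_R[OF a])
      then have rA: "a - P j a \<in> A j" using R_A by auto
      obtain c where c: "c \<in> B j" "dB j c = 0" "dA j (a - P j a) = S c"
        using dA_R[OF r] by auto
      obtain y where y: "y \<in> B j" "dA j (P j a) = S y"
        using dA_A_eq_S[OF _ uA] True k by auto
      have "dA j a = dA j (P j a) + dA j (a - P j a)"
        using linear_onD(1)[OF linear_dA uA rA] by simp
      then have "S (T (dA j a)) = S (y + c)"
        using c y ST[of "dA j a"] dA_in[OF a] k by (simp add: linear_add[OF linear_S])
      moreover have "y + c \<in> B j" using y c by (intro subspace_add subspace_B)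
      ultimately have "T (dA j a) = y + c"
        using inj_S[of j] True k TB by (auto dest: inj_onD)
      then have "?p (dA j a) = dB j y" using linear_onD(1)[OF linear_dB y(1) c(1)] c(2) by simp
      also have "dB j y = D j (P j a)" using y True k by (simp add: D_def Sinv_S)
      finally show ?thesis using u True k by (auto simp: coboundaries_def Y_def)
    next
      case False
      then obtain i where i: "j = Suc i" "J \<le> Suc i" using assms k J by (cases j) auto
      obtain b where b: "b \<in> B i" "a = S b" using surj_S[OF i(2)] a i(1) by auto
      have db: "dB i b \<in> B j" using dB_in[OF b(1)] i by simp
      have "S (T (dA j a) + dB i b) = dA j a + S (dB i b)"
        using ST[of "dA j a"] dA_in[OF a] k by (simp add: linear_add[OF linear_S])
      also have "\<dots> = 0" using S_dB[OF b(1)] b(2) i by simp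
      finally have 0: "S (T (dA j a) + dB i b) = 0" .
      have "dB j (T (dA j a) + dB i b) = ?p (dA j a)"
        using linear_onD(1)[OF linear_dB TB db] dB_dB[OF b(1)] i by simp
      then show ?thesis using dB_in_BY[OF subspace_add[OF subspace_B TB db] 0] by simp
    qed
    then show "?p ` coboundaries A dA k \<subseteq> coboundaries Y D k" using k by (auto simp: coboundaries_def)
    fix z assume z: "z \<in> cocycles Y D k" "z \<in> coboundaries B dB k"
    then obtain b where b: "b \<in> B j" "z = dB j b" using k by (auto simp: coboundaries_def)
    have Sz: "S z = 0" using z assms by (simp add: cocycles_def Y_def)
    have SbA: "S b \<in> A k" using S_in[OF b(1)] k by simp
    have "dA k (S b) = - S z" using S_dB[OF b(1)] b(2) k by simp
    then have Sb: "S b \<in> cocycles A dA k" using Sz SbA by (simp add: cocycles_def)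
    have "z - ?p (S b) = dB j (b - T (S b))"
      using linear_on_diff[OF linear_dB subspace_B b(1) TB] b(2) by simp
    moreover have "dB j (b - T (S b)) \<in> coboundaries Y D k"
      using b(1) TB ST[OF SbA]
      by (intro dB_in_BY) (auto simp: linear_diff[OF linear_S] intro: subspace_diff subspace_B)
    ultimately show "\<exists>x\<in>cocycles A dA k. z - ?p x \<in> coboundaries Y D k" using Sb by (intro bexI[of _ "S b"]) auto
  qed
qed

theorem cohomology_bound: "cohomology_dim Y D k \<le> cohomology_dim A dA k + cohomology_dim B dB k"
  using cohomology_bound_below[of k] cohomology_bound_above[of k]
  unfolding cohomology_dim_def cocycles_def coboundaries_def cocycles_def coboundaries_def by linarith

end

section \<open>The discrete spaces in coefficients\<close>

definition weakly_differentiable :: "'n \<Rightarrow> (real^'n::finite) L2 set" where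
  "weakly_differentiable m = {u. \<exists>v. has_weak_derivative (axis m 1) u v}"

abbreviation partial :: "'n \<Rightarrow> (real^'n::finite) L2 \<Rightarrow> (real^'n) L2" where
  "partial m \<equiv> weak_derivative (axis m 1)"

lemma has_partial: "u \<in> weakly_differentiable m \<Longrightarrow> has_weak_derivative (axis m 1) u (partial m u)"
  using weak_derivative_eqI by (auto simp: weakly_differentiable_def)

lemma subspace_weakly_differentiable: "subspace (weakly_differentiable m)"
  unfolding subspace_def weakly_differentiable_def
  using has_weak_derivative_zero has_weak_derivative_add has_weak_derivative_scaleR axis_in_Basis
  by blast

lemma linear_on_partial: "linear_on (weakly_differentiable m) (partial m)"
  unfolding linear_on_def
  by (auto intro!: weak_derivative_eqI has_weak_derivative_add has_weak_derivative_scaleR axis_in_Basis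
      dest: has_partial)

lemma partial_zero [simp]: "partial m 0 = 0"
  by (rule linear_on_zero[OF linear_on_partial subspace_weakly_differentiable])

definition coeff_space :: "('n::{finite,linorder} \<Rightarrow> nat \<Rightarrow> real L2 set) \<Rightarrow> 'n set \<Rightarrow> 'n set \<Rightarrow> (real, 'n) vec L2 set" where
  "coeff_space \<S> \<sigma> \<tau> = tensor_space (\<lambda>m. \<S> m (of_bool (m \<in> \<sigma>) + of_bool (m \<in> \<tau>)))"

lemma subspace_coeff_space: "subspace (coeff_space \<S> \<sigma> \<tau>)"
  by (simp add: coeff_space_def tensor_space_def subspace_span)

text \<open>
  An index lowers the degree once for each factor in which it occurs, so moving it from one factor
  to the other preserves the space. This is why \<open>S\<close> acts on the discrete spaces.
\<close>

lemma coeff_space_move: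
  "m \<in> \<sigma> \<Longrightarrow> m \<notin> \<tau> \<Longrightarrow> coeff_space \<S> (\<sigma> - {m}) (insert m \<tau>) = coeff_space \<S> \<sigma> \<tau>"
  "m \<notin> \<sigma> \<Longrightarrow> m \<in> \<tau> \<Longrightarrow> coeff_space \<S> (insert m \<sigma>) (\<tau> - {m}) = coeff_space \<S> \<sigma> \<tau>"
  unfolding coeff_space_def by (auto intro!: arg_cong[where f = tensor_space] ext simp: of_bool_def split: if_splits)

text \<open>
  The zero coefficients outside degree \<open>(k, l)\<close> let all sums over \<open>\<sigma>\<close> and \<open>\<tau>\<close> range over all sets.
\<close>

definition coeffs_in :: "('n::{finite,linorder} \<Rightarrow> nat \<Rightarrow> real L2 set) \<Rightarrow> nat \<Rightarrow> nat \<Rightarrow> ('n, (real, 'n) vec L2) coeffs set" where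
  "coeffs_in \<S> k l = {c. (\<forall>\<sigma> \<tau>. c \<sigma> \<tau> \<in> coeff_space \<S> \<sigma> \<tau>) \<and> bidegree k l c}"

lemma sum_bidegree:
  assumes "\<And>\<sigma> \<tau>. \<not> (card \<sigma> = k \<and> card \<tau> = l) \<Longrightarrow> G \<sigma> \<tau> = 0"
  shows "(\<Sum>\<sigma> | card \<sigma> = k. \<Sum>\<tau> | card \<tau> = l. G \<sigma> \<tau>) =
    (\<Sum>\<sigma>\<in>UNIV. \<Sum>\<tau>\<in>UNIV. G (\<sigma> :: 'n::{finite,linorder} set) (\<tau> :: 'n set))"
proof -
  have "(\<Sum>\<sigma> | card \<sigma> = k. \<Sum>\<tau> | card \<tau> = l. G \<sigma> \<tau>) = (\<Sum>\<sigma> | card \<sigma> = k. \<Sum>\<tau>\<in>UNIV. G \<sigma> \<tau>)"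
    using assms by (intro sum.cong sum.mono_neutral_left) auto
  also have "\<dots> = (\<Sum>\<sigma>\<in>UNIV. \<Sum>\<tau>\<in>UNIV. G \<sigma> \<tau>)"
    using assms by (intro sum.mono_neutral_left) auto
  finally show ?thesis .
qed

lemma form_space_eq: "form_space \<S> k l = comb ` coeffs_in \<S> k l"
proof (intro equalityI subsetI)
  fix \<mu> assume "\<mu> \<in> form_space \<S> k l"
  then obtain f where f: "\<mu> = (\<Sum>\<sigma> | card \<sigma> = k. \<Sum>\<tau> | card \<tau> = l.
         biform_scale (f \<sigma> \<tau>) (form_tensor (dx_set \<sigma>) (dx_set \<tau>)))"
      "\<And>\<sigma> \<tau>. card \<sigma> = k \<Longrightarrow> card \<tau> = l \<Longrightarrow> f \<sigma> \<tau> \<in> coeff_space \<S> \<sigma> \<tau>"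
    by (auto simp: form_space_def coeff_space_def)
  define c where "c \<sigma> \<tau> = (if card \<sigma> = k \<and> card \<tau> = l then f \<sigma> \<tau> else 0)" for \<sigma> \<tau>
  have "\<mu> = (\<Sum>\<sigma> | card \<sigma> = k. \<Sum>\<tau> | card \<tau> = l.
         biform_scale (c \<sigma> \<tau>) (form_tensor (dx_set \<sigma>) (dx_set \<tau>)))"
    unfolding f(1) by (intro sum.cong) (auto simp: c_def)
  also have "\<dots> = comb c"
    unfolding comb_def by (intro sum_bidegree) (auto simp: c_def)
  finally show "\<mu> \<in> comb ` coeffs_in \<S> k l"
    using f(2) by (auto simp: coeffs_in_def bidegree_def c_def subspace_0[OF subspace_coeff_space])
next
  fix \<mu> assume "\<mu> \<in> comb ` coeffs_in \<S> k l"
  then obtain c where c: "\<mu> = comb c" "\<And>\<sigma> \<tau>. c \<sigma> \<tau> \<in> coeff_space \<S> \<sigma> \<tau>" "bidegree k l c"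
    by (auto simp: coeffs_in_def)
  have "comb c = (\<Sum>\<sigma> | card \<sigma> = k. \<Sum>\<tau> | card \<tau> = l.
         biform_scale (c \<sigma> \<tau>) (form_tensor (dx_set \<sigma>) (dx_set \<tau>)))"
    unfolding comb_def
  proof (rule sum_bidegree[symmetric])
    fix \<sigma> \<tau> :: "'a set" assume "\<not> (card \<sigma> = k \<and> card \<tau> = l)"
    then have "c \<sigma> \<tau> = 0" using c(3) by (auto simp: bidegree_def)
    then show "biform_scale (c \<sigma> \<tau>) (form_tensor (dx_set \<sigma>) (dx_set \<tau>)) = 0" by simp
  qed
  then show "\<mu> \<in> form_space \<S> k l"
    unfolding c(1) form_space_def using c(2) by (auto simp: coeff_space_def)
qed

lemma subspace_coeffs_in: "subspace (coeffs_in \<S> k l)"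
  unfolding subspace_def coeffs_in_def
proof (intro conjI ballI allI; clarsimp; intro conjI allI)
  fix c c' :: "('a, (real, 'a) vec L2) coeffs" and \<sigma> \<tau> :: "'a set" and a :: real
  show "0 \<in> coeff_space \<S> \<sigma> \<tau>" by (rule subspace_0[OF subspace_coeff_space])
  show "bidegree k l (0 :: ('a, (real, 'a) vec L2) coeffs)" by (simp add: bidegree_def)
  show "c \<sigma> \<tau> + c' \<sigma> \<tau> \<in> coeff_space \<S> \<sigma> \<tau>"
    if "\<forall>\<sigma> \<tau>. c \<sigma> \<tau> \<in> coeff_space \<S> \<sigma> \<tau>" "\<forall>\<sigma> \<tau>. c' \<sigma> \<tau> \<in> coeff_space \<S> \<sigma> \<tau>"
    using that by (intro subspace_add[OF subspace_coeff_space]) auto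
  show "bidegree k l (c + c')" if "bidegree k l c" "bidegree k l c'"
    using that unfolding bidegree_def by (metis add.right_neutral plus_fun_apply)
  show "(a *\<^sub>R c) \<sigma> \<tau> \<in> coeff_space \<S> \<sigma> \<tau>" if "\<forall>\<sigma> \<tau>. c \<sigma> \<tau> \<in> coeff_space \<S> \<sigma> \<tau>"
    using that by (auto simp: scaleR_fun_apply intro: subspace_scale[OF subspace_coeff_space])
  show "bidegree k l (a *\<^sub>R c)" if "bidegree k l c"
    using that by (auto simp: bidegree_def scaleR_fun_apply)
qed

lemma subspace_form_space: "subspace (form_space \<S> k l)"
  unfolding form_space_eq by (rule linear_subspace_image[OF linear_comb subspace_coeffs_in])

lemma card_move:
  fixes \<sigma> \<tau> :: "'n::finite set"
  shows "m \<in> \<sigma> \<Longrightarrow> card (\<sigma> - {m}) = k \<longleftrightarrow> card \<sigma> = Suc k" "m \<notin> \<tau> \<Longrightarrow> card (insert m \<tau>) = Suc (card \<tau>)"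
  using card_gt_0_iff[of \<sigma>] by (auto simp: card_Diff_singleton)

lemma raise_coeffs_in:
  assumes "c \<in> coeffs_in \<S> k (Suc l)"
  shows "raise c \<in> coeffs_in \<S> (Suc k) l"
proof -
  have c: "c \<sigma> \<tau> \<in> coeff_space \<S> \<sigma> \<tau>" "c \<sigma> \<tau> \<noteq> 0 \<Longrightarrow> card \<sigma> = k \<and> card \<tau> = Suc l" for \<sigma> \<tau>
    using assms by (auto simp: coeffs_in_def bidegree_def)
  have "raise c \<sigma> \<tau> \<in> coeff_space \<S> \<sigma> \<tau>" for \<sigma> \<tau>
    unfolding raise_def
    using c(1) by (intro subspace_sum subspace_scale subspace_coeff_space) (metis DiffE coeff_space_move(1))
  moreover have "card \<sigma> = Suc k \<and> card \<tau> = l" if nz: "raise c \<sigma> \<tau> \<noteq> 0" for \<sigma> \<tau>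
  proof -
    obtain m where m: "m \<in> \<sigma> - \<tau>" "swap_sign m \<sigma> \<tau> *\<^sub>R c (\<sigma> - {m}) (insert m \<tau>) \<noteq> 0"
      using nz unfolding raise_def by (rule sum.not_neutral_contains_not_neutral)
    then show ?thesis using c(2)[of "\<sigma> - {m}" "insert m \<tau>"] card_move[of m] by auto
  qed
  ultimately show ?thesis by (simp add: coeffs_in_def bidegree_def)
qed

lemma lower_coeffs_in:
  assumes "c \<in> coeffs_in \<S> (Suc k) l"
  shows "lower c \<in> coeffs_in \<S> k (Suc l)"
proof -
  have c: "c \<sigma> \<tau> \<in> coeff_space \<S> \<sigma> \<tau>" "c \<sigma> \<tau> \<noteq> 0 \<Longrightarrow> card \<sigma> = Suc k \<and> card \<tau> = l" for \<sigma> \<tau>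
    using assms by (auto simp: coeffs_in_def bidegree_def)
  have "lower c \<sigma> \<tau> \<in> coeff_space \<S> \<sigma> \<tau>" for \<sigma> \<tau>
    unfolding lower_def
    using c(1) by (intro subspace_sum subspace_scale subspace_coeff_space) (metis DiffE coeff_space_move(2))
  moreover have "card \<sigma> = k \<and> card \<tau> = Suc l" if nz: "lower c \<sigma> \<tau> \<noteq> 0" for \<sigma> \<tau>
  proof -
    obtain m where m: "m \<in> \<tau> - \<sigma>" "swap_sign m \<sigma> \<tau> *\<^sub>R c (insert m \<sigma>) (\<tau> - {m}) \<noteq> 0"
      using nz unfolding lower_def by (rule sum.not_neutral_contains_not_neutral)
    then show ?thesis using c(2)[of "insert m \<sigma>" "\<tau> - {m}"] card_move[of m] by auto
  qed
  ultimately show ?thesis by (simp add: coeffs_in_def bidegree_def)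
qed

text \<open>
  The exterior derivative in coefficients, see \<open>ext_deriv_comb\<close>. Every \<open>m \<in> \<sigma>\<close> is differentiated
  in a coefficient whose index set \<open>\<sigma> - {m}\<close> lacks \<open>m\<close>, where the degree in direction \<open>m\<close> has been
  lowered at most once and the derivative exists.
\<close>

definition differential :: "('n::{finite,linorder}, (real, 'n) vec L2) coeffs \<Rightarrow> ('n, (real, 'n) vec L2) coeffs" where
  "differential c \<sigma> \<tau> = (\<Sum>m\<in>\<sigma>. pos_sign m \<sigma> *\<^sub>R partial m (c (\<sigma> - {m}) \<tau>))"

lemma biform_scale_form_tensor_scaleR:
  "biform_scale a (form_tensor (r *\<^sub>R \<alpha>) \<beta>) = biform_scale (r *\<^sub>R a) (form_tensor \<alpha> \<beta>)"
  by (intro ext) (simp add: biform_scale_def form_tensor_def scaleR_fun_apply mult_ac)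

lemma biform_scale_form_tensor_zero: "biform_scale a (form_tensor 0 \<beta>) = 0"
  by (intro ext) (simp add: biform_scale_def form_tensor_def)

lemma ext_deriv_comb:
  assumes "bidegree k l c"
  shows "ext_deriv k l (comb c) = comb (differential c)"
proof -
  let ?W = "\<lambda>f m \<sigma> \<tau>. biform_scale f (form_tensor (wedge1 (dx m) (dx_set \<sigma>)) (dx_set \<tau>))"
  let ?B = "\<lambda>f \<sigma> \<tau>. biform_scale f (form_tensor (dx_set \<sigma>) (dx_set \<tau>))"
  have "ext_deriv k l (comb c) =
      (\<Sum>\<sigma> | card \<sigma> = k. \<Sum>\<tau> | card \<tau> = l. \<Sum>m\<in>UNIV. ?W (partial m (c \<sigma> \<tau>)) m \<sigma> \<tau>)"
    by (simp add: ext_deriv_def)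
  also have "\<dots> = (\<Sum>\<sigma>\<in>UNIV. \<Sum>\<tau>\<in>UNIV. \<Sum>m\<in>UNIV. ?W (partial m (c \<sigma> \<tau>)) m \<sigma> \<tau>)"
  proof (rule sum_bidegree)
    fix \<sigma> \<tau> :: "'a set" assume "\<not> (card \<sigma> = k \<and> card \<tau> = l)"
    then have "c \<sigma> \<tau> = 0" using assms by (auto simp: bidegree_def)
    then show "(\<Sum>m\<in>UNIV. ?W (partial m (c \<sigma> \<tau>)) m \<sigma> \<tau>) = 0" by simp
  qed
  also have "\<dots> = (\<Sum>\<sigma>\<in>UNIV. \<Sum>m\<in>- \<sigma>. \<Sum>\<tau>\<in>UNIV.
      ?B (pos_sign m \<sigma> *\<^sub>R partial m (c \<sigma> \<tau>)) (insert m \<sigma>) \<tau>)"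
  proof (intro sum.cong refl)
    fix \<sigma> :: "'a set"
    have "(\<Sum>\<tau>\<in>UNIV. \<Sum>m\<in>UNIV. ?W (partial m (c \<sigma> \<tau>)) m \<sigma> \<tau>) =
        (\<Sum>m\<in>UNIV. \<Sum>\<tau>\<in>UNIV. ?W (partial m (c \<sigma> \<tau>)) m \<sigma> \<tau>)"
      by (rule sum.swap)
    also have "\<dots> = (\<Sum>m\<in>- \<sigma>. \<Sum>\<tau>\<in>UNIV. ?W (partial m (c \<sigma> \<tau>)) m \<sigma> \<tau>)"
      by (rule sum.mono_neutral_right) (auto simp: wedge1_dx_set biform_scale_form_tensor_zero)
    also have "\<dots> = (\<Sum>m\<in>- \<sigma>. \<Sum>\<tau>\<in>UNIV. ?B (pos_sign m \<sigma> *\<^sub>R partial m (c \<sigma> \<tau>)) (insert m \<sigma>) \<tau>)"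
      by (intro sum.cong refl) (simp add: wedge1_dx_set biform_scale_form_tensor_scaleR)
    finally show "(\<Sum>\<tau>\<in>UNIV. \<Sum>m\<in>UNIV. ?W (partial m (c \<sigma> \<tau>)) m \<sigma> \<tau>) = \<dots>" .
  qed
  also have "\<dots> = (\<Sum>(\<sigma>, m)\<in>(SIGMA \<sigma>:UNIV. - \<sigma>). \<Sum>\<tau>\<in>UNIV.
      ?B (pos_sign m \<sigma> *\<^sub>R partial m (c \<sigma> \<tau>)) (insert m \<sigma>) \<tau>)"
    by (rule sum.Sigma) auto
  also have "\<dots> = (\<Sum>(\<sigma>, m)\<in>(SIGMA \<sigma>:UNIV. \<sigma>). \<Sum>\<tau>\<in>UNIV.
      ?B (pos_sign m \<sigma> *\<^sub>R partial m (c (\<sigma> - {m}) \<tau>)) \<sigma> \<tau>)"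
    by (rule sum.reindex_bij_witness[of _ "\<lambda>(\<sigma>, m). (\<sigma> - {m}, m)" "\<lambda>(\<sigma>, m). (insert m \<sigma>, m)"])
      (auto simp: insert_absorb)
  also have "\<dots> = (\<Sum>\<sigma>\<in>UNIV. \<Sum>m\<in>\<sigma>. \<Sum>\<tau>\<in>UNIV. ?B (pos_sign m \<sigma> *\<^sub>R partial m (c (\<sigma> - {m}) \<tau>)) \<sigma> \<tau>)"
    by (rule sum.Sigma[symmetric]) auto
  also have "\<dots> = comb (differential c)"
    unfolding comb_def differential_def biform_scale_sum
    by (intro sum.cong refl sum.swap)
  finally show ?thesis .
qed

locale tensor_product_spaces =
  fixes \<S> :: "'n::{finite,linorder} \<Rightarrow> nat \<Rightarrow> real L2 set"
  assumes finite_dim: "\<And>m a. a \<le> 2 \<Longrightarrow> \<exists>B. finite B \<and> \<S> m a = span B"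
    and differentiable: "\<And>m a f. a \<le> 1 \<Longrightarrow> f \<in> \<S> m a \<Longrightarrow> \<exists>g. has_weak_derivative 1 f g"
    and onto: "\<And>m a. a \<le> 1 \<Longrightarrow> weak_derivative 1 ` \<S> m a = \<S> m (a + 1)"
begin

lemma coeff_space_partial:
  assumes "m \<notin> \<sigma>" "u \<in> coeff_space \<S> \<sigma> \<tau>"
  shows "u \<in> weakly_differentiable m" "partial m u \<in> coeff_space \<S> (insert m \<sigma>) \<tau>"
proof -
  let ?A = "\<lambda>j. \<S> j (of_bool (j \<in> \<sigma>) + of_bool (j \<in> \<tau>))"
  let ?a = "of_bool (m \<in> \<tau>) :: nat"
  have A: "?A m = \<S> m ?a" using assms(1) by simp
  have "\<exists>g\<in>\<S> m (?a + 1). has_weak_derivative 1 f g" if f: "f \<in> ?A m" for f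
  proof -
    have f': "f \<in> \<S> m ?a" using f A by simp
    have a: "?a \<le> 1" by simp
    obtain g where g: "has_weak_derivative 1 f g" using differentiable[OF a f'] by blast
    have "g \<in> \<S> m (?a + 1)"
      using onto[OF a, of m] weak_derivative_eqI[OF g] f' by blast
    then show ?thesis using g by blast
  qed
  from tensor_space_weak_derivative[of ?A m "\<S> m (?a + 1)", OF this] assms(2)
  obtain v where v: "v \<in> tensor_space (?A(m := \<S> m (?a + 1)))" "has_weak_derivative (axis m 1) u v"
    unfolding coeff_space_def by blast
  have "?A(m := \<S> m (?a + 1)) = (\<lambda>j. \<S> j (of_bool (j \<in> insert m \<sigma>) + of_bool (j \<in> \<tau>)))"
    using assms(1) by (auto simp: fun_eq_iff)
  then have "v \<in> coeff_space \<S> (insert m \<sigma>) \<tau>" using v(1) by (simp add: coeff_space_def)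
  then show "u \<in> weakly_differentiable m" "partial m u \<in> coeff_space \<S> (insert m \<sigma>) \<tau>"
    using v(2) weak_derivative_eqI[OF v(2)] by (auto simp: weakly_differentiable_def)
qed

lemma coeff_space_partial_commute:
  assumes "m \<notin> \<sigma>" "p \<notin> \<sigma>" "m \<noteq> p" "u \<in> coeff_space \<S> \<sigma> \<tau>"
  shows "partial m (partial p u) = partial p (partial m u)"
proof (rule weak_derivatives_commute[OF assms(3)])
  show "u \<in> tensor_space (\<lambda>m. \<S> m (of_bool (m \<in> \<sigma>) + of_bool (m \<in> \<tau>)))"
    using assms(4) by (simp add: coeff_space_def)
qed (use assms(1,2) in \<open>auto intro: differentiable[rotated]\<close>)

lemma differential_coeffs_in:
  assumes "c \<in> coeffs_in \<S> k l"
  shows "differential c \<in> coeffs_in \<S> (Suc k) l"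
proof -
  have c: "c \<sigma> \<tau> \<in> coeff_space \<S> \<sigma> \<tau>" "c \<sigma> \<tau> \<noteq> 0 \<Longrightarrow> card \<sigma> = k \<and> card \<tau> = l" for \<sigma> \<tau>
    using assms by (auto simp: coeffs_in_def bidegree_def)
  have "partial m (c (\<sigma> - {m}) \<tau>) \<in> coeff_space \<S> \<sigma> \<tau>" if "m \<in> \<sigma>" for m \<sigma> \<tau>
    using coeff_space_partial(2)[of m "\<sigma> - {m}", OF _ c(1)] that by (simp add: insert_absorb)
  then have "differential c \<sigma> \<tau> \<in> coeff_space \<S> \<sigma> \<tau>" for \<sigma> \<tau>
    unfolding differential_def by (intro subspace_sum subspace_scale subspace_coeff_space)
  moreover have "card \<sigma> = Suc k \<and> card \<tau> = l" if nz: "differential c \<sigma> \<tau> \<noteq> 0" for \<sigma> \<tau>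
  proof -
    obtain m where m: "m \<in> \<sigma>" "pos_sign m \<sigma> *\<^sub>R partial m (c (\<sigma> - {m}) \<tau>) \<noteq> 0"
      using nz unfolding differential_def by (rule sum.not_neutral_contains_not_neutral)
    then have "c (\<sigma> - {m}) \<tau> \<noteq> 0" by auto
    then show ?thesis using c(2)[of "\<sigma> - {m}" \<tau>] card_move[of m] m(1) by auto
  qed
  ultimately show ?thesis by (simp add: coeffs_in_def bidegree_def)
qed

lemma linear_on_differential: "linear_on (coeffs_in \<S> k l) differential"
proof -
  have c: "c (\<sigma> - {m}) \<tau> \<in> weakly_differentiable m" if "c \<in> coeffs_in \<S> k l" for c m \<sigma> \<tau>
    using that coeff_space_partial(1)[of m "\<sigma> - {m}"] by (auto simp: coeffs_in_def)
  show ?thesis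
    unfolding linear_on_def
  proof (intro conjI ballI allI ext)
    fix x y \<sigma> \<tau> assume "x \<in> coeffs_in \<S> k l" "y \<in> coeffs_in \<S> k l"
    then show "differential (x + y) \<sigma> \<tau> = (differential x + differential y) \<sigma> \<tau>"
      by (simp add: differential_def linear_onD(1)[OF linear_on_partial] c scaleR_add_right sum.distrib)
  next
    fix a x \<sigma> \<tau> assume "x \<in> coeffs_in \<S> k l"
    then show "differential (a *\<^sub>R x) \<sigma> \<tau> = (a *\<^sub>R differential x) \<sigma> \<tau>"
      by (simp add: differential_def scaleR_fun_apply linear_onD(2)[OF linear_on_partial] c scaleR_sum_right mult.commute)
  qed
qed

text \<open>
  The weak derivatives commute, while the signs for the two orders of removing two indices from \<open>\<sigma>\<close>
  are opposite.
\<close>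

lemma differential_differential:
  assumes "c \<in> coeffs_in \<S> k l"
  shows "differential (differential c) = 0"
proof (intro ext)
  fix \<sigma> \<tau>
  have c: "c \<sigma> \<tau> \<in> coeff_space \<S> \<sigma> \<tau>" for \<sigma> \<tau>
    using assms by (auto simp: coeffs_in_def)
  define G where "G m p = (pos_sign m \<sigma> * pos_sign p (\<sigma> - {m})) *\<^sub>R partial m (partial p (c (\<sigma> - {m} - {p}) \<tau>))" for m p
  have D: "differential (differential c) \<sigma> \<tau> = (\<Sum>m\<in>\<sigma>. \<Sum>p\<in>\<sigma> - {m}. G m p)"
    unfolding differential_def[of "differential c"]
  proof (rule sum.cong[OF refl])
    fix m assume m: "m \<in> \<sigma>"
    have "partial p (c (\<sigma> - {m} - {p}) \<tau>) \<in> weakly_differentiable m" if p: "p \<in> \<sigma> - {m}" for p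
    proof (rule coeff_space_partial(1))
      show "partial p (c (\<sigma> - {m} - {p}) \<tau>) \<in> coeff_space \<S> (insert p (\<sigma> - {m} - {p})) \<tau>"
        by (rule coeff_space_partial(2)[OF _ c]) auto
    qed (use p in auto)
    then have "partial m (differential c (\<sigma> - {m}) \<tau>) =
        (\<Sum>p\<in>\<sigma> - {m}. pos_sign p (\<sigma> - {m}) *\<^sub>R partial m (partial p (c (\<sigma> - {m} - {p}) \<tau>)))"
      unfolding differential_def by (intro linear_on_sum[OF linear_on_partial subspace_weakly_differentiable])
    then show "pos_sign m \<sigma> *\<^sub>R partial m (differential c (\<sigma> - {m}) \<tau>) = (\<Sum>p\<in>\<sigma> - {m}. G m p)"
      by (simp add: G_def scaleR_sum_right)
  qed
  have anti: "G m p = - G p m" if "m \<in> \<sigma>" "p \<in> \<sigma>" "m \<noteq> p" for m p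
  proof -
    have set: "\<sigma> - {p} - {m} = \<sigma> - {m} - {p}" by auto
    have sign: "pos_sign m \<sigma> * pos_sign p (\<sigma> - {m}) = - (pos_sign p \<sigma> * pos_sign m (\<sigma> - {p}))"
      using that by (cases "m < p") (auto simp: pos_sign_remove)
    show ?thesis
      unfolding G_def set sign
      using coeff_space_partial_commute[of m "\<sigma> - {m} - {p}" p, OF _ _ that(3) c] by simp
  qed
  have "(\<Sum>m\<in>\<sigma>. \<Sum>p\<in>\<sigma> - {m}. G m p) = (\<Sum>(m, p)\<in>(SIGMA m:\<sigma>. \<sigma> - {m}). G m p)"
    by (simp add: sum.Sigma)
  also have "\<dots> = (\<Sum>(m, p)\<in>(SIGMA m:\<sigma>. \<sigma> - {m}). G p m)"
    by (rule sum.reindex_bij_witness[of _ "\<lambda>(m, p). (p, m)" "\<lambda>(m, p). (p, m)"]) auto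
  also have "\<dots> = (\<Sum>(m, p)\<in>(SIGMA m:\<sigma>. \<sigma> - {m}). - G m p)"
    using anti by (intro sum.cong) auto
  also have "\<dots> = - (\<Sum>(m, p)\<in>(SIGMA m:\<sigma>. \<sigma> - {m}). G m p)"
    by (simp add: sum_negf case_prod_unfold)
  also have "\<dots> = - (\<Sum>m\<in>\<sigma>. \<Sum>p\<in>\<sigma> - {m}. G m p)"
    by (simp add: sum.Sigma)
  finally have "differential (differential c) \<sigma> \<tau> = - differential (differential c) \<sigma> \<tau>"
    unfolding D .
  then have "2 *\<^sub>R differential (differential c) \<sigma> \<tau> = 0"
    by (metis add.right_inverse scaleR_2)
  then show "differential (differential c) \<sigma> \<tau> = 0 \<sigma> \<tau>" by simp
qed

text \<open>
  Both sides remove two different indices from \<open>\<sigma>\<close>, one to be differentiated and one to be moved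
  to \<open>\<tau>\<close>, in opposite orders; exchanging the order changes the sign.
\<close>

lemma raise_differential:
  assumes "c \<in> coeffs_in \<S> k l"
  shows "raise (differential c) = - differential (raise c)"
proof (intro ext)
  fix \<sigma> \<tau>
  have c: "c \<sigma> \<tau> \<in> coeff_space \<S> \<sigma> \<tau>" for \<sigma> \<tau>
    using assms by (auto simp: coeffs_in_def)
  let ?u = "\<lambda>m p. partial p (c (\<sigma> - {m} - {p}) (insert m \<tau>))"
  define G where "G m p = (swap_sign m \<sigma> \<tau> * pos_sign p (\<sigma> - {m})) *\<^sub>R ?u m p" for m p
  have 1: "raise (differential c) \<sigma> \<tau> = (\<Sum>(m, p)\<in>(SIGMA m:\<sigma> - \<tau>. \<sigma> - {m}). G m p)"
    by (simp add: raise_def differential_def G_def scaleR_sum_right sum.Sigma)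
  have "differential (raise c) \<sigma> \<tau> = (\<Sum>p\<in>\<sigma>. \<Sum>m\<in>\<sigma> - {p} - \<tau>. - G m p)"
    unfolding differential_def
  proof (rule sum.cong[OF refl])
    fix p assume p: "p \<in> \<sigma>"
    have "c (\<sigma> - {p} - {m}) (insert m \<tau>) \<in> weakly_differentiable p" for m
      by (rule coeff_space_partial(1)[OF _ c]) auto
    then have "partial p (raise c (\<sigma> - {p}) \<tau>) =
        (\<Sum>m\<in>\<sigma> - {p} - \<tau>. swap_sign m (\<sigma> - {p}) \<tau> *\<^sub>R partial p (c (\<sigma> - {p} - {m}) (insert m \<tau>)))"
      unfolding raise_def by (intro linear_on_sum[OF linear_on_partial subspace_weakly_differentiable])
    also have "\<dots> = (\<Sum>m\<in>\<sigma> - {p} - \<tau>. pos_sign p \<sigma> *\<^sub>R (- G m p))"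
    proof (rule sum.cong[OF refl])
      fix m assume m: "m \<in> \<sigma> - {p} - \<tau>"
      have set: "\<sigma> - {p} - {m} = \<sigma> - {m} - {p}" by auto
      have sign: "swap_sign m (\<sigma> - {p}) \<tau> = - (pos_sign p \<sigma> * (swap_sign m \<sigma> \<tau> * pos_sign p (\<sigma> - {m})))"
        using m p pos_sign_square[of p \<sigma>]
        by (cases "m < p") (auto simp: swap_sign_def pos_sign_remove mult_ac)
      show "swap_sign m (\<sigma> - {p}) \<tau> *\<^sub>R partial p (c (\<sigma> - {p} - {m}) (insert m \<tau>)) = pos_sign p \<sigma> *\<^sub>R (- G m p)"
        unfolding G_def set sign by simp
    qed
    finally show "pos_sign p \<sigma> *\<^sub>R partial p (raise c (\<sigma> - {p}) \<tau>) = (\<Sum>m\<in>\<sigma> - {p} - \<tau>. - G m p)"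
      by (simp add: scaleR_sum_right del: scaleR_minus_right)
  qed
  also have "\<dots> = (\<Sum>(p, m)\<in>(SIGMA p:\<sigma>. \<sigma> - {p} - \<tau>). - G m p)"
    by (simp add: sum.Sigma)
  also have "\<dots> = (\<Sum>(m, p)\<in>(SIGMA m:\<sigma> - \<tau>. \<sigma> - {m}). - G m p)"
    by (rule sum.reindex_bij_witness[of _ "\<lambda>(m, p). (p, m)" "\<lambda>(m, p). (p, m)"]) auto
  also have "\<dots> = - raise (differential c) \<sigma> \<tau>"
    unfolding 1 by (simp add: sum_negf case_prod_unfold)
  finally show "raise (differential c) \<sigma> \<tau> = (- differential (raise c)) \<sigma> \<tau>" by simp
qed

lemma fin_form_space: "fin_subspace (form_space \<S> k l)"
proof -
  have "\<exists>F. finite F \<and> coeff_space \<S> \<sigma> \<tau> = span F" for \<sigma> \<tau>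
    unfolding coeff_space_def by (intro tensor_space_finite_dim finite_dim) (auto simp: of_bool_def)
  then obtain F where F: "\<And>\<sigma> \<tau>. finite (F \<sigma> \<tau>)" "\<And>\<sigma> \<tau>. coeff_space \<S> \<sigma> \<tau> = span (F \<sigma> \<tau>)"
    by metis
  let ?B = "\<lambda>\<sigma> \<tau> f. biform_scale f (form_tensor (dx_set \<sigma>) (dx_set \<tau>))"
  let ?F = "\<Union>\<sigma>. \<Union>\<tau>. ?B \<sigma> \<tau> ` F \<sigma> \<tau>"
  have "?B \<sigma> \<tau> f \<in> span ?F" if f: "f \<in> coeff_space \<S> \<sigma> \<tau>" for \<sigma> \<tau> f
  proof -
    have "?B \<sigma> \<tau> f \<in> span (?B \<sigma> \<tau> ` F \<sigma> \<tau>)"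
      using f unfolding F(2) linear_span_image[OF linear_biform_scale] by auto
    also have "\<dots> \<subseteq> span ?F" by (intro span_mono) auto
    finally show ?thesis .
  qed
  then have "form_space \<S> k l \<subseteq> span ?F"
    unfolding form_space_eq comb_def by (auto simp: coeffs_in_def intro!: span_sum)
  moreover have "fin_subspace (span ?F)"
    unfolding fin_subspace_def using F(1) by (intro conjI exI[of _ ?F]) auto
  ultimately show ?thesis by (rule fin_subspace_subset[OF _ subspace_form_space, rotated])
qed

end

section \<open>The discrete complexes form a BGG diagram\<close>

lemma biform_inner_commute: "biform_inner k l x y = biform_inner k l y x"
  by (simp add: biform_inner_def inner_commute)

lemma linear_biform_inner: "linear (\<lambda>x. biform_inner k l x y)"
  by (rule linearI)
    (simp_all add: biform_inner_def coeff_add coeff_scaleR inner_add_left sum.distrib sum_distrib_left)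

lemma biform_inner_comb: "bidegree k l c \<Longrightarrow> biform_inner k l (comb c) (comb c') = coeff_inner c c'"
  unfolding biform_inner_def coeff_inner_def coeff_comb
  by (intro sum_bidegree) (metis bidegree_def inner_zero_left)

lemma form_space_inner_definite:
  assumes "x \<in> form_space \<S> k l" "biform_inner k l x x = 0"
  shows "x = 0"
  using assms
  by (auto simp: form_space_eq coeffs_in_def biform_inner_comb coeff_inner_eq_0)

context tensor_product_spaces
begin

lemma complement_in_form_space:
  assumes R: "subspace R" "R \<subseteq> form_space \<S> k l" and x: "x \<in> form_space \<S> k l"
  shows "\<exists>r\<in>R. x - r \<in> form_space \<S> k l \<and> (\<forall>v\<in>R. biform_inner k l (x - r) v = 0)"
proof -
  obtain F where F: "finite F" "R = span F"
    using fin_subspace_subset[OF fin_form_space R] by (auto simp: fin_subspace_def)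
  obtain r where "r \<in> R" "\<forall>v\<in>R. biform_inner k l (x - r) v = 0"
    using orthogonal_decomposition[of "biform_inner k l" F x, OF linear_biform_inner biform_inner_commute F(1)]
      form_space_inner_definite R(2) F(2) by blast
  then show ?thesis
    using R(2) x subspace_diff[OF subspace_form_space] by blast
qed

lemma inj_on_s_map: "i < l \<Longrightarrow> inj_on s_map (form_space \<S> i l)"
proof (rule inj_onI)
  fix x y assume i: "i < l" and x: "x \<in> form_space \<S> i l" and y: "y \<in> form_space \<S> i l"
    and eq: "s_map x = s_map y"
  have "x - y \<in> form_space \<S> i l" by (rule subspace_diff[OF subspace_form_space x y])
  then obtain c where c: "x - y = comb c" "bidegree i l c" by (auto simp: form_space_eq coeffs_in_def)
  have "comb (raise c) = 0"
    using eq c(1) linear_diff[OF linear_s_map, of x y] by (simp flip: s_map_comb)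
  then have "raise c = coeff 0" by (metis coeff_comb)
  then have "raise c = 0" by (auto simp: fun_eq_iff coeff_def)
  then have "c = 0" by (rule raise_eq_0_imp[OF c(2) i])
  then show "x = y" using c(1) by simp
qed

lemma s_map_form_space: "x \<in> form_space \<S> i (Suc l) \<Longrightarrow> s_map x \<in> form_space \<S> (Suc i) l"
  by (auto simp: form_space_eq s_map_comb raise_coeffs_in)

text \<open>
  An element orthogonal to the range of \<open>S\<close> lies in the kernel of the adjoint, which is injective
  because the first degree \<open>Suc i\<close> exceeds the second degree \<open>l\<close>.
\<close>

lemma s_map_onto:
  assumes "l \<le> i"
  shows "s_map ` form_space \<S> i (Suc l) = form_space \<S> (Suc i) l"
proof (intro equalityI subsetI)
  show "y \<in> form_space \<S> (Suc i) l" if "y \<in> s_map ` form_space \<S> i (Suc l)" for y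
    using that s_map_form_space by auto
next
  fix y assume y: "y \<in> form_space \<S> (Suc i) l"
  let ?R = "s_map ` form_space \<S> i (Suc l)"
  have R: "subspace ?R" "?R \<subseteq> form_space \<S> (Suc i) l"
    using linear_subspace_image[OF linear_s_map subspace_form_space] s_map_form_space by auto
  obtain r where r: "r \<in> ?R" "y - r \<in> form_space \<S> (Suc i) l"
      "\<And>v. v \<in> ?R \<Longrightarrow> biform_inner (Suc i) l (y - r) v = 0"
    using complement_in_form_space[OF R y] by blast
  obtain c where c: "y - r = comb c" "c \<in> coeffs_in \<S> (Suc i) l"
    using r(2) by (auto simp: form_space_eq)
  have deg: "bidegree (Suc i) l c" using c(2) by (simp add: coeffs_in_def)
  have "comb (raise (lower c)) \<in> ?R"
    using lower_coeffs_in[OF c(2)] by (auto simp: form_space_eq simp flip: s_map_comb)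
  from r(3)[OF this] have "coeff_inner c (raise (lower c)) = 0"
    by (simp add: c(1) biform_inner_comb[OF deg])
  then have "coeff_inner (lower c) (lower c) = 0"
    using raise_adjoint[of "lower c" c] by (simp add: coeff_inner_commute)
  then have "lower c = 0" by (simp add: coeff_inner_eq_0)
  then have "c = 0" using assms by (intro lower_eq_0_imp[OF deg]) auto
  then show "y \<in> ?R" using c(1) r(1) by simp
qed

text \<open>
  The orthogonal projection onto \<open>range_perp\<close> coincides with the projection along the range of \<open>S\<close>,
  since the latter subtracts an element orthogonal to \<open>range_perp\<close>.
\<close>

lemma bgg_diagram_forms:
  assumes J: "1 \<le> J"
  shows "bgg_diagram (\<lambda>i. form_space \<S> i (J - 1)) (\<lambda>i. form_space \<S> i J) (range_perp \<S> J)
    (\<lambda>i. ext_deriv i (J - 1)) (\<lambda>i. ext_deriv i J)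
    (\<lambda>i. orthogonal_projection i (J - 1) (range_perp \<S> J i)) s_map J"
proof (rule bgg_diagram.intro)
  obtain l where l: "J = Suc l" using J by (cases J) auto
  fix i
  show "1 \<le> J" by (rule J)
  show "fin_subspace (form_space \<S> i (J - 1))" "fin_subspace (form_space \<S> i J)"
    by (rule fin_form_space)+
  have lin: "linear_on (form_space \<S> i l) (ext_deriv i l)" for l
  proof -
    have add: "ext_deriv i l (comb x + comb y) = comb (differential x) + comb (differential y)"
      if "x \<in> coeffs_in \<S> i l" "y \<in> coeffs_in \<S> i l" for x y
    proof -
      have "x + y \<in> coeffs_in \<S> i l" by (rule subspace_add[OF subspace_coeffs_in that])
      then have "ext_deriv i l (comb (x + y)) = comb (differential (x + y))"
        by (intro ext_deriv_comb) (simp add: coeffs_in_def)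
      then show ?thesis
        using that by (simp add: linear_add[OF linear_comb] linear_onD(1)[OF linear_on_differential])
    qed
    have scale: "ext_deriv i l (a *\<^sub>R comb x) = a *\<^sub>R comb (differential x)" if "x \<in> coeffs_in \<S> i l" for a x
    proof -
      have "a *\<^sub>R x \<in> coeffs_in \<S> i l" by (rule subspace_scale[OF subspace_coeffs_in that])
      then have "ext_deriv i l (comb (a *\<^sub>R x)) = comb (differential (a *\<^sub>R x))"
        by (intro ext_deriv_comb) (simp add: coeffs_in_def)
      then show ?thesis
        using that by (simp add: linear_scale[OF linear_comb] linear_onD(2)[OF linear_on_differential])
    qed
    have "ext_deriv i l (comb x) = comb (differential x)" if "x \<in> coeffs_in \<S> i l" for x
      using that by (intro ext_deriv_comb) (simp add: coeffs_in_def)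
    then show ?thesis
      unfolding linear_on_def form_space_eq by (auto simp: add scale)
  qed
  show "linear_on (form_space \<S> i (J - 1)) (ext_deriv i (J - 1))" "linear_on (form_space \<S> i J) (ext_deriv i J)"
    by (rule lin)+
  have dcomb: "ext_deriv i l (comb c) = comb (differential c) \<and> differential c \<in> coeffs_in \<S> (Suc i) l"
    if "c \<in> coeffs_in \<S> i l" for c i l
    using that differential_coeffs_in[OF that] by (auto intro: ext_deriv_comb simp: coeffs_in_def)
  have d_in: "x \<in> form_space \<S> i l \<Longrightarrow> ext_deriv i l x \<in> form_space \<S> (Suc i) l" for x l
    using dcomb by (auto simp: form_space_eq)
  have d_d: "x \<in> form_space \<S> i l \<Longrightarrow> ext_deriv (Suc i) l (ext_deriv i l x) = 0" for x l
    using dcomb differential_differential by (auto simp: form_space_eq)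
  show "x \<in> form_space \<S> i (J - 1) \<Longrightarrow> ext_deriv i (J - 1) x \<in> form_space \<S> (Suc i) (J - 1)"
    "x \<in> form_space \<S> i J \<Longrightarrow> ext_deriv i J x \<in> form_space \<S> (Suc i) J"
    "x \<in> form_space \<S> i (J - 1) \<Longrightarrow> ext_deriv (Suc i) (J - 1) (ext_deriv i (J - 1) x) = 0"
    "x \<in> form_space \<S> i J \<Longrightarrow> ext_deriv (Suc i) J (ext_deriv i J x) = 0" for x
    by (rule d_in d_d; assumption)+
  show "linear (s_map :: 'n L2_biform \<Rightarrow> _)" by (rule linear_s_map)
  show "s_map x \<in> form_space \<S> (Suc i) (J - 1)" if "x \<in> form_space \<S> i J" for x
    using that s_map_form_space l by simp
  show "s_map (ext_deriv i J x) = - ext_deriv (Suc i) (J - 1) (s_map x)" if x: "x \<in> form_space \<S> i J" for x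
  proof -
    obtain c where c: "x = comb c" "c \<in> coeffs_in \<S> i (Suc l)" using x l by (auto simp: form_space_eq)
    have "s_map (ext_deriv i J x) = comb (raise (differential c))"
      using dcomb[OF c(2)] c(1) l by (simp add: s_map_comb)
    also have "\<dots> = - comb (differential (raise c))"
      by (simp add: raise_differential[OF c(2)] linear_neg[OF linear_comb])
    also have "comb (differential (raise c)) = ext_deriv (Suc i) (J - 1) (s_map x)"
      using dcomb[OF raise_coeffs_in[OF c(2)]] c(1) l by (simp add: s_map_comb)
    finally show ?thesis .
  qed
  show "i < J \<Longrightarrow> inj_on s_map (form_space \<S> i J)" by (rule inj_on_s_map)
  show "J \<le> Suc i \<Longrightarrow> s_map ` form_space \<S> i J = form_space \<S> (Suc i) (J - 1)"
    using s_map_onto[of l i] l by simp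
  let ?ip = "biform_inner i (J - 1)" and ?A = "form_space \<S> i (J - 1)" and ?U = "range_perp \<S> J i"
  let ?R = "if i = 0 then {0} else s_map ` form_space \<S> (i - 1) J"
  have U: "?U = {x \<in> ?A. \<forall>v\<in>?R. ?ip x v = 0}" by (simp only: range_perp_def)
  have sR: "subspace ?R"
    using linear_subspace_image[OF linear_s_map subspace_form_space] by auto
  have RA: "?R \<subseteq> ?A"
    using s_map_form_space[of _ "i - 1" l] l subspace_0[OF subspace_form_space] by auto
  show sU: "subspace ?U"
    unfolding U
    using subspace_0[OF subspace_form_space] subspace_add[OF subspace_form_space] subspace_scale[OF subspace_form_space]
    by (auto simp: subspace_def linear_0[OF linear_biform_inner] linear_add[OF linear_biform_inner]
        linear_scale[OF linear_biform_inner])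
  show UA: "?U \<subseteq> ?A" unfolding U by auto
  show "?U \<inter> ?R = {0}"
  proof (intro equalityI subsetI)
    fix x assume x: "x \<in> ?U \<inter> ?R"
    then have "?ip x x = 0" "x \<in> ?A" unfolding U by blast+
    then show "x \<in> {0}" using form_space_inner_definite by blast
  next
    show "x \<in> ?U \<inter> ?R" if "x \<in> {0}" for x
      using that subspace_0[OF sU] subspace_0[OF sR] by simp
  qed
  have P: "orthogonal_projection i (J - 1) ?U x \<in> ?U \<and> x - orthogonal_projection i (J - 1) ?U x \<in> ?R"
    if x: "x \<in> ?A" for x
  proof -
    obtain r where r: "r \<in> ?R" "x - r \<in> ?A" "\<forall>v\<in>?R. ?ip (x - r) v = 0"
      using complement_in_form_space[OF sR RA x] by blast
    then have u: "x - r \<in> ?U" unfolding U by blast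
    have "orthogonal_projection i (J - 1) ?U x = x - r"
      unfolding orthogonal_projection_def
    proof (rule the_equality)
      have "?ip r v = 0" if "v \<in> ?U" for v
        using that r(1) biform_inner_commute[of i "J - 1" r v] unfolding U by auto
      then show 1: "x - r \<in> ?U \<and> (\<forall>v\<in>?U. ?ip (x - (x - r)) v = 0)" using u by simp
      fix w assume w: "w \<in> ?U \<and> (\<forall>v\<in>?U. ?ip (x - w) v = 0)"
      then have d: "w - (x - r) \<in> ?U" using u subspace_diff[OF sU] by blast
      have "?ip (w - (x - r)) (w - (x - r)) = ?ip ((x - (x - r)) - (x - w)) (w - (x - r))"
        by (rule arg_cong2[where f = ?ip]) (simp_all add: algebra_simps)
      also have "\<dots> = ?ip (x - (x - r)) (w - (x - r)) - ?ip (x - w) (w - (x - r))"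
        by (rule linear_diff[OF linear_biform_inner])
      also have "\<dots> = 0" using 1 w d by simp
      finally have "w - (x - r) = 0"
        using form_space_inner_definite d UA by blast
      then show "w = x - r" by simp
    qed
    then show ?thesis using u r(1) by simp
  qed
  show "orthogonal_projection i (J - 1) ?U x \<in> ?U" if "x \<in> ?A" for x using P[OF that] by blast
  show "x - orthogonal_projection i (J - 1) ?U x \<in> ?R" if "x \<in> ?A" for x using P[OF that] by blast
qed

end


theorem theorem1:
  fixes \<S> :: "'n::{finite,linorder} \<Rightarrow> nat \<Rightarrow> real L2 set"
    and J k :: nat
  assumes J: "1 \<le> J" "J \<le> CARD('n)"
    and subspace: "\<And>m a. a \<le> 2 \<Longrightarrow> subspace (\<S> m a)"
    and finite_dim: "\<And>m a. a \<le> 2 \<Longrightarrow> \<exists>B. finite B \<and> \<S> m a = span B"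
    and differentiable: "\<And>m a f. a \<le> 1 \<Longrightarrow> f \<in> \<S> m a \<Longrightarrow> \<exists>g. has_weak_derivative 1 f g"
    and onto: "\<And>m a. a \<le> 1 \<Longrightarrow> weak_derivative 1 ` \<S> m a = \<S> m (a + 1)"
    and k: "k \<le> CARD('n)"
  shows "cohomology_dim (bgg_space \<S> J) (bgg_op \<S> J) k \<le>
           cohomology_dim (\<lambda>i. form_space \<S> i (J - 1)) (\<lambda>i. ext_deriv i (J - 1)) k +
           cohomology_dim (\<lambda>i. form_space \<S> i J) (\<lambda>i. ext_deriv i J) k"
proof -
  interpret tensor_product_spaces \<S>
    by unfold_locales (fact finite_dim differentiable onto)+
  interpret bgg_diagram "\<lambda>i. form_space \<S> i (J - 1)" "\<lambda>i. form_space \<S> i J" "range_perp \<S> J"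
    "\<lambda>i. ext_deriv i (J - 1)" "\<lambda>i. ext_deriv i J"
    "\<lambda>i. orthogonal_projection i (J - 1) (range_perp \<S> J i)" s_map J
    by (rule bgg_diagram_forms[OF J(1)])
  have "Y = bgg_space \<S> J" by (rule ext) (simp add: Y_def bgg_space_def)
  moreover have "D = bgg_op \<S> J" by (rule ext)+ (simp only: D_def bgg_op_def)
  ultimately show ?thesis using cohomology_bound[of k] by simp
qed

end
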